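(* Let $(L,\mathbb{F})$ be a Lévy process on $(\Omega,\mathscr{F},\mathbb{P};\mathbb{F})$ with finite horizon $T>0$, and assume that $L$ is not monotone, i.e. neither $L$ nor $-L$ is a subordinator. Then $$\inf_{\mathbb{Q}\in\mathscr{M}_{efl}}I_T(\mathbb{Q},\mathbb{P})=\inf_{\mathbb{Q}\in\mathscr{M}_a}I_T(\mathbb{Q},\mathbb{P})=\inf_{\mathbb{Q}\in\mathscr{M}^{\rm loc}_a}I_T(\mathbb{Q},\mathbb{P})=\inf_{\mathbb{Q}\in\tilde{\mathscr{M}}^{\rm loc}_a}I_T(\mathbb{Q},\mathbb{P}).$$
   Context: Time runs over $[0,T]$, $\mathbb{F}=(\mathscr{F}_t)_{t\in[0,T]}$, and $(L,\mathbb{F})$ is a real-valued Lévy process with respect to $\mathbb{F}$ under $\mathbb{P}$ (càdlàg, $L_0=0$, $\mathbb{F}$-adapted, stationary increments $L_t-L_s$ independent of $\mathscr{F}_s$). Probability measures below are considered on $\mathscr{F}_T$. Relative entropy: $I_T(\mathbb{Q},\mathbb{P})=\mathbb{E}_{\mathbb{P}}\big[\frac{d\mathbb{Q}}{d\mathbb{P}}|_{\mathscr{F}_T}\log\frac{d\mathbb{Q}}{d\mathbb{P}}|_{\mathscr{F}_T}\big]$ if $\mathbb{Q}|_{\mathscr{F}_T}\ll\mathbb{P}|_{\mathscr{F}_T}$, and $+\infty$ otherwise. A probability measure $\mathbb{Q}$ is Lévy preserving if $(L,\mathbb{F})$ is a Lévy process with respect to $\mathbb{Q}$. Classes: - $\mathscr{M}_a$: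 all $\mathbb{Q}$ with $\mathbb{Q}|_{\mathscr{F}_T}\ll\mathbb{P}|_{\mathscr{F}_T}$ such that $(L,\mathbb{F})$ is a $\mathbb{Q}$-martingale. - $\mathscr{M}_{efl}$: all $\mathbb{Q}$ with $\mathbb{Q}|_{\mathscr{F}_T}\sim\mathbb{P}|_{\mathscr{F}_T}$ such that $(L,\mathbb{F})$ is a $\mathbb{Q}$-martingale, $I_T(\mathbb{Q},\mathbb{P})<+\infty$, and $\mathbb{Q}$ is Lévy preserving. - $\mathscr{M}^{\rm loc}_a$: all $\mathbb{Q}$ with $\mathbb{Q}|_{\mathscr{F}_T}\ll\mathbb{P}|_{\mathscr{F}_T}$ such that $(L,\mathbb{F})$ is a $\mathbb{Q}$-local martingale. - $\tilde{\mathscr{M}}^{\rm loc}_a$: all $\mathbb{Q}$ with $\mathbb{Q}|_{\mathscr{F}_T}\ll\mathbb{P}|_{\mathscr{F}_T}$ for which there is a sequence $(\tau_k)_{k\ge1}$ of $\mathbb{F}$-stopping times such that $\{\tau_k=T\}\uparrow\Omega$ as $k\to\infty$ and $\mathbb{E}_{\mathbb{Q}}[L_{\tau_k\wedge T}]=0$ (in particular this expectation exists) for all $k\ge1$. *)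

theory Defs
  imports "HOL-Probability.Probability"
begin

text \<open>
  The time set is the interval \<open>{0..T}\<close> of the type \<^typ>\<open>real\<close>. Filtrations \<open>F\<close> and
  processes \<open>L\<close> are total functions of a real time argument, but only their values at times in
  \<open>{0..T}\<close> are constrained. The notions \<^const>\<open>filtration\<close> and \<^const>\<open>stopping_time\<close>, which
  quantify over the whole index type, are therefore relativised to \<open>{0..T}\<close> here. The usual
  conditions (completeness, right-continuity) are not part of the definition.
\<close>

definition filtered_prob_space :: "'a measure \<Rightarrow> (real \<Rightarrow> 'a measure) \<Rightarrow> real \<Rightarrow> bool" where
  "filtered_prob_space M F T \<longleftrightarrow>
     prob_space M \<and>
     (\<forall>t\<in>{0..T}. subalgebra M (F t)) \<and>
     (\<forall>s\<in>{0..T}. \<forall>t\<in>{0..T}. s \<le> t \<longrightarrow> sets (F s) \<subseteq> sets (F t))"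

text \<open>All values above \<open>T\<close> play the role of \<open>\<infinity>\<close>.\<close>

definition stopping_time_upto :: "(real \<Rightarrow> 'a measure) \<Rightarrow> real \<Rightarrow> ('a \<Rightarrow> real) \<Rightarrow> bool" where
  "stopping_time_upto F T \<tau> \<longleftrightarrow>
     (\<forall>\<omega>\<in>space (F T). 0 \<le> \<tau> \<omega>) \<and>
     (\<forall>t\<in>{0..T}. Measurable.pred (F t) (\<lambda>\<omega>. \<tau> \<omega> \<le> t))"

definition adapted_process ::
    "(real \<Rightarrow> 'a measure) \<Rightarrow> real \<Rightarrow> (real \<Rightarrow> 'a \<Rightarrow> real) \<Rightarrow> bool" where
  "adapted_process F T X \<longleftrightarrow> (\<forall>t\<in>{0..T}. X t \<in> borel_measurable (F t))"

definition cadlag_on :: "real \<Rightarrow> (real \<Rightarrow> real) \<Rightarrow> bool" where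
  "cadlag_on T f \<longleftrightarrow>
     (\<forall>t\<in>{0..<T}. continuous (at_right t) f) \<and>
     (\<forall>t\<in>{0<..T}. \<exists>l. (f \<longlongrightarrow> l) (at_left t))"

definition levy_process ::
    "'a measure \<Rightarrow> (real \<Rightarrow> 'a measure) \<Rightarrow> real \<Rightarrow> (real \<Rightarrow> 'a \<Rightarrow> real) \<Rightarrow> bool" where
  "levy_process M F T L \<longleftrightarrow>
     filtered_prob_space M F T \<and>
     adapted_process F T L \<and>
     (\<forall>\<omega>\<in>space M. L 0 \<omega> = 0) \<and>
     (\<forall>\<omega>\<in>space M. cadlag_on T (\<lambda>t. L t \<omega>)) \<and>
     (\<forall>s\<in>{0..T}. \<forall>t\<in>{s..T}.
        distr M borel (\<lambda>\<omega>. L t \<omega> - L s \<omega>) = distr M borel (\<lambda>\<omega>. L (t - s) \<omega> - L 0 \<omega>)) \<and>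
     (\<forall>s\<in>{0..T}. \<forall>t\<in>{s..T}.
        prob_space.indep_set M (sets (F s))
          {(\<lambda>\<omega>. L t \<omega> - L s \<omega>) -` B \<inter> space M | B. B \<in> sets borel})"

definition subordinator ::
    "'a measure \<Rightarrow> (real \<Rightarrow> 'a measure) \<Rightarrow> real \<Rightarrow> (real \<Rightarrow> 'a \<Rightarrow> real) \<Rightarrow> bool" where
  "subordinator M F T L \<longleftrightarrow>
     levy_process M F T L \<and> (AE \<omega> in M. mono_on {0..T} (\<lambda>t. L t \<omega>))"

definition martingale_upto ::
    "'a measure \<Rightarrow> (real \<Rightarrow> 'a measure) \<Rightarrow> real \<Rightarrow> (real \<Rightarrow> 'a \<Rightarrow> real) \<Rightarrow> bool" where
  "martingale_upto Q F T X \<longleftrightarrow>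
     filtered_prob_space Q F T \<and>
     adapted_process F T X \<and>
     (\<forall>t\<in>{0..T}. integrable Q (X t)) \<and>
     (\<forall>s\<in>{0..T}. \<forall>t\<in>{s..T}. AE \<omega> in Q. real_cond_exp Q (F s) (X t) \<omega> = X s \<omega>)"

text \<open>
  The localizing sequence is, \<open>Q\<close>-almost surely, increasing and eventually at least \<open>T\<close>.
  As all processes considered start at 0, no initial value has to be subtracted.
\<close>

definition local_martingale_upto ::
    "'a measure \<Rightarrow> (real \<Rightarrow> 'a measure) \<Rightarrow> real \<Rightarrow> (real \<Rightarrow> 'a \<Rightarrow> real) \<Rightarrow> bool" where
  "local_martingale_upto Q F T X \<longleftrightarrow>
     (\<exists>\<tau> :: nat \<Rightarrow> 'a \<Rightarrow> real.
        (\<forall>k. stopping_time_upto F T (\<tau> k)) \<and>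
        (AE \<omega> in Q. incseq (\<lambda>k. \<tau> k \<omega>)) \<and>
        (AE \<omega> in Q. \<exists>k. T \<le> \<tau> k \<omega>) \<and>
        (\<forall>k. martingale_upto Q F T (\<lambda>t \<omega>. X (min t (\<tau> k \<omega>)) \<omega>)))"

text \<open>
  Expectation in the extended sense, meaningful as soon as the positive or the negative part has
  finite integral (the coercion \<^const>\<open>ennreal\<close> cuts off negative values).
\<close>

definition ext_expectation :: "'a measure \<Rightarrow> ('a \<Rightarrow> real) \<Rightarrow> ereal" where
  "ext_expectation M f =
     enn2ereal (\<integral>\<^sup>+\<omega>. ennreal (f \<omega>) \<partial>M) - enn2ereal (\<integral>\<^sup>+\<omega>. ennreal (- f \<omega>) \<partial>M)"

text \<open>
  Relative entropy of \<open>Q\<close> with respect to \<open>P\<close> on the sub-\<open>\<sigma>\<close>-algebra \<open>G\<close>. Since \<open>x ln x\<close> is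
  bounded below by \<open>- 1 / e\<close> (with value 0 at \<open>x = 0\<close>), the expectation always exists
  in \<open>(-\<infinity>, \<infinity>]\<close>.
\<close>

definition rel_entropy :: "'a measure \<Rightarrow> 'a measure \<Rightarrow> 'a measure \<Rightarrow> ereal" where
  "rel_entropy G Q P =
     (let P' = restr_to_subalg P G;
          Q' = restr_to_subalg Q G;
          Z = (\<lambda>\<omega>. enn2real (RN_deriv P' Q' \<omega>))
      in if absolutely_continuous P' Q'
         then ext_expectation P' (\<lambda>\<omega>. Z \<omega> * ln (Z \<omega>))
         else \<infinity>)"

text \<open>The classes consist of probability measures \<open>Q\<close> on the \<open>\<sigma>\<close>-algebra \<open>F T\<close>.\<close>

definition prob_ac ::
    "'a measure \<Rightarrow> (real \<Rightarrow> 'a measure) \<Rightarrow> real \<Rightarrow> 'a measure set" where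
  "prob_ac P F T =
     {Q. prob_space Q \<and> sets Q = sets (F T) \<and>
         absolutely_continuous (restr_to_subalg P (F T)) Q}"

definition M_a ::
    "'a measure \<Rightarrow> (real \<Rightarrow> 'a measure) \<Rightarrow> real \<Rightarrow> (real \<Rightarrow> 'a \<Rightarrow> real) \<Rightarrow> 'a measure set" where
  "M_a P F T L = {Q \<in> prob_ac P F T. martingale_upto Q F T L}"

definition M_efl ::
    "'a measure \<Rightarrow> (real \<Rightarrow> 'a measure) \<Rightarrow> real \<Rightarrow> (real \<Rightarrow> 'a \<Rightarrow> real) \<Rightarrow> 'a measure set" where
  "M_efl P F T L =
     {Q \<in> prob_ac P F T.
        absolutely_continuous Q (restr_to_subalg P (F T)) \<and>
        martingale_upto Q F T L \<and>
        rel_entropy (F T) Q P < \<infinity> \<and>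
        levy_process Q F T L}"

definition M_a_loc ::
    "'a measure \<Rightarrow> (real \<Rightarrow> 'a measure) \<Rightarrow> real \<Rightarrow> (real \<Rightarrow> 'a \<Rightarrow> real) \<Rightarrow> 'a measure set" where
  "M_a_loc P F T L = {Q \<in> prob_ac P F T. local_martingale_upto Q F T L}"

definition M_a_loc_tilde ::
    "'a measure \<Rightarrow> (real \<Rightarrow> 'a measure) \<Rightarrow> real \<Rightarrow> (real \<Rightarrow> 'a \<Rightarrow> real) \<Rightarrow> 'a measure set" where
  "M_a_loc_tilde P F T L =
     {Q \<in> prob_ac P F T.
        \<exists>\<tau> :: nat \<Rightarrow> 'a \<Rightarrow> real.
          (\<forall>k. stopping_time_upto F T (\<tau> k)) \<and>
          incseq (\<lambda>k. {\<omega> \<in> space Q. \<tau> k \<omega> = T}) \<and>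
          (\<Union>k. {\<omega> \<in> space Q. \<tau> k \<omega> = T}) = space Q \<and>
          (\<forall>k. integrable Q (\<lambda>\<omega>. L (min (\<tau> k \<omega>) T) \<omega>) \<and>
               (\<integral>\<omega>. L (min (\<tau> k \<omega>) T) \<omega> \<partial>Q) = 0)}"

end

theory Submission
  imports Defs
begin

text \<open>
  The common value of the four infima is \<open>- ln\<close> of the infimum over \<open>\<theta>\<close> of
  \<open>E exp (\<theta> * L T)\<close>.

  \<^emph>\<open>Lower bound.\<close> Let \<open>E exp (\<theta> * L T) = exp (\<kappa> * T)\<close> be finite. The process
  \<open>exp (\<theta> * L t - \<kappa> * t)\<close> is a martingale under \<open>P\<close>, so its value at a bounded stopping time
  has expectation at most 1 (\<open>exp_martingale_stopped_le_1\<close>). The Gibbs variational inequality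
  (\<open>rel_entropy_ge_integral\<close>) bounds the entropy of \<open>Q\<close> from below by the \<open>Q\<close>-expectation of the
  exponent \<open>\<theta> * L \<tau> - \<kappa> * \<tau>\<close>. If \<open>L \<tau>\<close> has mean 0 under \<open>Q\<close>, then only \<open>- \<kappa> * E \<tau>\<close> remains, and
  along stopping times that increase to \<open>T\<close> this tends to \<open>- \<kappa> * T\<close>. All four classes provide
  such stopping times.

  \<^emph>\<open>Upper bound.\<close> If \<open>\<theta>\<close> minimises
  \<open>E exp (\<theta> * L T)\<close> and the minimum is a critical point, the Esscher transform with density
  proportional to \<open>exp (\<theta> * L T)\<close> is Levy preserving, gives \<open>L T\<close>
  mean 0, and attains the bound. In general, however, \<open>L\<close> need not have exponential
  moments nor the minimum be a critical point. So the large jumps are damped first: the density is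
  multiplied by \<open>exp (- A)\<close>, where \<open>A\<close> sums a superlinear penalty over
  the jumps larger than \<open>n + 1\<close>. This factor is multiplicative over adjacent time
  intervals, hence it keeps the increments stationary and independent
  (\<open>levy_tilted\<close>); it makes all exponential moments finite
  (\<open>damped_exp_moment_finite\<close>); and as \<open>A\<close> is nonnegative it can only
  help the entropy (\<open>rel_entropy_tilted_le\<close>). Since \<open>L\<close> is not monotone,
  \<open>L T\<close> takes both signs with positive probability
  (\<open>nonmonotone_both_signs\<close>), so the damped moment generating function tends to
  infinity in both directions and has a critical minimiser. As \<open>n\<close> grows the damping
  disappears, and a limit point of the minimisers yields a \<open>\<theta>\<close> for which the
  lower bound is matched (\<open>INF_M_efl_le\<close>).

  The Levy-Ito decomposition is avoided. The penalty functional is the pathwise limit of sums over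
  increments along dyadic grids, and all distributional statements are first proved for grid times,
  where they follow from finitely many independent steps, and then carried over by dominated
  convergence or Fatou's lemma. In particular the exponential moments come from an exit-time
  recursion for the damped random walk on the grid (\<open>exp_mom_short_bound\<close>).
\<close>

section \<open>Dyadic grids and cadlag paths\<close>

definition grid :: "real \<Rightarrow> nat \<Rightarrow> nat \<Rightarrow> real" where
  "grid T m i = T * real i / 2 ^ m"

text \<open>
  Times are approximated by grid times from above, because paths are right-continuous and events
  observed before a time remain observable later.
\<close>

definition grid_above :: "real \<Rightarrow> nat \<Rightarrow> real \<Rightarrow> nat" where
  "grid_above T m x = nat \<lceil>x * 2 ^ m / T\<rceil>"

lemma grid_0 [simp]: "grid T m 0 = 0"
  by (simp add: grid_def)

lemma grid_top [simp]: "grid T m (2 ^ m) = T"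
  by (simp add: grid_def)

lemma grid_nonneg [simp]: "0 < T \<Longrightarrow> 0 \<le> grid T m i"
  by (simp add: grid_def)

lemma grid_le_iff [simp]: "0 < T \<Longrightarrow> grid T m i \<le> grid T m j \<longleftrightarrow> i \<le> j"
  by (simp add: grid_def divide_le_cancel)

lemma grid_less_iff [simp]: "0 < T \<Longrightarrow> grid T m i < grid T m j \<longleftrightarrow> i < j"
  by (simp add: grid_def divide_less_cancel)

lemma grid_le_T: "0 < T \<Longrightarrow> grid T m i \<le> T \<longleftrightarrow> i \<le> 2 ^ m"
  using grid_le_iff[of T m i "2 ^ m"] by (simp del: grid_le_iff)

lemma grid_diff: "i \<le> j \<Longrightarrow> grid T m j - grid T m i = grid T m (j - i)"
  by (simp add: grid_def of_nat_diff right_diff_distrib diff_divide_distrib)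

lemma grid_add: "grid T m (i + j) = grid T m i + grid T m j"
  by (simp add: grid_def algebra_simps add_divide_distrib)

lemma grid_Suc: "grid T m (Suc i) = grid T m i + T / 2 ^ m"
  by (simp add: grid_def field_simps)

lemma grid_refine: "k \<le> m \<Longrightarrow> grid T m (i * 2 ^ (m - k)) = grid T k i"
proof -
  assume "k \<le> m"
  hence "(2::real) ^ m = 2 ^ k * 2 ^ (m - k)" by (simp flip: power_add)
  thus ?thesis by (simp add: grid_def)
qed

lemma mesh_tendsto_0: "(\<lambda>m. T / 2 ^ m :: real) \<longlonglongrightarrow> 0"
  using LIMSEQ_divide_realpow_zero[of 2 T] by simp

lemma grid_above_props:
  assumes "0 < T" "0 \<le> x" "x \<le> T"
  shows "x \<le> grid T m (grid_above T m x)"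
    and "grid T m (grid_above T m x) < x + T / 2 ^ m"
    and "grid_above T m x \<le> 2 ^ m"
proof -
  let ?y = "x * 2 ^ m / T"
  have y: "0 \<le> ?y" "?y \<le> 2 ^ m" using assms by (simp_all add: field_simps)
  have c: "real (grid_above T m x) = real_of_int \<lceil>?y\<rceil>"
    unfolding grid_above_def using y by (simp add: ceiling_le_iff)
  have "?y \<le> real (grid_above T m x)" unfolding c by (rule le_of_int_ceiling)
  thus "x \<le> grid T m (grid_above T m x)"
    using assms by (simp add: grid_def field_simps)
  have "real (grid_above T m x) < ?y + 1" unfolding c by linarith
  hence "real (grid_above T m x) * T < x * 2 ^ m + T"
    using assms by (simp add: field_simps)
  thus "grid T m (grid_above T m x) < x + T / 2 ^ m"
    using assms by (simp add: grid_def field_simps)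
  have "\<lceil>?y\<rceil> \<le> 2 ^ m" using y(2) by (simp add: ceiling_le_iff)
  thus "grid_above T m x \<le> 2 ^ m"
    unfolding grid_above_def by (simp add: nat_le_iff)
qed

lemma grid_above_mono: "0 < T \<Longrightarrow> x \<le> y \<Longrightarrow> grid_above T m x \<le> grid_above T m y"
  unfolding grid_above_def by (intro nat_mono ceiling_mono divide_right_mono mult_right_mono) auto

lemma grid_above_tendsto:
  assumes "0 < T" "0 \<le> x" "x \<le> T"
  shows "(\<lambda>m. grid T m (grid_above T m x)) \<longlonglongrightarrow> x"
proof (rule tendsto_sandwich[OF _ _ tendsto_const])
  show "\<forall>\<^sub>F m in sequentially. x \<le> grid T m (grid_above T m x)"
    using grid_above_props(1)[OF assms] by simp
  show "\<forall>\<^sub>F m in sequentially. grid T m (grid_above T m x) \<le> x + T / 2 ^ m"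
    using grid_above_props(2)[OF assms] by (simp add: less_imp_le)
  show "(\<lambda>m. x + T / 2 ^ m) \<longlonglongrightarrow> x"
    using tendsto_add[OF tendsto_const[of x] mesh_tendsto_0[of T]] by simp
qed

text \<open>
  One number \<open>l\<close>, the left limit at \<open>x\<close>, serves for all \<open>e\<close>; at \<open>x = 0\<close> it is arbitrary, since
  no time precedes 0.
\<close>

lemma cadlag_on_local:
  assumes "cadlag_on T f" "0 \<le> x" "x \<le> T"
  obtains l where
    "\<forall>e>0. \<exists>d>0. (\<forall>u. x \<le> u \<and> u < x + d \<and> u \<le> T \<longrightarrow> \<bar>f u - f x\<bar> < e) \<and>
                              (\<forall>u. x - d < u \<and> u < x \<and> 0 \<le> u \<longrightarrow> \<bar>f u - l\<bar> < e)"
proof -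
  have R: "\<exists>d>0. \<forall>u. x \<le> u \<and> u < x + d \<and> u \<le> T \<longrightarrow> \<bar>f u - f x\<bar> < e" if "0 < e" for e
  proof (cases "x < T")
    case True
    hence "(f \<longlongrightarrow> f x) (at_right x)"
      using assms by (auto simp: cadlag_on_def continuous_within)
    hence "\<forall>\<^sub>F u in at_right x. dist (f u) (f x) < e" using that by (rule tendstoD)
    then obtain b where "b > x" "\<And>u. x < u \<Longrightarrow> u < b \<Longrightarrow> dist (f u) (f x) < e"
      by (auto simp: eventually_at_right_field)
    thus ?thesis using that
      by (intro exI[of _ "b - x"]) (auto simp: dist_real_def less_eq_real_def)
  next
    case False
    thus ?thesis using that assms by (intro exI[of _ 1]) auto
  qed
  have "\<exists>l. \<forall>e>0. \<exists>d>0. \<forall>u. x - d < u \<and> u < x \<and> 0 \<le> u \<longrightarrow> \<bar>f u - l\<bar> < e"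
  proof (cases "0 < x")
    case True
    hence "\<exists>l. (f \<longlongrightarrow> l) (at_left x)" using assms by (simp add: cadlag_on_def)
    then obtain l where l: "(f \<longlongrightarrow> l) (at_left x)" ..
    show ?thesis
    proof (rule exI[of _ l], intro allI impI)
      fix e :: real assume "0 < e"
      with l have "\<forall>\<^sub>F u in at_left x. dist (f u) l < e" by (rule tendstoD)
      then obtain b where "b < x" "\<And>u. b < u \<Longrightarrow> u < x \<Longrightarrow> dist (f u) l < e"
        by (auto simp: eventually_at_left_field)
      thus "\<exists>d>0. \<forall>u. x - d < u \<and> u < x \<and> 0 \<le> u \<longrightarrow> \<bar>f u - l\<bar> < e"
        by (intro exI[of _ "x - b"]) (auto simp: dist_real_def)
    qed
  next
    case False
    thus ?thesis by (intro exI[of _ 0]) (auto intro!: exI[of _ 1])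
  qed
  then obtain l where L: "\<And>e. 0 < e \<Longrightarrow> \<exists>d>0. \<forall>u. x - d < u \<and> u < x \<and> 0 \<le> u \<longrightarrow> \<bar>f u - l\<bar> < e"
    by blast
  show thesis
  proof (rule that[of l], intro allI impI)
    fix e :: real assume "0 < e"
    from R[OF this] L[OF this] obtain d1 d2 where
      "d1 > 0" "\<forall>u. x \<le> u \<and> u < x + d1 \<and> u \<le> T \<longrightarrow> \<bar>f u - f x\<bar> < e"
      "d2 > 0" "\<forall>u. x - d2 < u \<and> u < x \<and> 0 \<le> u \<longrightarrow> \<bar>f u - l\<bar> < e" by blast
    thus "\<exists>d>0. (\<forall>u. x \<le> u \<and> u < x + d \<and> u \<le> T \<longrightarrow> \<bar>f u - f x\<bar> < e) \<and>
                 (\<forall>u. x - d < u \<and> u < x \<and> 0 \<le> u \<longrightarrow> \<bar>f u - l\<bar> < e)"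
      by (intro exI[of _ "min d1 d2"]) auto
  qed
qed

lemma cadlag_on_right_limit:
  assumes "cadlag_on T f" "0 \<le> x" "x \<le> T" "u \<longlonglongrightarrow> x" "\<And>m. x \<le> u m" "\<And>m. u m \<le> T"
  shows "(\<lambda>m. f (u m)) \<longlonglongrightarrow> f x"
proof (rule tendstoI)
  fix e :: real assume "0 < e"
  then obtain d where d: "d > 0" "\<forall>v. x \<le> v \<and> v < x + d \<and> v \<le> T \<longrightarrow> \<bar>f v - f x\<bar> < e"
    using cadlag_on_local[OF assms(1-3)] by metis
  have "\<forall>\<^sub>F m in sequentially. dist (u m) x < d" using assms(4) d(1) by (rule tendstoD)
  thus "\<forall>\<^sub>F m in sequentially. dist (f (u m)) (f x) < e"
    by eventually_elim (use d(2) assms(5,6) in \<open>auto simp: dist_real_def\<close>)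
qed

lemma cadlag_on_bounded:
  assumes "cadlag_on T f" "0 < T"
  obtains B where "\<forall>t\<in>{0..T}. \<bar>f t\<bar> \<le> B"
proof -
  \<comment> \<open>a name for the time interval, as the induction generalises its end points\<close>
  define X where "X = {0..T}"
  have "\<exists>B. \<forall>t\<in>{0..T} \<inter> X. \<bar>f t\<bar> \<le> B"
    using less_imp_le[OF assms(2)]
  proof (induction rule: Bolzano)
    case (trans a b c)
    then obtain B C where B: "\<forall>t\<in>{a..b} \<inter> X. \<bar>f t\<bar> \<le> B"
      and C: "\<forall>t\<in>{b..c} \<inter> X. \<bar>f t\<bar> \<le> C" by blast
    have "\<bar>f t\<bar> \<le> max B C" if t: "t \<in> {a..c} \<inter> X" for t
    proof (cases "t \<le> b")
      case True
      hence "\<bar>f t\<bar> \<le> B" using t by (intro B[rule_format]) simp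
      thus ?thesis by simp
    next
      case False
      hence "\<bar>f t\<bar> \<le> C" using t by (intro C[rule_format]) simp
      thus ?thesis by simp
    qed
    thus ?case by (intro exI[of _ "max B C"] ballI)
  next
    case (local x)
    obtain l where l: "\<forall>e>0. \<exists>d>0. (\<forall>u. x \<le> u \<and> u < x + d \<and> u \<le> T \<longrightarrow> \<bar>f u - f x\<bar> < e) \<and>
                              (\<forall>u. x - d < u \<and> u < x \<and> 0 \<le> u \<longrightarrow> \<bar>f u - l\<bar> < e)"
      by (rule cadlag_on_local[OF assms(1) local])
    from l[rule_format, OF zero_less_one] obtain d where d: "d > 0" "\<And>u. x \<le> u \<Longrightarrow> u < x + d \<Longrightarrow> u \<le> T \<Longrightarrow> \<bar>f u - f x\<bar> < 1"
       "\<And>u. x - d < u \<Longrightarrow> u < x \<Longrightarrow> 0 \<le> u \<Longrightarrow> \<bar>f u - l\<bar> < 1" by blast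
    have "\<bar>f t\<bar> \<le> \<bar>f x\<bar> + \<bar>l\<bar> + 1" if "x - d < t" "t < x + d" "0 \<le> t" "t \<le> T" for t
      using d(2)[of t] d(3)[of t] that by (cases "x \<le> t") auto
    thus ?case using d(1)
      by (intro exI[of _ d] conjI allI impI exI[of _ "\<bar>f x\<bar> + \<bar>l\<bar> + 1"] ballI) (auto simp: X_def)
  qed
  then obtain B where B: "\<forall>t\<in>{0..T} \<inter> X. \<bar>f t\<bar> \<le> B" ..
  show thesis by (rule that[of B]) (use B in \<open>simp add: X_def\<close>)
qed

section \<open>Sums over the large jumps of a path\<close>

text \<open>
  An increment is attributed to the interval that contains its right end point, open on the left.
  This makes the sum exactly additive in the interval even if the end points are not grid times. If
  \<open>g\<close> is continuous and vanishes near 0, the limit under refinement of the grid is the sum of \<open>g\<close>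
  over the jumps of the path in the interval; a jump at an end point that is never a grid time is
  attributed to the interval on its right.
\<close>

definition grid_sum :: "(real \<Rightarrow> real) \<Rightarrow> real \<Rightarrow> (real \<Rightarrow> real) \<Rightarrow> nat \<Rightarrow> real \<Rightarrow> real \<Rightarrow> real" where
  "grid_sum g T f m a b =
     (\<Sum>l | a < grid T m (Suc l) \<and> grid T m (Suc l) \<le> b. g (f (grid T m (Suc l)) - f (grid T m l)))"

definition jump_sum :: "(real \<Rightarrow> real) \<Rightarrow> real \<Rightarrow> (real \<Rightarrow> real) \<Rightarrow> real \<Rightarrow> real \<Rightarrow> real" where
  "jump_sum g T f a b = lim (\<lambda>m. grid_sum g T f m a b)"

lemma finite_grid_le:
  assumes "0 < T" shows "finite {l. P l \<and> grid T m (Suc l) \<le> b}"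
proof (rule finite_subset)
  show "{l. P l \<and> grid T m (Suc l) \<le> b} \<subseteq> {..nat \<lceil>b * 2 ^ m / T\<rceil>}"
  proof safe
    fix l assume "grid T m (Suc l) \<le> b"
    hence "real (Suc l) \<le> b * 2 ^ m / T" using assms by (simp add: grid_def field_simps)
    thus "l \<le> nat \<lceil>b * 2 ^ m / T\<rceil>" by linarith
  qed
qed simp

lemma grid_sum_add:
  assumes "0 < T" "a \<le> b" "b \<le> c"
  shows "grid_sum g T f m a c = grid_sum g T f m a b + grid_sum g T f m b c"
proof -
  have "{l. a < grid T m (Suc l) \<and> grid T m (Suc l) \<le> c} =
    {l. a < grid T m (Suc l) \<and> grid T m (Suc l) \<le> b} \<union> {l. b < grid T m (Suc l) \<and> grid T m (Suc l) \<le> c}"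
    using assms by auto
  thus ?thesis unfolding grid_sum_def
    by (simp, intro sum.union_disjoint finite_grid_le assms) auto
qed

lemma grid_sum_grid:
  assumes "0 < T" "k \<le> m"
  shows "grid_sum g T f m (grid T k i) (grid T k j) =
    (\<Sum>l\<in>{i * 2 ^ (m - k)..<j * 2 ^ (m - k)}. g (f (grid T m (Suc l)) - f (grid T m l)))"
  unfolding grid_sum_def grid_refine[OF assms(2), symmetric]
  using assms(1) by (intro sum.cong) auto

lemma grid_sum_nonneg: "(\<And>x. 0 \<le> g x) \<Longrightarrow> 0 \<le> grid_sum g T f m a b"
  unfolding grid_sum_def by (intro sum_nonneg) auto

lemma grid_sum_mono: "(\<And>x. g x \<le> g' x) \<Longrightarrow> grid_sum g T f m a b \<le> grid_sum g' T f m a b"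
  unfolding grid_sum_def by (intro sum_mono) auto

text \<open>
  Around each point the path stays within distance \<open>R\<close> of its left limit before and of its value
  after the point, so on a fine grid only the increment straddling the point can contribute, and
  it converges to the jump. If the point is an end point of the interval, then the straddling
  increment counts or not depending on whether the point is a grid time; this is eventually
  constant because the grids are nested. Compactness then gives the claim, as the sums are exactly
  additive in the interval.
\<close>

lemma grid_sum_convergent:
  assumes f: "cadlag_on T f" and T: "0 < T"
    and g: "\<And>x. isCont g x" and R: "0 < R" "\<And>x. \<bar>x\<bar> \<le> R \<Longrightarrow> g x = 0"
    and ab: "0 \<le> a" "a \<le> b" "b \<le> T"
  shows "convergent (\<lambda>m. grid_sum g T f m a b)"
proof -
  have "0 \<le> a \<and> b \<le> T \<longrightarrow> convergent (\<lambda>m. grid_sum g T f m a b)"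
    using ab(2)
  proof (induction rule: Bolzano)
    case (trans a b c)
    thus ?case by (auto simp: grid_sum_add[OF T, of a b c] intro!: convergent_add)
  next
    case (local x)
    hence x: "0 \<le> x" "x \<le> T" using ab by auto
    obtain l where l: "\<forall>e>0. \<exists>d>0. (\<forall>u. x \<le> u \<and> u < x + d \<and> u \<le> T \<longrightarrow> \<bar>f u - f x\<bar> < e) \<and>
                              (\<forall>u. x - d < u \<and> u < x \<and> 0 \<le> u \<longrightarrow> \<bar>f u - l\<bar> < e)"
      by (rule cadlag_on_local[OF f x])
    from l[rule_format, OF half_gt_zero[OF R(1)]] obtain d where d: "d > 0"
      "\<And>u. x \<le> u \<Longrightarrow> u < x + d \<Longrightarrow> u \<le> T \<Longrightarrow> \<bar>f u - f x\<bar> < R/2"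
      "\<And>u. x - d < u \<Longrightarrow> u < x \<Longrightarrow> 0 \<le> u \<Longrightarrow> \<bar>f u - l\<bar> < R/2" by blast
    have "convergent (\<lambda>m. grid_sum g T f m a b)"
      if ab: "a \<le> x" "x \<le> b" "b - a < d / 2" "0 \<le> a" "b \<le> T" for a b
    proof -
      have ev1: "\<forall>\<^sub>F m in sequentially. T / 2 ^ m < d / 2"
        using order_tendstoD(2)[OF mesh_tendsto_0[of T], of "d/2"] d(1) by simp
      have zero: "g (f (grid T m (Suc i)) - f (grid T m i)) = 0"
        if m: "T / 2 ^ m < d / 2" and i: "a < grid T m (Suc i)" "grid T m (Suc i) \<le> b"
          and ns: "\<not> (grid T m i < x \<and> x \<le> grid T m (Suc i))" for m i
      proof (rule R(2))
        have s: "grid T m (Suc i) = grid T m i + T / 2 ^ m" by (rule grid_Suc)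
        have pos: "0 < T / 2 ^ m" using T by simp
        show "\<bar>f (grid T m (Suc i)) - f (grid T m i)\<bar> \<le> R"
        proof (cases "x \<le> grid T m i")
          case True
          have xS: "x \<le> grid T m (Suc i)" using True s pos by linarith
          have "\<bar>f (grid T m (Suc i)) - f x\<bar> < R/2"
            using xS ab i d(1) by (intro d(2)) linarith+
          moreover have "\<bar>f (grid T m i) - f x\<bar> < R/2"
            using True s pos ab i d(1) by (intro d(2)) linarith+
          ultimately show ?thesis by linarith
        next
          case False
          have Sx: "grid T m (Suc i) < x" using False ns by linarith
          have "\<bar>f (grid T m (Suc i)) - l\<bar> < R/2"
            using Sx ab i d(1) T by (intro d(3)) (linarith | simp)+
          moreover have "x - d < grid T m i" using s ab m i d(1) by linarith
          hence "\<bar>f (grid T m i) - l\<bar> < R/2"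
            using False T by (intro d(3)) (linarith | simp)+
          ultimately show ?thesis by linarith
        qed
      qed
      show ?thesis
      proof (cases "x = 0")
        case True
        have "\<forall>\<^sub>F m in sequentially. grid_sum g T f m a b = 0"
          using ev1
        proof eventually_elim
          case (elim m)
          have "\<not> grid T m i < 0" for i using T by (simp add: not_less)
          hence "g (f (grid T m (Suc i)) - f (grid T m i)) = 0"
            if "a < grid T m (Suc i)" "grid T m (Suc i) \<le> b" for i
            using zero[OF elim that] True by blast
          thus ?case unfolding grid_sum_def by (intro sum.neutral) auto
        qed
        thus ?thesis by (rule tendsto_eventually[THEN convergentI])
      next
        case False
        hence x0: "0 < x" using x by simp
        define u where "u m = grid T m (grid_above T m x)" for m
        define k where "k m = grid_above T m x - 1" for m
        have up: "x \<le> u m" "u m < x + T / 2 ^ m" "u m \<le> T" for m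
          unfolding u_def using grid_above_props[OF T x, of m] T by (auto simp: grid_le_T)
        have kS: "grid_above T m x = Suc (k m)" for m
        proof -
          have "grid_above T m x \<noteq> 0" using up(1)[of m] x0 unfolding u_def by (metis grid_0 not_less)
          thus ?thesis unfolding k_def by simp
        qed
        have u: "u m = grid T m (Suc (k m))" for m by (simp add: u_def kS)
        have lo: "grid T m (k m) < x" for m using up(2)[of m] by (simp add: u grid_Suc)
        have uniq: "i = k m" if "grid T m i < x" "x \<le> grid T m (Suc i)" for i m
        proof -
          have "grid T m i < grid T m (Suc (k m))" using that(1) up(1)[of m] by (simp add: u)
          moreover have "grid T m (k m) < grid T m (Suc i)" using lo[of m] that(2) by simp
          ultimately show ?thesis using T by simp
        qed
        define c where "c m \<longleftrightarrow> a < u m \<and> u m \<le> b" for m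
        define G where "G m = g (f (u m) - f (grid T m (k m)))" for m
        have ev2: "\<forall>\<^sub>F m in sequentially. grid_sum g T f m a b = (if c m then G m else 0)"
          using ev1
        proof eventually_elim
          case (elim m)
          let ?A = "{i. a < grid T m (Suc i) \<and> grid T m (Suc i) \<le> b}"
          have "grid_sum g T f m a b = (\<Sum>i\<in>?A. if i = k m then G m else 0)"
            unfolding grid_sum_def
          proof (rule sum.cong)
            fix i assume "i \<in> ?A"
            thus "g (f (grid T m (Suc i)) - f (grid T m i)) = (if i = k m then G m else 0)"
              using zero[OF elim, of i] uniq[where i=i and m=m] by (auto simp: G_def u)
          qed simp
          also have "\<dots> = (if k m \<in> ?A then G m else 0)"
            using finite_grid_le[OF T] by (simp add: sum.delta')
          finally show ?case by (simp add: c_def u)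
        qed
        have u_lim: "u \<longlonglongrightarrow> x" unfolding u_def by (rule grid_above_tendsto[OF T x])
        have G_lim: "G \<longlonglongrightarrow> g (f x - l)"
        proof -
          have 1: "(\<lambda>m. f (u m)) \<longlonglongrightarrow> f x"
            by (rule cadlag_on_right_limit[OF f x u_lim up(1) up(3)])
          have 2: "(\<lambda>m. f (grid T m (k m))) \<longlonglongrightarrow> l"
          proof (rule tendstoI)
            fix e :: real assume "0 < e"
            from l[rule_format, OF this] obtain d' where d': "d' > 0"
              "\<And>u. x - d' < u \<Longrightarrow> u < x \<Longrightarrow> 0 \<le> u \<Longrightarrow> \<bar>f u - l\<bar> < e" by blast
            have "\<forall>\<^sub>F m in sequentially. T / 2 ^ m < d'"
              using order_tendstoD(2)[OF mesh_tendsto_0[of T], of d'] d'(1) by simp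
            thus "\<forall>\<^sub>F m in sequentially. dist (f (grid T m (k m))) l < e"
            proof eventually_elim
              case (elim m)
              have "grid T m (k m) = u m - T / 2 ^ m" by (simp add: u grid_Suc)
              hence "x - d' < grid T m (k m)" using up(1)[of m] elim by linarith
              from d'(2)[OF this lo[of m]] show ?case using T by (simp add: dist_real_def)
            qed
          qed
          show ?thesis unfolding G_def
            by (rule isCont_tendsto_compose[OF g tendsto_diff[OF 1 2]])
        qed
        \<comment> \<open>whether the straddling increment is attributed to this interval is eventually constant\<close>
        have "\<exists>C. \<forall>\<^sub>F m in sequentially. c m = C"
        proof (cases "\<exists>m0 i. x = grid T m0 i")
          case True
          then obtain m0 i where i: "x = grid T m0 i" by blast
          have "u m = x" if "m0 \<le> m" for m
          proof -
            have xi: "x = grid T m (i * 2 ^ (m - m0))" using i grid_refine[OF that, of T i] by simp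
            have "k m < i * 2 ^ (m - m0)" using lo[of m] xi T by simp
            hence "u m \<le> x" unfolding u using xi T by simp
            thus ?thesis using up(1)[of m] by simp
          qed
          hence "\<forall>\<^sub>F m in sequentially. c m = (a < x \<and> x \<le> b)"
            unfolding c_def eventually_sequentially by auto
          thus ?thesis by blast
        next
          case False
          hence xu: "x < u m" for m using up(1)[of m] unfolding u by (metis order_le_less)
          show ?thesis
          proof (cases "x < b")
            case True
            have "\<forall>\<^sub>F m in sequentially. u m < b" by (rule order_tendstoD(2)[OF u_lim True])
            hence "\<forall>\<^sub>F m in sequentially. c m = True"
              by eventually_elim (use xu ab in \<open>auto simp: c_def intro: le_less_trans\<close>)
            thus ?thesis by blast
          next
            case False
            hence "c m = False" for m using xu[of m] ab by (simp add: c_def)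
            thus ?thesis by (intro exI[of _ False]) simp
          qed
        qed
        then obtain C where C: "\<forall>\<^sub>F m in sequentially. c m = C" by blast
        have "\<forall>\<^sub>F m in sequentially. grid_sum g T f m a b = (if C then G m else 0)"
          using ev2 C by eventually_elim simp
        moreover have "(\<lambda>m. if C then G m else 0) \<longlonglongrightarrow> (if C then g (f x - l) else 0)"
          using G_lim by simp
        ultimately have "(\<lambda>m. grid_sum g T f m a b) \<longlonglongrightarrow> (if C then g (f x - l) else 0)"
          by (simp add: tendsto_cong)
        thus ?thesis by (rule convergentI)
      qed
    qed
    thus ?case using d(1) by (intro exI[of _ "d/2"]) auto
  qed
  thus ?thesis using ab by simp
qed

text \<open>
  The penalty leaves increments below the level \<open>n + 1\<close> alone and grows faster than linearly, so
  that weights \<open>exp (- penalty n x)\<close> make every exponential moment of the large jumps finite.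
  Continuity is what makes the grid sums converge.
\<close>

definition penalty :: "nat \<Rightarrow> real \<Rightarrow> real" where
  "penalty n x = (max 0 (\<bar>x\<bar> - real (Suc n)))\<^sup>2"

lemma penalty_nonneg [simp]: "0 \<le> penalty n x"
  by (simp add: penalty_def)

lemma penalty_eq_0: "\<bar>x\<bar> \<le> real (Suc n) \<Longrightarrow> penalty n x = 0"
  by (simp add: penalty_def)

lemma isCont_penalty: "isCont (penalty n) x"
  unfolding penalty_def by (intro continuous_intros)

lemma borel_measurable_penalty [measurable]: "penalty n \<in> borel_measurable borel"
  unfolding penalty_def by measurable

lemma penalty_antimono: "n \<le> n' \<Longrightarrow> penalty n' x \<le> penalty n x"
  unfolding penalty_def by (intro power_mono max.mono) auto

abbreviation large_jumps :: "nat \<Rightarrow> real \<Rightarrow> (real \<Rightarrow> real) \<Rightarrow> real \<Rightarrow> real \<Rightarrow> real" where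
  "large_jumps n \<equiv> jump_sum (penalty n)"

lemma large_jumps_LIMSEQ:
  assumes "cadlag_on T f" "0 < T" "0 \<le> a" "a \<le> b" "b \<le> T"
  shows "(\<lambda>m. grid_sum (penalty n) T f m a b) \<longlonglongrightarrow> large_jumps n T f a b"
  unfolding jump_sum_def convergent_LIMSEQ_iff[symmetric]
  by (rule grid_sum_convergent[OF assms(1,2) isCont_penalty _ penalty_eq_0[of _ n] assms(3-5)]) simp_all

lemma large_jumps_add:
  assumes "cadlag_on T f" "0 < T" "0 \<le> a" "a \<le> b" "b \<le> c" "c \<le> T"
  shows "large_jumps n T f a c = large_jumps n T f a b + large_jumps n T f b c"
proof (rule LIMSEQ_unique)
  show "(\<lambda>m. grid_sum (penalty n) T f m a c) \<longlonglongrightarrow> large_jumps n T f a c"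
    using assms by (intro large_jumps_LIMSEQ) auto
  show "(\<lambda>m. grid_sum (penalty n) T f m a c) \<longlonglongrightarrow> large_jumps n T f a b + large_jumps n T f b c"
    unfolding grid_sum_add[OF assms(2,4,5)]
    using assms by (intro tendsto_add large_jumps_LIMSEQ) auto
qed

lemma large_jumps_nonneg:
  assumes "cadlag_on T f" "0 < T" "0 \<le> a" "a \<le> b" "b \<le> T"
  shows "0 \<le> large_jumps n T f a b"
  by (rule LIMSEQ_le_const[OF large_jumps_LIMSEQ[OF assms]])
     (simp add: grid_sum_nonneg)

lemma large_jumps_antimono:
  assumes "cadlag_on T f" "0 < T" "0 \<le> a" "a \<le> b" "b \<le> T" "n \<le> n'"
  shows "large_jumps n' T f a b \<le> large_jumps n T f a b"
  by (rule LIMSEQ_le[OF large_jumps_LIMSEQ[OF assms(1-5)] large_jumps_LIMSEQ[OF assms(1-5)]])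
     (simp add: grid_sum_mono penalty_antimono[OF assms(6)])

lemma large_jumps_eventually_0:
  assumes "cadlag_on T f" "0 < T"
  shows "\<forall>\<^sub>F n in sequentially. large_jumps n T f 0 T = 0"
proof -
  obtain B where B: "\<forall>t\<in>{0..T}. \<bar>f t\<bar> \<le> B"
    by (rule cadlag_on_bounded[OF assms])
  have "large_jumps n T f 0 T = 0" if n: "2 * B \<le> real n" for n
  proof (rule LIMSEQ_unique[OF large_jumps_LIMSEQ[OF assms]])
    have "grid_sum (penalty n) T f m 0 T = 0" for m
      unfolding grid_sum_def
    proof (intro sum.neutral ballI penalty_eq_0)
      fix l assume l: "l \<in> {l. 0 < grid T m (Suc l) \<and> grid T m (Suc l) \<le> T}"
      hence "grid T m l \<le> T" using assms(2) by (auto simp: grid_le_T)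
      hence "\<bar>f (grid T m l)\<bar> \<le> B" using assms(2) by (intro B[rule_format]) auto
      moreover have "\<bar>f (grid T m (Suc l))\<bar> \<le> B" using assms(2) l by (intro B[rule_format]) auto
      ultimately show "\<bar>f (grid T m (Suc l)) - f (grid T m l)\<bar> \<le> real (Suc n)" using n by linarith
    qed
    thus "(\<lambda>m. grid_sum (penalty n) T f m 0 T) \<longlonglongrightarrow> 0" by simp
  qed (use assms(2) in auto)
  moreover obtain N :: nat where "2 * B \<le> real N" using real_arch_simple by blast
  ultimately have "large_jumps n T f 0 T = 0" if "N \<le> n" for n
    using that by (meson of_nat_le_iff order_trans)
  thus ?thesis unfolding eventually_sequentially by blast
qed

section \<open>Increments of a Levy process on the grid\<close>

locale levy =
  fixes P :: "'a measure" and F :: "real \<Rightarrow> 'a measure" and T :: real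
    and L :: "real \<Rightarrow> 'a \<Rightarrow> real"
  assumes T_pos: "0 < T" and levy: "levy_process P F T L"
begin

lemma filtered: "filtered_prob_space P F T"
  and adapted: "adapted_process F T L"
  and starts_at_0: "\<forall>\<omega>\<in>space P. L 0 \<omega> = 0"
  and cadlag_paths: "\<forall>\<omega>\<in>space P. cadlag_on T (\<lambda>t. L t \<omega>)"
  and stationary: "\<forall>s\<in>{0..T}. \<forall>t\<in>{s..T}.
        distr P borel (\<lambda>\<omega>. L t \<omega> - L s \<omega>) = distr P borel (\<lambda>\<omega>. L (t - s) \<omega> - L 0 \<omega>)"
  and independent: "\<forall>s\<in>{0..T}. \<forall>t\<in>{s..T}.
        prob_space.indep_set P (sets (F s))
          {(\<lambda>\<omega>. L t \<omega> - L s \<omega>) -` B \<inter> space P | B. B \<in> sets borel}"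
  using levy unfolding levy_process_def by blast+

sublocale prob_space P
  using filtered by (simp add: filtered_prob_space_def)

lemma subalgebra_F: "0 \<le> t \<Longrightarrow> t \<le> T \<Longrightarrow> subalgebra P (F t)"
  using filtered by (simp add: filtered_prob_space_def)

lemma space_F: "0 \<le> t \<Longrightarrow> t \<le> T \<Longrightarrow> space (F t) = space P"
  using subalgebra_F by (simp add: subalgebra_def)

lemma sets_F_P: "0 \<le> t \<Longrightarrow> t \<le> T \<Longrightarrow> sets (F t) \<subseteq> sets P"
  using subalgebra_F by (simp add: subalgebra_def)

lemma sets_F_mono: "0 \<le> s \<Longrightarrow> s \<le> t \<Longrightarrow> t \<le> T \<Longrightarrow> sets (F s) \<subseteq> sets (F t)"
  using filtered by (simp add: filtered_prob_space_def)

lemma subalgebra_F_F: "0 \<le> s \<Longrightarrow> s \<le> t \<Longrightarrow> t \<le> T \<Longrightarrow> subalgebra (F t) (F s)"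
  using sets_F_mono space_F by (simp add: subalgebra_def)

lemma measurable_F_mono:
  "f \<in> measurable (F s) N \<Longrightarrow> 0 \<le> s \<Longrightarrow> s \<le> t \<Longrightarrow> t \<le> T \<Longrightarrow> f \<in> measurable (F t) N"
  by (rule measurable_from_subalg[OF subalgebra_F_F])

lemma measurable_F_P: "f \<in> measurable (F t) N \<Longrightarrow> 0 \<le> t \<Longrightarrow> t \<le> T \<Longrightarrow> f \<in> measurable P N"
  by (rule measurable_from_subalg[OF subalgebra_F])

lemma L_measurable_F: "0 \<le> s \<Longrightarrow> s \<le> t \<Longrightarrow> t \<le> T \<Longrightarrow> L s \<in> borel_measurable (F t)"
proof -
  assume st: "0 \<le> s" "s \<le> t" "t \<le> T"
  hence "L s \<in> borel_measurable (F s)" using adapted by (simp add: adapted_process_def)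
  thus ?thesis by (rule measurable_F_mono[OF _ st])
qed

lemma L_measurable: "0 \<le> s \<Longrightarrow> s \<le> T \<Longrightarrow> L s \<in> borel_measurable P"
  by (rule measurable_F_P[OF L_measurable_F, of s s]) auto

lemma L_0: "\<omega> \<in> space P \<Longrightarrow> L 0 \<omega> = 0"
  using starts_at_0 by simp

lemma cadlag: "\<omega> \<in> space P \<Longrightarrow> cadlag_on T (\<lambda>t. L t \<omega>)"
  using cadlag_paths by simp

lemma distr_increment:
  assumes "0 \<le> s" "s \<le> t" "t \<le> T"
  shows "distr P borel (\<lambda>\<omega>. L t \<omega> - L s \<omega>) = distr P borel (L (t - s))"
proof -
  have "distr P borel (\<lambda>\<omega>. L t \<omega> - L s \<omega>) = distr P borel (\<lambda>\<omega>. L (t - s) \<omega> - L 0 \<omega>)"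
    using stationary[rule_format, of s t] assms by simp
  also have "\<dots> = distr P borel (L (t - s))"
    by (intro distr_cong) (simp_all add: L_0)
  finally show ?thesis .
qed

lemma prob_space_distr_L: "0 \<le> t \<Longrightarrow> t \<le> T \<Longrightarrow> prob_space (distr P borel (L t))"
  by (intro prob_space_distr L_measurable)

text \<open>
  Independence of the past, in the form that allows the increment to be integrated out by Fubini
  while everything observed up to time \<open>s\<close> is kept fixed.
\<close>

lemma joint_distr_increment:
  assumes "0 \<le> s" "s \<le> t" "t \<le> T"
  shows "distr P (F s \<Otimes>\<^sub>M borel) (\<lambda>\<omega>. (\<omega>, L t \<omega> - L s \<omega>)) =
         distr P (F s) (\<lambda>\<omega>. \<omega>) \<Otimes>\<^sub>M distr P borel (L (t - s))"
proof -
  note [measurable] = L_measurable[of s] L_measurable[of t]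
  have s: "0 \<le> s" "s \<le> T" and t: "0 \<le> t" "t \<le> T" using assms by auto
  let ?D = "\<lambda>\<omega>. L t \<omega> - L s \<omega>"
  have id [measurable]: "(\<lambda>\<omega>. \<omega>) \<in> measurable P (F s)"
    by (rule measurable_F_P[OF _ s]) simp
  have D [measurable]: "?D \<in> borel_measurable P" using s t by measurable
  interpret A: prob_space "distr P (F s) (\<lambda>\<omega>. \<omega>)" by (rule prob_space_distr) fact
  interpret B: prob_space "distr P borel (L (t - s))" using assms by (intro prob_space_distr_L) auto
  have "distr P (F s) (\<lambda>\<omega>. \<omega>) \<Otimes>\<^sub>M distr P borel (L (t - s)) =
        distr P (F s \<Otimes>\<^sub>M borel) (\<lambda>\<omega>. (\<omega>, ?D \<omega>))"
  proof (rule pair_measure_eqI)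
    fix A B assume "A \<in> sets (distr P (F s) (\<lambda>\<omega>. \<omega>))" "B \<in> sets (distr P borel (L (t - s)))"
    hence A: "A \<in> sets (F s)" and B: "B \<in> sets borel" by auto
    have AP: "A \<subseteq> space P" using sets.sets_into_space[OF A] space_F[OF s] by simp
    have ind: "indep_set (sets (F s)) {?D -` B \<inter> space P | B. B \<in> sets borel}"
      using independent assms by simp
    have "emeasure (distr P (F s \<Otimes>\<^sub>M borel) (\<lambda>\<omega>. (\<omega>, ?D \<omega>))) (A \<times> B) =
          emeasure P (A \<inter> (?D -` B \<inter> space P))"
      using A B AP by (subst emeasure_distr) (auto intro!: arg_cong[where f = "emeasure P"])
    also have "\<dots> = emeasure P A * emeasure P (?D -` B \<inter> space P)"
      using indep_setD[OF ind A] B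
      by (auto simp: emeasure_eq_measure ennreal_mult[symmetric])
    also have "emeasure P A = emeasure (distr P (F s) (\<lambda>\<omega>. \<omega>)) A"
      using A AP by (simp add: emeasure_distr Int_absorb2)
    also have "emeasure P (?D -` B \<inter> space P) = emeasure (distr P borel (L (t - s))) B"
      using B D by (simp add: distr_increment[OF assms, symmetric] emeasure_distr)
    finally show "emeasure (distr P (F s) (\<lambda>\<omega>. \<omega>)) A * emeasure (distr P borel (L (t - s))) B =
      emeasure (distr P (F s \<Otimes>\<^sub>M borel) (\<lambda>\<omega>. (\<omega>, ?D \<omega>))) (A \<times> B)" ..
  qed (simp_all add: A.sigma_finite_measure_axioms B.sigma_finite_measure_axioms
         cong: sets_pair_measure_cong)
  thus ?thesis ..
qed

lemma nn_integral_increment: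
  assumes st: "0 \<le> s" "s \<le> t" "t \<le> T"
    and [measurable]: "Y \<in> borel_measurable (F s)" "V \<in> borel_measurable (F s)"
      "(\<lambda>(x, y). h x y) \<in> borel_measurable (borel \<Otimes>\<^sub>M borel)"
  shows "(\<integral>\<^sup>+\<omega>. Y \<omega> * h (V \<omega> :: real) (L t \<omega> - L s \<omega>) \<partial>P) =
         (\<integral>\<^sup>+\<omega>. Y \<omega> * (\<integral>\<^sup>+y. h (V \<omega>) y \<partial>distr P borel (L (t - s))) \<partial>P)"
proof -
  let ?\<mu> = "distr P borel (L (t - s))"
  interpret \<mu>: prob_space ?\<mu> using st by (intro prob_space_distr_L) auto
  have s: "0 \<le> s" "s \<le> T" and t: "0 \<le> t" "t \<le> T" using assms by auto
  note [measurable] = L_measurable[OF s] L_measurable[OF t]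
  have id [measurable]: "(\<lambda>\<omega>. \<omega>) \<in> measurable P (F s)"
    by (rule measurable_F_P[OF _ s]) simp
  let ?k = "\<lambda>(\<omega>, y). Y \<omega> * h (V \<omega>) y"
  have k [measurable]: "?k \<in> borel_measurable (F s \<Otimes>\<^sub>M borel)"
    by measurable
  have "(\<integral>\<^sup>+\<omega>. Y \<omega> * h (V \<omega>) (L t \<omega> - L s \<omega>) \<partial>P) =
        (\<integral>\<^sup>+z. ?k z \<partial>distr P (F s \<Otimes>\<^sub>M borel) (\<lambda>\<omega>. (\<omega>, L t \<omega> - L s \<omega>)))"
    by (subst nn_integral_distr) auto
  also have "\<dots> = (\<integral>\<^sup>+z. ?k z \<partial>(distr P (F s) (\<lambda>\<omega>. \<omega>) \<Otimes>\<^sub>M ?\<mu>))"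
    by (simp add: joint_distr_increment[OF st])
  also have "\<dots> = (\<integral>\<^sup>+\<omega>. \<integral>\<^sup>+y. ?k (\<omega>, y) \<partial>?\<mu> \<partial>distr P (F s) (\<lambda>\<omega>. \<omega>))"
    by (rule \<mu>.nn_integral_fst[symmetric]) measurable
  also have "\<dots> = (\<integral>\<^sup>+\<omega>. Y \<omega> * (\<integral>\<^sup>+y. h (V \<omega>) y \<partial>?\<mu>) \<partial>distr P (F s) (\<lambda>\<omega>. \<omega>))"
    by (intro nn_integral_cong) (simp, subst nn_integral_cmult, auto)
  also have "\<dots> = (\<integral>\<^sup>+\<omega>. Y \<omega> * (\<integral>\<^sup>+y. h (V \<omega>) y \<partial>?\<mu>) \<partial>P)"
    by (subst nn_integral_distr) auto
  finally show ?thesis .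
qed

abbreviation tm :: "nat \<Rightarrow> nat \<Rightarrow> real" where
  "tm \<equiv> grid T"

definition incr :: "nat \<Rightarrow> nat \<Rightarrow> 'a \<Rightarrow> real" where
  "incr m k \<omega> = L (tm m (Suc k)) \<omega> - L (tm m k) \<omega>"

lemma tm_bounds: "i \<le> 2 ^ m \<Longrightarrow> 0 \<le> tm m i" "i \<le> 2 ^ m \<Longrightarrow> tm m i \<le> T"
  using T_pos by (simp_all add: grid_le_T)

lemma L_tm_measurable [measurable (raw)]: "i \<le> 2 ^ m \<Longrightarrow> L (tm m i) \<in> borel_measurable P"
  by (intro L_measurable tm_bounds)

lemma L_tm_measurable_F: "i \<le> j \<Longrightarrow> j \<le> 2 ^ m \<Longrightarrow> L (tm m i) \<in> borel_measurable (F (tm m j))"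
  using T_pos by (intro L_measurable_F tm_bounds) auto

lemma incr_measurable_F:
  "Suc k \<le> j \<Longrightarrow> j \<le> 2 ^ m \<Longrightarrow> incr m k \<in> borel_measurable (F (tm m j))"
  unfolding incr_def by (intro borel_measurable_diff L_tm_measurable_F) auto

text \<open>
  Conditioning on the last but one grid time replaces \<open>h\<close> by its average over one increment, so
  the factor \<open>c\<close> depends on \<open>h\<close>, on the weight and on the number of steps, but neither on the
  starting point nor on \<open>Y\<close>. It is identified afterwards.
\<close>

lemma nn_integral_grid_steps_ex:
  assumes [measurable]: "w \<in> borel_measurable borel" "h \<in> borel_measurable borel"
  shows "\<exists>c. \<forall>i Y. i + r \<le> 2 ^ m \<longrightarrow> Y \<in> borel_measurable (F (tm m i)) \<longrightarrow>
    (\<integral>\<^sup>+\<omega>. Y \<omega> * h (L (tm m (i + r)) \<omega> - L (tm m i) \<omega>) * (\<Prod>k\<in>{i..<i + r}. w (incr m k \<omega>)) \<partial>P) =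
    (\<integral>\<^sup>+\<omega>. Y \<omega> \<partial>P) * (c :: ennreal)"
  using assms(2)
proof (induction r arbitrary: h)
  case 0
  show ?case
    by (intro exI[of _ "h 0"]) (auto intro!: nn_integral_multc measurable_F_P tm_bounds)
next
  case (Suc r)
  note [measurable] = Suc.prems
  let ?\<mu> = "distr P borel (L (tm m 1))"
  define h' where "h' x = (\<integral>\<^sup>+y. h (x + y) * w y \<partial>?\<mu>)" for x
  have h' [measurable]: "h' \<in> borel_measurable borel"
  proof -
    interpret \<mu>: prob_space ?\<mu> by (intro prob_space_distr_L tm_bounds) simp_all
    show ?thesis unfolding h'_def by measurable
  qed
  from Suc.IH[OF h'] obtain c where c: "\<And>i Y. i + r \<le> 2 ^ m \<Longrightarrow> Y \<in> borel_measurable (F (tm m i)) \<Longrightarrow>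
    (\<integral>\<^sup>+\<omega>. Y \<omega> * h' (L (tm m (i + r)) \<omega> - L (tm m i) \<omega>) * (\<Prod>k\<in>{i..<i + r}. w (incr m k \<omega>)) \<partial>P) =
    (\<integral>\<^sup>+\<omega>. Y \<omega> \<partial>P) * c" by blast
  show ?case
  proof (intro exI[of _ c] allI impI)
    fix i and Y :: "'a \<Rightarrow> ennreal"
    assume i: "i + Suc r \<le> 2 ^ m" and Y: "Y \<in> borel_measurable (F (tm m i))"
    let ?V = "\<lambda>\<omega>. L (tm m (i + r)) \<omega> - L (tm m i) \<omega>"
    let ?Y = "\<lambda>\<omega>. Y \<omega> * (\<Prod>k\<in>{i..<i + r}. w (incr m k \<omega>))"
    have Ym: "?Y \<in> borel_measurable (F (tm m (i + r)))"
      using i T_pos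
      by (intro borel_measurable_times_ennreal borel_measurable_prod_ennreal
            measurable_compose[OF incr_measurable_F assms(1)] measurable_F_mono[OF Y] tm_bounds) auto
    have Vm: "?V \<in> borel_measurable (F (tm m (i + r)))"
      using i by (intro borel_measurable_diff L_tm_measurable_F) auto
    have "(\<integral>\<^sup>+\<omega>. Y \<omega> * h (L (tm m (i + Suc r)) \<omega> - L (tm m i) \<omega>) * (\<Prod>k\<in>{i..<i + Suc r}. w (incr m k \<omega>)) \<partial>P)
        = (\<integral>\<^sup>+\<omega>. ?Y \<omega> * (h (?V \<omega> + (L (tm m (Suc (i + r))) \<omega> - L (tm m (i + r)) \<omega>)) *
               w (L (tm m (Suc (i + r))) \<omega> - L (tm m (i + r)) \<omega>)) \<partial>P)"
      by (simp add: incr_def mult_ac)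
    also have "\<dots> = (\<integral>\<^sup>+\<omega>. ?Y \<omega> * h' (?V \<omega>) \<partial>P)"
    proof -
      have "tm m (Suc (i + r)) - tm m (i + r) = tm m 1" by (subst grid_diff) simp_all
      thus ?thesis unfolding h'_def using i T_pos
        by (subst nn_integral_increment[where h = "\<lambda>x y. h (x + y) * w y"])
           (auto intro!: tm_bounds Ym Vm)
    qed
    also have "\<dots> = (\<integral>\<^sup>+\<omega>. Y \<omega> \<partial>P) * c"
      using c[OF _ Y] i by (simp add: mult_ac)
    finally show "(\<integral>\<^sup>+\<omega>. Y \<omega> * h (L (tm m (i + Suc r)) \<omega> - L (tm m i) \<omega>) *
      (\<Prod>k\<in>{i..<i + Suc r}. w (incr m k \<omega>)) \<partial>P) = (\<integral>\<^sup>+\<omega>. Y \<omega> \<partial>P) * c" .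
  qed
qed

lemma nn_integral_grid_steps:
  assumes w: "w \<in> borel_measurable borel" and h: "h \<in> borel_measurable borel"
    and i: "i + r \<le> 2 ^ m" and Y: "Y \<in> borel_measurable (F (tm m i))"
  shows "(\<integral>\<^sup>+\<omega>. Y \<omega> * h (L (tm m (i + r)) \<omega> - L (tm m i) \<omega>) * (\<Prod>k\<in>{i..<i + r}. w (incr m k \<omega>)) \<partial>P) =
    (\<integral>\<^sup>+\<omega>. Y \<omega> \<partial>P) * (\<integral>\<^sup>+\<omega>. h (L (tm m r) \<omega>) * (\<Prod>k<r. w (incr m k \<omega>)) \<partial>P :: ennreal)"
proof -
  from nn_integral_grid_steps_ex[OF w h, of r m] obtain c where c: "\<And>i Y. i + r \<le> 2 ^ m \<Longrightarrow>
      Y \<in> borel_measurable (F (tm m i)) \<Longrightarrow>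
    (\<integral>\<^sup>+\<omega>. Y \<omega> * h (L (tm m (i + r)) \<omega> - L (tm m i) \<omega>) * (\<Prod>k\<in>{i..<i + r}. w (incr m k \<omega>)) \<partial>P) =
    (\<integral>\<^sup>+\<omega>. Y \<omega> \<partial>P) * c" by blast
  have "(\<integral>\<^sup>+\<omega>. h (L (tm m r) \<omega>) * (\<Prod>k<r. w (incr m k \<omega>)) \<partial>P) =
     (\<integral>\<^sup>+\<omega>. 1 * h (L (tm m (0 + r)) \<omega> - L (tm m 0) \<omega>) * (\<Prod>k\<in>{0..<0 + r}. w (incr m k \<omega>)) \<partial>P)"
    by (intro nn_integral_cong) (simp add: L_0 lessThan_atLeast0)
  also have "\<dots> = c" using i by (subst c) (simp_all add: emeasure_space_1)
  finally show ?thesis using c[OF i Y] by simp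
qed

end

section \<open>First exit of a damped walk\<close>

lemma SUP_min_of_nat_ennreal: "(SUP N. min x (of_nat N :: ennreal)) = x"
proof -
  have "(SUP N. min x (of_nat N :: ennreal)) = min x (SUP N. of_nat N)"
    unfolding inf_min[symmetric] by (rule inf_SUP[symmetric])
  thus ?thesis by (simp add: ennreal_SUP_of_nat_eq_top)
qed

lemma nn_integral_truncate:
  fixes g c :: "'a \<Rightarrow> ennreal"
  assumes [measurable]: "g \<in> borel_measurable M" "c \<in> borel_measurable M"
  shows "(\<integral>\<^sup>+x. g x * c x \<partial>M) = (SUP N. \<integral>\<^sup>+x. min (g x) (of_nat N) * c x \<partial>M)"
proof -
  have "(\<integral>\<^sup>+x. g x * c x \<partial>M) = (\<integral>\<^sup>+x. (SUP N. min (g x) (of_nat N) * c x) \<partial>M)"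
    by (simp add: SUP_mult_right_ennreal[symmetric] SUP_min_of_nat_ennreal)
  also have "\<dots> = (SUP N. \<integral>\<^sup>+x. min (g x) (of_nat N) * c x \<partial>M)"
    by (rule nn_integral_monotone_convergence_SUP)
       (auto simp: incseq_def le_fun_def intro!: mult_right_mono min.mono)
  finally show ?thesis .
qed

text \<open>
  One splits at the first time at which \<open>S\<close> leaves the interval \<open>{-1..1}\<close>: before the last step
  the path is bounded by 1, the exit step contributes its own size, and the walk starts afresh.
\<close>

lemma first_exit_bound:
  fixes S :: "nat \<Rightarrow> real" and w :: "nat \<Rightarrow> ennreal"
  assumes S0: "S 0 = 0" and \<theta>: "0 \<le> \<theta>" and w: "\<And>k. w k \<le> 1"
  shows "ennreal (exp (\<theta> * \<bar>S r\<bar>)) * (\<Prod>k<r. w k) \<le> ennreal (exp \<theta>) +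
    (\<Sum>i<r. of_bool ((\<forall>j\<le>i. \<bar>S j\<bar> \<le> 1) \<and> 1 < \<bar>S (Suc i)\<bar>) *
      (ennreal (exp \<theta>) * (ennreal (exp (\<theta> * \<bar>S (Suc i) - S i\<bar>)) * w i)) *
      (ennreal (exp (\<theta> * \<bar>S r - S (Suc i)\<bar>)) * (\<Prod>k\<in>{Suc i..<r}. w k)))"
    (is "?l \<le> _ + (\<Sum>i<r. ?t i)")
proof (cases "\<exists>i\<le>r. 1 < \<bar>S i\<bar>")
  case False
  have "(\<Prod>k<r. w k) \<le> 1" using w by (intro prod_le_1) auto
  hence "?l \<le> ennreal (exp (\<theta> * \<bar>S r\<bar>)) * 1" by (intro mult_left_mono) auto
  also have "\<dots> \<le> ennreal (exp \<theta>)"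
    using False \<theta> mult_left_mono[of "\<bar>S r\<bar>" 1 \<theta>] by (auto simp: not_less)
  finally show ?thesis by (rule order_trans) simp
next
  case True
  define q where "q = (LEAST i. 1 < \<bar>S i\<bar>)"
  from True obtain i0 where i0: "i0 \<le> r" "1 < \<bar>S i0\<bar>" by blast
  have "1 < \<bar>S q\<bar>" unfolding q_def by (rule LeastI[of "\<lambda>i. 1 < \<bar>S i\<bar>", OF i0(2)])
  moreover have "q \<le> i0" unfolding q_def by (rule Least_le) (rule i0(2))
  ultimately have q: "1 < \<bar>S q\<bar>" "q \<le> r" using i0(1) by auto
  have least: "\<bar>S j\<bar> \<le> 1" if "j < q" for j
    using not_less_Least[of j "\<lambda>i. 1 < \<bar>S i\<bar>"] that unfolding q_def by linarith
  from q(1) S0 obtain i where i: "q = Suc i" by (cases q) auto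
  have ir: "i < r" using q(2) i by simp
  have "\<bar>S r\<bar> \<le> 1 + \<bar>S (Suc i) - S i\<bar> + \<bar>S r - S (Suc i)\<bar>"
    using least[of i] i by simp
  hence "\<theta> * \<bar>S r\<bar> \<le> \<theta> * (1 + \<bar>S (Suc i) - S i\<bar> + \<bar>S r - S (Suc i)\<bar>)"
    using \<theta> by (rule mult_left_mono)
  hence "exp (\<theta> * \<bar>S r\<bar>) \<le> exp \<theta> * exp (\<theta> * \<bar>S (Suc i) - S i\<bar>) * exp (\<theta> * \<bar>S r - S (Suc i)\<bar>)"
    by (simp add: exp_add[symmetric] algebra_simps)
  hence e: "ennreal (exp (\<theta> * \<bar>S r\<bar>)) \<le>
    ennreal (exp \<theta>) * ennreal (exp (\<theta> * \<bar>S (Suc i) - S i\<bar>)) * ennreal (exp (\<theta> * \<bar>S r - S (Suc i)\<bar>))"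
    by (simp add: ennreal_mult[symmetric])
  have "(\<Prod>k<r. w k) = (\<Prod>k<i. w k) * (w i * (\<Prod>k\<in>{Suc i..<r}. w k))"
  proof -
    have "{..<r} = {..<i} \<union> insert i {Suc i..<r}" using ir by auto
    hence "prod w {..<r} = prod w ({..<i} \<union> insert i {Suc i..<r})" by (rule arg_cong)
    also have "\<dots> = prod w {..<i} * prod w (insert i {Suc i..<r})"
      by (rule prod.union_disjoint) auto
    finally show ?thesis by simp
  qed
  also have "\<dots> \<le> 1 * (w i * (\<Prod>k\<in>{Suc i..<r}. w k))"
    using w by (intro mult_right_mono prod_le_1) auto
  finally have p: "(\<Prod>k<r. w k) \<le> w i * (\<Prod>k\<in>{Suc i..<r}. w k)" by simp
  have ind: "(\<forall>j\<le>i. \<bar>S j\<bar> \<le> 1) \<and> 1 < \<bar>S (Suc i)\<bar>" using q i least by auto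
  have "?l \<le> ?t i"
    using mult_mono[OF e p] ind by (simp add: mult_ac)
  also have "\<dots> \<le> (\<Sum>i<r. ?t i)" using ir by (intro member_le_sum) auto
  finally show ?thesis by (rule order_trans) simp
qed

text \<open>
  A linear exponent loses against a quadratic penalty; the part of \<open>x\<close> below the penalty level
  contributes the term with \<open>Suc n\<close>.
\<close>

lemma exp_minus_penalty_bound: "exp (\<theta> * \<bar>x\<bar>) * exp (- penalty n x) \<le> exp (\<theta> * real (Suc n) + \<theta>\<^sup>2)"
  if "0 \<le> \<theta>"
proof -
  define u where "u = max 0 (\<bar>x\<bar> - real (Suc n))"
  have "\<bar>x\<bar> \<le> real (Suc n) + u" by (simp add: u_def)
  hence "\<theta> * \<bar>x\<bar> \<le> \<theta> * (real (Suc n) + u)" using that by (rule mult_left_mono)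
  moreover have "\<theta> * u \<le> \<theta>\<^sup>2 + u\<^sup>2"
  proof -
    have "0 \<le> \<theta> * u" using that by (simp add: u_def)
    thus ?thesis using sum_squares_bound[of \<theta> u] by linarith
  qed
  ultimately have "\<theta> * \<bar>x\<bar> + - u\<^sup>2 \<le> \<theta> * real (Suc n) + \<theta>\<^sup>2"
    by (simp only: distrib_left)
  thus ?thesis by (simp only: exp_add[symmetric] penalty_def u_def[symmetric] exp_le_cancel_iff)
qed

section \<open>Damping the large jumps\<close>

context levy
begin

text \<open>
  The damping factor lies between 0 and 1, is multiplicative over adjacent time intervals, and
  tends to 1 as \<open>n\<close> grows, because each path is bounded.
\<close>

definition damp :: "nat \<Rightarrow> real \<Rightarrow> real \<Rightarrow> 'a \<Rightarrow> real" where
  "damp n a b \<omega> = exp (- large_jumps n T (\<lambda>t. L t \<omega>) a b)"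

abbreviation wgt :: "nat \<Rightarrow> real \<Rightarrow> ennreal" where
  "wgt n x \<equiv> ennreal (exp (- penalty n x))"

lemma wgt_le_1: "wgt n x \<le> 1"
  by (simp add: ennreal_le_1)

lemma grid_damp_eq:
  assumes "k \<le> m"
  shows "ennreal (exp (- grid_sum (penalty n) T (\<lambda>t. L t \<omega>) m (tm k i) (tm k j))) =
    (\<Prod>l\<in>{i * 2 ^ (m - k)..<j * 2 ^ (m - k)}. wgt n (incr m l \<omega>))"
  by (subst prod_ennreal)
     (simp_all add: grid_sum_grid[OF T_pos assms] exp_sum[symmetric] sum_negf incr_def)

lemma damp_LIMSEQ:
  assumes "\<omega> \<in> space P" "0 \<le> a" "a \<le> b" "b \<le> T"
  shows "(\<lambda>m. exp (- grid_sum (penalty n) T (\<lambda>t. L t \<omega>) (m + k) a b)) \<longlonglongrightarrow> damp n a b \<omega>"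
  unfolding damp_def
  by (intro tendsto_intros LIMSEQ_ignore_initial_segment large_jumps_LIMSEQ cadlag T_pos assms)

lemma damp_pos: "0 < damp n a b \<omega>"
  by (simp add: damp_def)

lemma damp_le_1: "\<omega> \<in> space P \<Longrightarrow> 0 \<le> a \<Longrightarrow> a \<le> b \<Longrightarrow> b \<le> T \<Longrightarrow> damp n a b \<omega> \<le> 1"
  unfolding damp_def using large_jumps_nonneg[OF cadlag T_pos] by simp

lemma damp_mult:
  "\<omega> \<in> space P \<Longrightarrow> 0 \<le> a \<Longrightarrow> a \<le> b \<Longrightarrow> b \<le> c \<Longrightarrow> c \<le> T \<Longrightarrow>
    damp n a b \<omega> * damp n b c \<omega> = damp n a c \<omega>"
  unfolding damp_def by (simp add: large_jumps_add[OF cadlag T_pos, of \<omega> a b c] exp_add[symmetric])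

lemma damp_mono: "\<omega> \<in> space P \<Longrightarrow> n \<le> n' \<Longrightarrow> damp n 0 T \<omega> \<le> damp n' 0 T \<omega>"
  unfolding damp_def using large_jumps_antimono[OF cadlag T_pos] T_pos by simp

lemma damp_tendsto_1: "\<omega> \<in> space P \<Longrightarrow> (\<lambda>n. damp n 0 T \<omega>) \<longlonglongrightarrow> 1"
proof (rule tendsto_eventually)
  assume "\<omega> \<in> space P"
  from large_jumps_eventually_0[OF cadlag[OF this] T_pos]
  show "\<forall>\<^sub>F n in sequentially. damp n 0 T \<omega> = 1"
    by eventually_elim (simp add: damp_def)
qed

lemma grid_sum_measurable:
  assumes "k \<le> m" "i \<le> j" "j \<le> 2 ^ k"
  shows "(\<lambda>\<omega>. grid_sum (penalty n) T (\<lambda>t. L t \<omega>) m (tm k i) (tm k j)) \<in> borel_measurable (F (tm k j))"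
proof -
  have j: "j * 2 ^ (m - k) \<le> 2 ^ m"
  proof -
    have "j * 2 ^ (m - k) \<le> 2 ^ k * 2 ^ (m - k)" using assms(3) by (rule mult_right_mono) simp
    also have "\<dots> = (2::nat) ^ m" using assms(1) by (simp flip: power_add)
    finally show ?thesis .
  qed
  have "(\<lambda>\<omega>. penalty n (incr m l \<omega>)) \<in> borel_measurable (F (tm k j))" if "l < j * 2 ^ (m - k)" for l
  proof -
    have "incr m l \<in> borel_measurable (F (tm m (j * 2 ^ (m - k))))"
      using that j by (intro incr_measurable_F) auto
    thus ?thesis unfolding grid_refine[OF assms(1)]
      by (rule measurable_compose[OF _ borel_measurable_penalty])
  qed
  thus ?thesis
    unfolding grid_sum_grid[OF T_pos assms(1)] incr_def by (intro borel_measurable_sum) auto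
qed

lemma damp_measurable_F:
  assumes "i \<le> j" "j \<le> 2 ^ k"
  shows "damp n (tm k i) (tm k j) \<in> borel_measurable (F (tm k j))"
proof (rule borel_measurable_LIMSEQ_real)
  fix \<omega> assume "\<omega> \<in> space (F (tm k j))"
  hence "\<omega> \<in> space P" using space_F[OF tm_bounds[OF assms(2)]] by simp
  thus "(\<lambda>m. exp (- grid_sum (penalty n) T (\<lambda>t. L t \<omega>) (m + k) (tm k i) (tm k j))) \<longlonglongrightarrow>
      damp n (tm k i) (tm k j) \<omega>"
    using assms T_pos by (intro damp_LIMSEQ tm_bounds) auto
next
  fix m
  have [measurable]: "(\<lambda>\<omega>. grid_sum (penalty n) T (\<lambda>t. L t \<omega>) (m + k) (tm k i) (tm k j)) \<in>
     borel_measurable (F (tm k j))"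
    using assms by (intro grid_sum_measurable) auto
  show "(\<lambda>\<omega>. exp (- grid_sum (penalty n) T (\<lambda>t. L t \<omega>) (m + k) (tm k i) (tm k j))) \<in>
     borel_measurable (F (tm k j))"
    by measurable
qed

lemma damp_measurable: "i \<le> j \<Longrightarrow> j \<le> 2 ^ k \<Longrightarrow> damp n (tm k i) (tm k j) \<in> borel_measurable P"
  by (rule measurable_F_P[OF damp_measurable_F]) (auto intro: tm_bounds)

text \<open>
  The law of the pair of an increment and its damping factor is the same on all grid intervals
  of the same length, and the pair is independent of the past. This passes from the grid sums to
  their limits by dominated convergence, first for bounded integrands.
\<close>

lemma nn_integral_damp_steps_bounded:
  assumes i: "i + r \<le> 2 ^ k" and Y: "Y \<in> borel_measurable (F (tm k i))"
    and YN: "\<And>\<omega>. Y \<omega> \<le> of_nat N"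
    and h [measurable]: "h \<in> borel_measurable borel" and hN: "\<And>x. h x \<le> of_nat N" and N: "1 \<le> N"
  shows "(\<integral>\<^sup>+\<omega>. Y \<omega> * h (L (tm k (i + r)) \<omega> - L (tm k i) \<omega>) * ennreal (damp n (tm k i) (tm k (i + r)) \<omega>) \<partial>P) =
    (\<integral>\<^sup>+\<omega>. Y \<omega> \<partial>P) * (\<integral>\<^sup>+\<omega>. h (L (tm k r) \<omega>) * ennreal (damp n 0 (tm k r) \<omega>) \<partial>P)"
proof -
  have Yb: "(\<integral>\<^sup>+\<omega>. Y \<omega> \<partial>P) < \<infinity>"
  proof -
    have "(\<integral>\<^sup>+\<omega>. Y \<omega> \<partial>P) \<le> (\<integral>\<^sup>+\<omega>. of_nat N \<partial>P)" by (intro nn_integral_mono YN)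
    thus ?thesis by (simp add: emeasure_space_1 order_le_less_trans of_nat_less_top)
  qed
  have Ym [measurable]: "Y \<in> borel_measurable P"
    by (rule measurable_F_P[OF Y]) (use i in \<open>auto intro: tm_bounds\<close>)
  have L1 [measurable]: "L (tm k (i + r)) \<in> borel_measurable P" "L (tm k i) \<in> borel_measurable P"
    "L (tm k r) \<in> borel_measurable P" using i by (auto intro: L_tm_measurable)
  let ?e = "\<lambda>m a b \<omega>. exp (- grid_sum (penalty n) T (\<lambda>t. L t \<omega>) (m + k) (tm k a) (tm k b))"
  let ?h = "\<lambda>a b \<omega>. h (L (tm k b) \<omega> - L (tm k a) \<omega>)"
  let ?d = "\<lambda>a b \<omega>. damp n (tm k a) (tm k b) \<omega>"
  have e1: "?e m a b \<omega> \<le> 1" for m a b \<omega> by (simp add: grid_sum_nonneg)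
  have conv: "(\<lambda>m. \<integral>\<^sup>+\<omega>. Y' \<omega> * ?h a b \<omega> * ennreal (?e m a b \<omega>) \<partial>P) \<longlonglongrightarrow>
     (\<integral>\<^sup>+\<omega>. Y' \<omega> * ?h a b \<omega> * ennreal (?d a b \<omega>) \<partial>P)"
    if ab: "a \<le> b" "b \<le> 2 ^ k" and Y'[measurable]: "Y' \<in> borel_measurable P"
      and Y'N: "\<And>\<omega>. Y' \<omega> \<le> of_nat N" and Y'b: "(\<integral>\<^sup>+\<omega>. Y' \<omega> \<partial>P) < \<infinity>" for a b and Y' :: "'a \<Rightarrow> ennreal"
  proof (rule nn_integral_dominated_convergence[where w = "\<lambda>\<omega>. of_nat N * Y' \<omega>"])
    have [measurable]: "L (tm k a) \<in> borel_measurable P" "L (tm k b) \<in> borel_measurable P"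
      using ab by (auto intro: L_tm_measurable)
    have [measurable]: "(\<lambda>\<omega>. grid_sum (penalty n) T (\<lambda>t. L t \<omega>) (m + k) (tm k a) (tm k b)) \<in> borel_measurable P" for m
      using ab by (intro measurable_F_P[OF grid_sum_measurable] tm_bounds) auto
    note [measurable] = damp_measurable[OF ab]
    show "(\<lambda>\<omega>. Y' \<omega> * ?h a b \<omega> * ennreal (?e m a b \<omega>)) \<in> borel_measurable P" for m by measurable
    show "(\<lambda>\<omega>. Y' \<omega> * ?h a b \<omega> * ennreal (?d a b \<omega>)) \<in> borel_measurable P" by measurable
    show "(\<lambda>\<omega>. of_nat N * Y' \<omega>) \<in> borel_measurable P" by measurable
    show "(\<integral>\<^sup>+\<omega>. of_nat N * Y' \<omega> \<partial>P) < \<infinity>"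
      using Y'b by (simp add: nn_integral_cmult ennreal_mult_less_top of_nat_less_top)
    have "Y' \<omega> * (h x * ennreal (?e m a b \<omega>)) \<le> Y' \<omega> * (of_nat N * 1)" for x m \<omega>
      using e1 by (intro mult_left_mono mult_mono hN) (auto simp: ennreal_le_1)
    hence "Y' \<omega> * h x * ennreal (?e m a b \<omega>) \<le> of_nat N * Y' \<omega>" for x m \<omega>
      by (metis mult.assoc mult.commute mult_1_right)
    thus "AE \<omega> in P. Y' \<omega> * ?h a b \<omega> * ennreal (?e m a b \<omega>) \<le> of_nat N * Y' \<omega>" for m
      by (intro AE_I2)
    show "AE \<omega> in P. (\<lambda>m. Y' \<omega> * ?h a b \<omega> * ennreal (?e m a b \<omega>)) \<longlonglongrightarrow>
       Y' \<omega> * ?h a b \<omega> * ennreal (?d a b \<omega>)"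
    proof (rule AE_I2)
      fix \<omega> assume w: "\<omega> \<in> space P"
      have "Y' \<omega> * h x < top" for x
        using Y'N[of \<omega>] hN[of x] by (simp add: ennreal_mult_less_top order_le_less_trans of_nat_less_top)
      moreover have "(\<lambda>m. ?e m a b \<omega>) \<longlonglongrightarrow> ?d a b \<omega>"
        using ab w T_pos by (intro damp_LIMSEQ tm_bounds) auto
      ultimately show "(\<lambda>m. Y' \<omega> * ?h a b \<omega> * ennreal (?e m a b \<omega>)) \<longlonglongrightarrow>
        Y' \<omega> * ?h a b \<omega> * ennreal (?d a b \<omega>)"
        by (intro ennreal_tendsto_cmult tendsto_ennrealI)
    qed
  qed
  have step: "(\<integral>\<^sup>+\<omega>. Y \<omega> * ?h i (i + r) \<omega> * ennreal (?e m i (i + r) \<omega>) \<partial>P) =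
    (\<integral>\<^sup>+\<omega>. Y \<omega> \<partial>P) * (\<integral>\<^sup>+\<omega>. 1 * ?h 0 r \<omega> * ennreal (?e m 0 r \<omega>) \<partial>P)" for m
  proof -
    let ?M = "m + k" and ?q = "2 ^ m :: nat"
    have ref: "tm k j = tm ?M (j * ?q)" for j using grid_refine[of k ?M T j] by simp
    have le: "i * ?q + r * ?q \<le> 2 ^ ?M"
      using mult_right_mono[OF i, of ?q] by (simp add: distrib_right power_add mult.commute)
    have "(\<integral>\<^sup>+\<omega>. Y \<omega> * ?h i (i + r) \<omega> * ennreal (?e m i (i + r) \<omega>) \<partial>P) =
      (\<integral>\<^sup>+\<omega>. Y \<omega> * h (L (tm ?M (i * ?q + r * ?q)) \<omega> - L (tm ?M (i * ?q)) \<omega>) *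
         (\<Prod>l\<in>{i * ?q..<i * ?q + r * ?q}. wgt n (incr ?M l \<omega>)) \<partial>P)"
      by (subst grid_damp_eq) (simp_all add: ref distrib_right)
    also have "\<dots> = (\<integral>\<^sup>+\<omega>. Y \<omega> \<partial>P) *
       (\<integral>\<^sup>+\<omega>. h (L (tm ?M (r * ?q)) \<omega>) * (\<Prod>l<r * ?q. wgt n (incr ?M l \<omega>)) \<partial>P)"
      using Y le by (intro nn_integral_grid_steps) (simp_all add: ref)
    also have "(\<integral>\<^sup>+\<omega>. h (L (tm ?M (r * ?q)) \<omega>) * (\<Prod>l<r * ?q. wgt n (incr ?M l \<omega>)) \<partial>P) =
      (\<integral>\<^sup>+\<omega>. 1 * ?h 0 r \<omega> * ennreal (?e m 0 r \<omega>) \<partial>P)"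
      by (subst grid_damp_eq) (auto intro!: nn_integral_cong simp: L_0 ref[symmetric] lessThan_atLeast0)
    finally show ?thesis .
  qed
  have "(\<lambda>m. (\<integral>\<^sup>+\<omega>. Y \<omega> \<partial>P) * (\<integral>\<^sup>+\<omega>. 1 * ?h 0 r \<omega> * ennreal (?e m 0 r \<omega>) \<partial>P)) \<longlonglongrightarrow>
      (\<integral>\<^sup>+\<omega>. Y \<omega> \<partial>P) * (\<integral>\<^sup>+\<omega>. 1 * ?h 0 r \<omega> * ennreal (?d 0 r \<omega>) \<partial>P)"
    using Yb i by (intro ennreal_tendsto_cmult conv) (use N in \<open>auto simp: emeasure_space_1\<close>)
  moreover have "(\<lambda>m. (\<integral>\<^sup>+\<omega>. Y \<omega> \<partial>P) * (\<integral>\<^sup>+\<omega>. 1 * ?h 0 r \<omega> * ennreal (?e m 0 r \<omega>) \<partial>P)) \<longlonglongrightarrow>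
      (\<integral>\<^sup>+\<omega>. Y \<omega> * ?h i (i + r) \<omega> * ennreal (?d i (i + r) \<omega>) \<partial>P)"
    unfolding step[symmetric] using i by (intro conv Ym YN Yb) auto
  ultimately have "(\<integral>\<^sup>+\<omega>. Y \<omega> * ?h i (i + r) \<omega> * ennreal (?d i (i + r) \<omega>) \<partial>P) =
      (\<integral>\<^sup>+\<omega>. Y \<omega> \<partial>P) * (\<integral>\<^sup>+\<omega>. 1 * ?h 0 r \<omega> * ennreal (?d 0 r \<omega>) \<partial>P)"
    by (rule LIMSEQ_unique[symmetric])
  also have "(\<integral>\<^sup>+\<omega>. 1 * ?h 0 r \<omega> * ennreal (?d 0 r \<omega>) \<partial>P) =
      (\<integral>\<^sup>+\<omega>. h (L (tm k r) \<omega>) * ennreal (damp n 0 (tm k r) \<omega>) \<partial>P)"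
    by (intro nn_integral_cong) (simp add: L_0)
  finally show ?thesis .
qed

text \<open>
  Truncating first \<open>h\<close> and then \<open>Y\<close> removes the boundedness. Unbounded \<open>Y\<close> and \<open>h\<close> are what the
  exponential tilting needs.
\<close>

lemma nn_integral_damp_steps:
  assumes i: "i + r \<le> 2 ^ k" and Y: "Y \<in> borel_measurable (F (tm k i))"
    and h [measurable]: "h \<in> borel_measurable borel"
  shows "(\<integral>\<^sup>+\<omega>. Y \<omega> * h (L (tm k (i + r)) \<omega> - L (tm k i) \<omega>) * ennreal (damp n (tm k i) (tm k (i + r)) \<omega>) \<partial>P) =
    (\<integral>\<^sup>+\<omega>. Y \<omega> \<partial>P) * (\<integral>\<^sup>+\<omega>. h (L (tm k r) \<omega>) * ennreal (damp n 0 (tm k r) \<omega>) \<partial>P)"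
proof -
  let ?D = "\<lambda>\<omega>. L (tm k (i + r)) \<omega> - L (tm k i) \<omega>" and ?d = "\<lambda>\<omega>. ennreal (damp n (tm k i) (tm k (i + r)) \<omega>)"
  have Ym [measurable]: "Y \<in> borel_measurable P"
    by (rule measurable_F_P[OF Y]) (use i in \<open>auto intro: tm_bounds\<close>)
  have L1 [measurable]: "L (tm k (i + r)) \<in> borel_measurable P" "L (tm k i) \<in> borel_measurable P"
    "L (tm k r) \<in> borel_measurable P" using i by (auto intro: L_tm_measurable)
  have d [measurable]: "damp n (tm k i) (tm k (i + r)) \<in> borel_measurable P" "damp n 0 (tm k r) \<in> borel_measurable P"
    using damp_measurable[of i "i + r" k n] damp_measurable[of 0 r k n] i by simp_all
  have bd: "(\<integral>\<^sup>+\<omega>. min (Y \<omega>) (of_nat N) * min (h (?D \<omega>)) (of_nat M) * ?d \<omega> \<partial>P) =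
    (\<integral>\<^sup>+\<omega>. min (Y \<omega>) (of_nat N) \<partial>P) * (\<integral>\<^sup>+\<omega>. min (h (L (tm k r) \<omega>)) (of_nat M) * ennreal (damp n 0 (tm k r) \<omega>) \<partial>P)"
    for N M
    using Y by (intro nn_integral_damp_steps_bounded[where N = "max 1 (max N M)" and h = "\<lambda>x. min (h x) (of_nat M)"] i)
      (auto simp: min_le_iff_disj of_nat_max le_max_iff_disj intro!: measurable_compose[OF Y])
  have "(\<integral>\<^sup>+\<omega>. min (Y \<omega>) (of_nat N) * h (?D \<omega>) * ?d \<omega> \<partial>P) =
    (\<integral>\<^sup>+\<omega>. min (Y \<omega>) (of_nat N) \<partial>P) * (\<integral>\<^sup>+\<omega>. h (L (tm k r) \<omega>) * ennreal (damp n 0 (tm k r) \<omega>) \<partial>P)" for N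
  proof -
    have "(\<integral>\<^sup>+\<omega>. min (Y \<omega>) (of_nat N) * h (?D \<omega>) * ?d \<omega> \<partial>P) =
      (\<integral>\<^sup>+\<omega>. h (?D \<omega>) * (min (Y \<omega>) (of_nat N) * ?d \<omega>) \<partial>P)" by (simp add: mult_ac)
    also have "\<dots> = (SUP M. \<integral>\<^sup>+\<omega>. min (Y \<omega>) (of_nat N) * min (h (?D \<omega>)) (of_nat M) * ?d \<omega> \<partial>P)"
      by (subst nn_integral_truncate) (auto simp: mult_ac)
    also have "\<dots> = (\<integral>\<^sup>+\<omega>. min (Y \<omega>) (of_nat N) \<partial>P) * (\<integral>\<^sup>+\<omega>. h (L (tm k r) \<omega>) * ennreal (damp n 0 (tm k r) \<omega>) \<partial>P)"
      unfolding bd by (subst (2) nn_integral_truncate) (auto simp: SUP_mult_left_ennreal)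
    finally show ?thesis .
  qed
  note b2 = this
  have "(\<integral>\<^sup>+\<omega>. Y \<omega> * h (?D \<omega>) * ?d \<omega> \<partial>P) = (\<integral>\<^sup>+\<omega>. Y \<omega> * (h (?D \<omega>) * ?d \<omega>) \<partial>P)" by (simp add: mult_ac)
  also have "\<dots> = (SUP N. \<integral>\<^sup>+\<omega>. min (Y \<omega>) (of_nat N) * h (?D \<omega>) * ?d \<omega> \<partial>P)"
    by (subst nn_integral_truncate) (auto simp: mult_ac)
  also have "\<dots> = (SUP N. \<integral>\<^sup>+\<omega>. min (Y \<omega>) (of_nat N) * 1 \<partial>P) * (\<integral>\<^sup>+\<omega>. h (L (tm k r) \<omega>) * ennreal (damp n 0 (tm k r) \<omega>) \<partial>P)"
    unfolding b2 SUP_mult_right_ennreal by simp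
  also have "(SUP N. \<integral>\<^sup>+\<omega>. min (Y \<omega>) (of_nat N) * 1 \<partial>P) = (\<integral>\<^sup>+\<omega>. Y \<omega> * 1 \<partial>P)"
    by (rule nn_integral_truncate[symmetric]) auto
  finally show ?thesis by simp
qed

section \<open>Exponential moments of the damped process\<close>

definition exp_mom :: "nat \<Rightarrow> real \<Rightarrow> nat \<Rightarrow> nat \<Rightarrow> ennreal" where
  "exp_mom n \<theta> m r =
     (\<integral>\<^sup>+\<omega>. ennreal (exp (\<theta> * \<bar>L (tm m r) \<omega>\<bar>)) * (\<Prod>k<r. wgt n (incr m k \<omega>)) \<partial>P)"

text \<open>
  Only grid times are inspected, so that the event is a countable union of measurable ones.
\<close>

definition early_exit :: "nat \<Rightarrow> 'a set" where
  "early_exit r = {\<omega> \<in> space P. \<exists>m i. i \<le> 2 ^ m \<and> tm m i \<le> T / 2 ^ r \<and> 1 < \<bar>L (tm m i) \<omega>\<bar>}"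

lemma early_exit_sets: "early_exit r \<in> sets P"
proof -
  have "early_exit r = (\<Union>m. \<Union>i\<in>{i. i \<le> 2 ^ m \<and> tm m i \<le> T / 2 ^ r}. {\<omega> \<in> space P. 1 < \<bar>L (tm m i) \<omega>\<bar>})"
    unfolding early_exit_def by auto
  also have "\<dots> \<in> sets P"
  proof (rule sets.countable_UN''[OF countableI_type], rule sets.countable_UN''[OF countableI_type])
    fix m i assume "i \<in> {i. i \<le> 2 ^ m \<and> tm m i \<le> T / 2 ^ r}"
    hence [measurable]: "L (tm m i) \<in> borel_measurable P" by (intro L_tm_measurable) simp
    show "{\<omega> \<in> space P. 1 < \<bar>L (tm m i) \<omega>\<bar>} \<in> sets P" by measurable
  qed
  finally show ?thesis .
qed

text \<open>
  Paths start at 0 and are right-continuous there.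
\<close>

lemma early_exit_tendsto_0: "(\<lambda>r. prob (early_exit r)) \<longlonglongrightarrow> 0"
proof -
  have "(\<lambda>r. prob (early_exit r)) \<longlonglongrightarrow> prob (\<Inter>r. early_exit r)"
  proof (rule finite_Lim_measure_decseq)
    show "range early_exit \<subseteq> events" using early_exit_sets by auto
    show "decseq early_exit"
    proof (rule decseq_SucI)
      fix r
      have "T / 2 ^ Suc r \<le> T / 2 ^ r" using T_pos by (simp add: field_simps)
      thus "early_exit (Suc r) \<subseteq> early_exit r"
        unfolding early_exit_def by (blast intro: order_trans)
    qed
  qed
  moreover have "(\<Inter>r. early_exit r) = {}"
  proof (rule ccontr)
    assume "(\<Inter>r. early_exit r) \<noteq> {}"
    then obtain \<omega> where w: "\<And>r. \<omega> \<in> early_exit r" by blast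
    hence sp: "\<omega> \<in> space P" by (auto simp: early_exit_def)
    from w have "\<exists>u. 0 \<le> u \<and> u \<le> T \<and> u \<le> T / 2 ^ r \<and> 1 < \<bar>L u \<omega>\<bar>" for r
      unfolding early_exit_def using tm_bounds by blast
    then obtain u where u: "\<And>r. 0 \<le> u r" "\<And>r. u r \<le> T" "\<And>r. u r \<le> T / 2 ^ r" "\<And>r. 1 < \<bar>L (u r) \<omega>\<bar>"
      by metis
    have "u \<longlonglongrightarrow> 0"
      by (rule tendsto_sandwich[OF _ _ tendsto_const mesh_tendsto_0[of T]]) (use u in auto)
    hence "(\<lambda>r. L (u r) \<omega>) \<longlonglongrightarrow> L 0 \<omega>"
      using u T_pos by (intro cadlag_on_right_limit[OF cadlag[OF sp]]) auto
    hence "(\<lambda>r. \<bar>L (u r) \<omega>\<bar>) \<longlonglongrightarrow> 0" using L_0[OF sp] by (simp add: tendsto_rabs_zero_iff)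
    hence "\<forall>\<^sub>F r in sequentially. \<bar>L (u r) \<omega>\<bar> < 1" by (rule order_tendstoD) simp
    thus False using u(4) by (auto simp: eventually_sequentially less_le_not_le dest!: spec)
  qed
  ultimately show ?thesis by simp
qed

text \<open>
  Write \<open>G j\<close> for the moment after \<open>j\<close> steps. Splitting at the first exit from \<open>{-1..1}\<close> gives
  \<open>G j \<le> exp \<theta> + exp \<theta> * C * p * Max {G i | i < j}\<close>, where \<open>p\<close> bounds the probability of
  an exit and \<open>C\<close> bounds the damped exponential of the exit step. If \<open>exp \<theta> * C * p \<le> 1 / 2\<close>
  then \<open>G j \<le> 2 * exp \<theta>\<close> follows by induction, uniformly in the grid.
\<close>

lemma exp_mom_short_bound:
  assumes \<theta>: "0 \<le> \<theta>"
    and p: "exp \<theta> * exp (\<theta> * real (Suc n) + \<theta>\<^sup>2) * prob (early_exit r0) \<le> 1 / 2"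
    and m: "r0 \<le> m" and j: "j \<le> 2 ^ (m - r0)"
  shows "exp_mom n \<theta> m j \<le> ennreal (2 * exp \<theta>)"
  using j
proof (induction j rule: less_induct)
  case (less j)
  define C where "C = exp (\<theta> * real (Suc n) + \<theta>\<^sup>2)"
  have jm: "j \<le> 2 ^ m" using less.prems by (rule order_trans) (simp add: power_increasing)
  define A where "A i = {\<omega> \<in> space P. (\<forall>l\<le>i. \<bar>L (tm m l) \<omega>\<bar> \<le> 1) \<and> 1 < \<bar>L (tm m (Suc i)) \<omega>\<bar>}" for i
  have A_F: "A i \<in> sets (F (tm m (Suc i)))" if "i < j" for i
  proof -
    have [measurable]: "L (tm m l) \<in> borel_measurable (F (tm m (Suc i)))" if "l \<le> Suc i" for l
      using that \<open>i < j\<close> jm by (intro L_tm_measurable_F) auto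
    have "A i = (\<Inter>l\<in>{..i}. {\<omega> \<in> space (F (tm m (Suc i))). \<bar>L (tm m l) \<omega>\<bar> \<le> 1}) \<inter>
        {\<omega> \<in> space (F (tm m (Suc i))). 1 < \<bar>L (tm m (Suc i)) \<omega>\<bar>}"
      using that jm by (subst (1 2) space_F) (auto simp: A_def intro!: tm_bounds)
    also have "\<dots> \<in> sets (F (tm m (Suc i)))"
      by (intro sets.Int sets.finite_INT) (auto simp: le_SucI)
    finally show ?thesis .
  qed
  have A_P: "A i \<in> sets P" if "i < j" for i
    using A_F[OF that] sets_F_P[of "tm m (Suc i)"] tm_bounds[of "Suc i" m] that jm by auto
  have A_sum: "(\<Sum>i<j. emeasure P (A i)) \<le> ennreal (prob (early_exit r0))"
  proof -
    have "(\<Sum>i<j. emeasure P (A i)) = emeasure P (\<Union>i<j. A i)"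
    proof (rule sum_emeasure)
      show "A ` {..<j} \<subseteq> sets P" using A_P by auto
      show "disjoint_family_on A {..<j}"
        unfolding disjoint_family_on_def
      proof (intro ballI impI)
        have "A i \<inter> A i' = {}" if "i < i'" for i i'
          using that by (auto simp: A_def dest!: spec[of _ "Suc i"])
        moreover fix i i' :: nat assume "i \<noteq> i'"
        ultimately show "A i \<inter> A i' = {}" by (metis Int_commute linorder_neqE_nat)
      qed
    qed simp
    also have "\<dots> \<le> emeasure P (early_exit r0)"
    proof (rule emeasure_mono[OF _ early_exit_sets], safe)
      fix i \<omega> assume i: "i < j" and w: "\<omega> \<in> A i"
      have "tm m (Suc i) \<le> tm m (2 ^ (m - r0))" using i less.prems T_pos by simp
      also have "\<dots> = T / 2 ^ r0" using grid_refine[OF m, of T 1] by (simp add: grid_def)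
      finally have "tm m (Suc i) \<le> T / 2 ^ r0" .
      moreover have "Suc i \<le> 2 ^ m" "1 < \<bar>L (tm m (Suc i)) \<omega>\<bar>" "\<omega> \<in> space P"
        using i jm w by (auto simp: A_def)
      ultimately show "\<omega> \<in> early_exit r0" unfolding early_exit_def by blast
    qed
    finally show ?thesis by (simp add: emeasure_eq_measure)
  qed
  have [measurable]: "L (tm m l) \<in> borel_measurable P" if "l \<le> j" for l
    using that jm by (intro L_tm_measurable) simp
  have incm [measurable]: "incr m l \<in> borel_measurable P" if "l < j" for l
    unfolding incr_def using that jm by (intro borel_measurable_diff L_tm_measurable) auto
  let ?h = "\<lambda>x. ennreal (exp (\<theta> * \<bar>x\<bar>))"
  let ?x = "\<lambda>i \<omega>. of_bool ((\<forall>l\<le>i. \<bar>L (tm m l) \<omega>\<bar> \<le> 1) \<and> 1 < \<bar>L (tm m (Suc i)) \<omega>\<bar>) :: ennreal"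
  let ?s = "\<lambda>i \<omega>. ennreal (exp \<theta>) * (?h (L (tm m (Suc i)) \<omega> - L (tm m i) \<omega>) * wgt n (incr m i \<omega>))"
  let ?G = "\<lambda>i \<omega>. ?h (L (tm m j) \<omega> - L (tm m (Suc i)) \<omega>) * (\<Prod>k\<in>{Suc i..<j}. wgt n (incr m k \<omega>))"
  have "exp_mom n \<theta> m j \<le> (\<integral>\<^sup>+\<omega>. ennreal (exp \<theta>) + (\<Sum>i<j. ennreal (exp \<theta> * C) * (indicator (A i) \<omega> * ?G i \<omega>)) \<partial>P)"
    unfolding exp_mom_def
  proof (rule nn_integral_mono)
    fix \<omega> assume w: "\<omega> \<in> space P"
    have "?h (L (tm m j) \<omega>) * (\<Prod>k<j. wgt n (incr m k \<omega>)) \<le> ennreal (exp \<theta>) +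
      (\<Sum>i<j. ?x i \<omega> * ?s i \<omega> * ?G i \<omega>)"
      using L_0[OF w] by (intro first_exit_bound[where S = "\<lambda>l. L (tm m l) \<omega>"] \<theta> wgt_le_1) simp
    also have "\<dots> \<le> ennreal (exp \<theta>) + (\<Sum>i<j. ennreal (exp \<theta> * C) * (indicator (A i) \<omega> * ?G i \<omega>))"
    proof (intro add_left_mono sum_mono)
      fix i
      have "?h (L (tm m (Suc i)) \<omega> - L (tm m i) \<omega>) * wgt n (incr m i \<omega>) \<le> ennreal C"
        using exp_minus_penalty_bound[OF \<theta>, of "incr m i \<omega>" n]
        by (simp add: ennreal_mult[symmetric] incr_def C_def)
      hence "?s i \<omega> \<le> ennreal (exp \<theta> * C)"
        by (simp add: ennreal_mult C_def mult_left_mono)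
      hence "?x i \<omega> * ?s i \<omega> * ?G i \<omega>
        \<le> ?x i \<omega> * ennreal (exp \<theta> * C) * ?G i \<omega>"
        by (intro mult_right_mono mult_left_mono) auto
      also have "\<dots> = ennreal (exp \<theta> * C) * (indicator (A i) \<omega> * ?G i \<omega>)"
        using w by (simp add: A_def indicator_def mult_ac)
      finally show "?x i \<omega> * ?s i \<omega> * ?G i \<omega>
        \<le> ennreal (exp \<theta> * C) * (indicator (A i) \<omega> * ?G i \<omega>)" .
    qed
    finally show "?h (L (tm m j) \<omega>) * (\<Prod>k<j. wgt n (incr m k \<omega>)) \<le>
      ennreal (exp \<theta>) + (\<Sum>i<j. ennreal (exp \<theta> * C) * (indicator (A i) \<omega> * ?G i \<omega>))" .
  qed
  also have "\<dots> = ennreal (exp \<theta>) + (\<Sum>i<j. ennreal (exp \<theta> * C) * (\<integral>\<^sup>+\<omega>. indicator (A i) \<omega> * ?G i \<omega> \<partial>P))"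
  proof -
    have meas: "(\<lambda>\<omega>. indicator (A i) \<omega> * ?G i \<omega>) \<in> borel_measurable P" if "i < j" for i
    proof -
      note [measurable] = A_P[OF that]
      have [measurable]: "L (tm m (Suc i)) \<in> borel_measurable P" using that jm by (intro L_tm_measurable) auto
      have [measurable]: "(\<lambda>\<omega>. (\<Prod>k\<in>{Suc i..<j}. wgt n (incr m k \<omega>))) \<in> borel_measurable P"
        by (intro borel_measurable_prod_ennreal measurable_compose[OF incm]) auto
      show ?thesis by measurable
    qed
    show ?thesis
    proof (subst nn_integral_add)
      have "(\<integral>\<^sup>+\<omega>. (\<Sum>i<j. ennreal (exp \<theta> * C) * (indicator (A i) \<omega> * ?G i \<omega>)) \<partial>P) =
        (\<Sum>i<j. \<integral>\<^sup>+\<omega>. ennreal (exp \<theta> * C) * (indicator (A i) \<omega> * ?G i \<omega>) \<partial>P)"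
        by (rule nn_integral_sum) (use meas in \<open>auto intro!: borel_measurable_times_ennreal[OF borel_measurable_const]\<close>)
      also have "\<dots> = (\<Sum>i<j. ennreal (exp \<theta> * C) * (\<integral>\<^sup>+\<omega>. indicator (A i) \<omega> * ?G i \<omega> \<partial>P))"
        by (intro sum.cong refl nn_integral_cmult meas) simp
      finally show "(\<integral>\<^sup>+\<omega>. ennreal (exp \<theta>) \<partial>P) +
          (\<integral>\<^sup>+\<omega>. (\<Sum>i<j. ennreal (exp \<theta> * C) * (indicator (A i) \<omega> * ?G i \<omega>)) \<partial>P) =
        ennreal (exp \<theta>) + (\<Sum>i<j. ennreal (exp \<theta> * C) * (\<integral>\<^sup>+\<omega>. indicator (A i) \<omega> * ?G i \<omega> \<partial>P))"
        by (simp add: emeasure_space_1)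
    qed (use meas in \<open>auto intro!: borel_measurable_sum borel_measurable_times_ennreal[OF borel_measurable_const]\<close>)
  qed
  also have "\<dots> = ennreal (exp \<theta>) + (\<Sum>i<j. ennreal (exp \<theta> * C) * (emeasure P (A i) * exp_mom n \<theta> m (j - Suc i)))"
  proof (intro arg_cong2[where f = "(+)"] sum.cong refl arg_cong2[where f = "(*)"])
    fix i assume "i \<in> {..<j}"
    hence i: "i < j" by simp
    have "(\<integral>\<^sup>+\<omega>. indicator (A i) \<omega> * ?G i \<omega> \<partial>P) =
      (\<integral>\<^sup>+\<omega>. indicator (A i) \<omega> * ?h (L (tm m (Suc i + (j - Suc i))) \<omega> - L (tm m (Suc i)) \<omega>) *
        (\<Prod>k\<in>{Suc i..<Suc i + (j - Suc i)}. wgt n (incr m k \<omega>)) \<partial>P)"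
      using i by (simp add: mult_ac)
    also have "\<dots> = (\<integral>\<^sup>+\<omega>. indicator (A i) \<omega> \<partial>P) * exp_mom n \<theta> m (j - Suc i)"
      unfolding exp_mom_def using i jm A_F[OF i] by (subst nn_integral_grid_steps) auto
    finally show "(\<integral>\<^sup>+\<omega>. indicator (A i) \<omega> * ?G i \<omega> \<partial>P) = emeasure P (A i) * exp_mom n \<theta> m (j - Suc i)"
      using A_P[OF i] by simp
  qed
  also have "\<dots> \<le> ennreal (exp \<theta>) + (\<Sum>i<j. ennreal (exp \<theta> * C) * (emeasure P (A i) * ennreal (2 * exp \<theta>)))"
    using less.prems by (intro add_left_mono sum_mono mult_left_mono less.IH) auto
  also have "\<dots> = ennreal (exp \<theta>) + ennreal (exp \<theta> * C) * ennreal (2 * exp \<theta>) * (\<Sum>i<j. emeasure P (A i))"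
    by (simp add: sum_distrib_left mult_ac)
  also have "\<dots> \<le> ennreal (exp \<theta>) + ennreal (exp \<theta> * C) * ennreal (2 * exp \<theta>) * ennreal (prob (early_exit r0))"
    by (intro add_left_mono mult_left_mono A_sum) auto
  also have "\<dots> = ennreal (exp \<theta> + 2 * exp \<theta> * (exp \<theta> * C * prob (early_exit r0)))"
    by (simp add: ennreal_mult[symmetric] ennreal_plus[symmetric] C_def mult_ac del: ennreal_plus)
  also have "\<dots> \<le> ennreal (exp \<theta> + 2 * exp \<theta> * (1 / 2))"
    unfolding C_def by (intro ennreal_leI add_left_mono mult_left_mono p) auto
  finally show ?case by simp
qed

lemma exp_mom_submult:
  assumes "0 \<le> \<theta>" "i + j \<le> 2 ^ m"
  shows "exp_mom n \<theta> m (i + j) \<le> exp_mom n \<theta> m i * exp_mom n \<theta> m j"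
proof -
  let ?h = "\<lambda>x. ennreal (exp (\<theta> * \<bar>x\<bar>))"
  let ?Y = "\<lambda>\<omega>. ?h (L (tm m i) \<omega>) * (\<Prod>k<i. wgt n (incr m k \<omega>))"
  have "exp_mom n \<theta> m (i + j) \<le> (\<integral>\<^sup>+\<omega>. ?Y \<omega> * ?h (L (tm m (i + j)) \<omega> - L (tm m i) \<omega>) *
      (\<Prod>k\<in>{i..<i + j}. wgt n (incr m k \<omega>)) \<partial>P)"
    unfolding exp_mom_def
  proof (rule nn_integral_mono)
    fix \<omega>
    have "\<theta> * \<bar>L (tm m (i + j)) \<omega>\<bar> \<le> \<theta> * (\<bar>L (tm m i) \<omega>\<bar> + \<bar>L (tm m (i + j)) \<omega> - L (tm m i) \<omega>\<bar>)"
      using assms(1) by (intro mult_left_mono) auto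
    hence "?h (L (tm m (i + j)) \<omega>) \<le> ?h (L (tm m i) \<omega>) * ?h (L (tm m (i + j)) \<omega> - L (tm m i) \<omega>)"
      by (simp add: ennreal_mult[symmetric] exp_add[symmetric] distrib_left)
    moreover have "(\<Prod>k<i + j. wgt n (incr m k \<omega>)) =
        (\<Prod>k<i. wgt n (incr m k \<omega>)) * (\<Prod>k\<in>{i..<i + j}. wgt n (incr m k \<omega>))"
      using prod.atLeastLessThan_concat[of 0 i "i + j" "\<lambda>k. wgt n (incr m k \<omega>)"]
      by (simp add: lessThan_atLeast0)
    ultimately show "?h (L (tm m (i + j)) \<omega>) * (\<Prod>k<i + j. wgt n (incr m k \<omega>)) \<le>
      ?Y \<omega> * ?h (L (tm m (i + j)) \<omega> - L (tm m i) \<omega>) * (\<Prod>k\<in>{i..<i + j}. wgt n (incr m k \<omega>))"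
      using mult_right_mono[of "?h (L (tm m (i + j)) \<omega>)"
          "?h (L (tm m i) \<omega>) * ?h (L (tm m (i + j)) \<omega> - L (tm m i) \<omega>)" "\<Prod>k<i + j. wgt n (incr m k \<omega>)"]
      by (simp add: mult_ac)
  qed
  also have "\<dots> = (\<integral>\<^sup>+\<omega>. ?Y \<omega> \<partial>P) * (\<integral>\<^sup>+\<omega>. ?h (L (tm m j) \<omega>) * (\<Prod>k<j. wgt n (incr m k \<omega>)) \<partial>P)"
  proof (rule nn_integral_grid_steps)
    have [measurable]: "L (tm m i) \<in> borel_measurable (F (tm m i))"
      using assms by (intro L_tm_measurable_F) auto
    have [measurable]: "(\<lambda>\<omega>. \<Prod>k<i. wgt n (incr m k \<omega>)) \<in> borel_measurable (F (tm m i))"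
      using assms by (intro borel_measurable_prod_ennreal measurable_compose[OF incr_measurable_F]) auto
    show "?Y \<in> borel_measurable (F (tm m i))" by measurable
  qed (use assms in auto)
  finally show ?thesis by (simp only: exp_mom_def)
qed

lemma exp_mom_power:
  assumes "0 \<le> \<theta>" "c * j \<le> 2 ^ m"
  shows "exp_mom n \<theta> m (c * j) \<le> exp_mom n \<theta> m j ^ c"
  using assms(2)
proof (induction c)
  case 0
  have "exp_mom n \<theta> m 0 = (\<integral>\<^sup>+\<omega>. 1 \<partial>P)"
    unfolding exp_mom_def by (intro nn_integral_cong) (simp add: L_0)
  thus ?case by (simp add: emeasure_space_1)
next
  case (Suc c)
  have "exp_mom n \<theta> m (Suc c * j) \<le> exp_mom n \<theta> m j * exp_mom n \<theta> m (c * j)"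
    using exp_mom_submult[OF assms(1), of j "c * j" m n] Suc.prems by simp
  also have "\<dots> \<le> exp_mom n \<theta> m j * exp_mom n \<theta> m j ^ c"
    using Suc by (intro mult_left_mono Suc.IH) auto
  finally show ?case by simp
qed

text \<open>
  On a time interval so short that leaving \<open>{-1..1}\<close> is unlikely, the moments of the damped grid
  sums are bounded uniformly in the grid. Finitely many such intervals cover the time horizon.
\<close>

lemma damped_exp_moment_finite:
  "(\<integral>\<^sup>+\<omega>. ennreal (exp (\<theta> * \<bar>L T \<omega>\<bar>)) * ennreal (damp n 0 T \<omega>) \<partial>P) < \<infinity>"
proof -
  let ?\<theta> = "max 0 \<theta>"
  define C where "C = exp ?\<theta> * exp (?\<theta> * real (Suc n) + ?\<theta>\<^sup>2)"
  have "(\<lambda>r. C * prob (early_exit r)) \<longlonglongrightarrow> C * 0"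
    by (intro tendsto_mult tendsto_const early_exit_tendsto_0)
  hence "\<forall>\<^sub>F r in sequentially. C * prob (early_exit r) < 1 / 2"
    by (rule order_tendstoD) simp
  then obtain r0 where r0: "C * prob (early_exit r0) \<le> 1 / 2"
    unfolding eventually_sequentially by (meson less_imp_le order_refl)
  let ?B = "ennreal (2 * exp ?\<theta>) ^ (2 ^ r0)"
  let ?u = "\<lambda>m \<omega>. ennreal (exp (\<theta> * \<bar>L T \<omega>\<bar>)) * ennreal (exp (- grid_sum (penalty n) T (\<lambda>t. L t \<omega>) (m + r0) 0 T))"
  have LT [measurable]: "L T \<in> borel_measurable P" using T_pos by (intro L_measurable) auto
  have gm [measurable]: "(\<lambda>\<omega>. grid_sum (penalty n) T (\<lambda>t. L t \<omega>) m 0 T) \<in> borel_measurable P" for m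
    using measurable_F_P[OF grid_sum_measurable[of 0 m 0 1]] T_pos by (simp add: grid_def)
  have bound: "(\<integral>\<^sup>+\<omega>. ?u m \<omega> \<partial>P) \<le> ?B" for m
  proof -
    have "(\<integral>\<^sup>+\<omega>. ?u m \<omega> \<partial>P) \<le> exp_mom n ?\<theta> (m + r0) (2 ^ (m + r0))"
      unfolding exp_mom_def
    proof (rule nn_integral_mono)
      fix \<omega>
      have "\<theta> * \<bar>L T \<omega>\<bar> \<le> ?\<theta> * \<bar>L T \<omega>\<bar>" by (intro mult_right_mono) auto
      moreover have "ennreal (exp (- grid_sum (penalty n) T (\<lambda>t. L t \<omega>) (m + r0) 0 T)) =
          (\<Prod>k<2 ^ (m + r0). wgt n (incr (m + r0) k \<omega>))"
        using grid_damp_eq[of "m + r0" "m + r0" n \<omega> 0 "2 ^ (m + r0)"] by (simp add: lessThan_atLeast0)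
      ultimately show "?u m \<omega> \<le> ennreal (exp (?\<theta> * \<bar>L (tm (m + r0) (2 ^ (m + r0))) \<omega>\<bar>)) *
          (\<Prod>k<2 ^ (m + r0). wgt n (incr (m + r0) k \<omega>))"
        by (auto intro!: mult_right_mono)
    qed
    also have "(2::nat) ^ (m + r0) = 2 ^ r0 * 2 ^ m" by (simp add: power_add)
    also have "exp_mom n ?\<theta> (m + r0) (2 ^ r0 * 2 ^ m) \<le> exp_mom n ?\<theta> (m + r0) (2 ^ m) ^ (2 ^ r0)"
      by (rule exp_mom_power) (simp_all add: power_add)
    also have "\<dots> \<le> ?B"
      by (intro power_mono exp_mom_short_bound[OF _ r0[unfolded C_def]]) auto
    finally show ?thesis .
  qed
  have "(\<integral>\<^sup>+\<omega>. ennreal (exp (\<theta> * \<bar>L T \<omega>\<bar>)) * ennreal (damp n 0 T \<omega>) \<partial>P) = (\<integral>\<^sup>+\<omega>. liminf (\<lambda>m. ?u m \<omega>) \<partial>P)"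
  proof (rule nn_integral_cong)
    fix \<omega> assume w: "\<omega> \<in> space P"
    have "(\<lambda>m. ?u m \<omega>) \<longlonglongrightarrow> ennreal (exp (\<theta> * \<bar>L T \<omega>\<bar>)) * ennreal (damp n 0 T \<omega>)"
      using T_pos by (intro ennreal_tendsto_cmult tendsto_ennrealI damp_LIMSEQ w) auto
    thus "ennreal (exp (\<theta> * \<bar>L T \<omega>\<bar>)) * ennreal (damp n 0 T \<omega>) = liminf (\<lambda>m. ?u m \<omega>)"
      by (simp add: lim_imp_Liminf)
  qed
  also have "\<dots> \<le> liminf (\<lambda>m. \<integral>\<^sup>+\<omega>. ?u m \<omega> \<partial>P)"
    by (rule nn_integral_liminf) measurable
  also have "\<dots> \<le> liminf (\<lambda>m. ?B)"
    by (intro Liminf_mono always_eventually allI bound)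
  also have "\<dots> = ?B" by (simp add: Liminf_const)
  also have "\<dots> < \<infinity>" by (simp add: power_less_top_ennreal)
  finally show ?thesis .
qed

end

section \<open>Minimising a moment generating function\<close>

lemma abs_exp_minus_1_le: "\<bar>exp u - 1\<bar> \<le> \<bar>u\<bar> * exp \<bar>u\<bar>" for u :: real
proof (cases "0 \<le> u")
  case True
  have "(1 - u) * exp u \<le> exp (- u) * exp u"
    using exp_ge_add_one_self[of "- u"] by (intro mult_right_mono) auto
  also have "\<dots> = 1" by (simp add: exp_add[symmetric])
  finally show ?thesis using True by (simp add: algebra_simps)
next
  case False
  have "1 - exp u \<le> - u" using exp_ge_add_one_self[of u] by linarith
  also have "- u * 1 \<le> - u * exp (- u)" using False by (intro mult_left_mono) auto
  finally show ?thesis using False by simp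
qed

lemma abs_le_exp_sum: "\<bar>x\<bar> \<le> exp x + exp (- x)" for x :: real
  using exp_ge_add_one_self[of x] exp_ge_add_one_self[of "- x"] exp_gt_zero[of x] exp_gt_zero[of "- x"]
  by linarith

lemma exp_abs_le_exp_sum: "exp \<bar>x\<bar> \<le> exp x + exp (- x)" for x :: real
  by (cases "0 \<le> x") auto

context finite_measure
begin

text \<open>
  The bound \<open>exp u \<ge> max 0 u\<close> makes the moment generating function grow at least linearly, with the
  mean of the positive part of \<open>X\<close> as slope.
\<close>

lemma mgf_coercive_right:
  assumes X [measurable]: "X \<in> borel_measurable M"
    and int: "\<And>\<theta>. integrable M (\<lambda>x. exp (\<theta> * X x :: real))"
    and pos: "measure M {x \<in> space M. 0 < X x} \<noteq> 0"
  shows "\<exists>b. \<forall>\<theta>>b. K < (\<integral>x. exp (\<theta> * X x) \<partial>M)"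
proof -
  define q where "q = (\<integral>x. max 0 (X x) \<partial>M)"
  have le_exp: "max 0 u \<le> exp u" for u :: real
    using exp_ge_add_one_self[of u] exp_gt_zero[of u] by linarith
  have q_int: "integrable M (\<lambda>x. max 0 (X x))"
    using int[of 1] le_exp by (intro Bochner_Integration.integrable_bound[OF int[of 1]]) auto
  have "q \<noteq> 0"
  proof
    assume "q = 0"
    hence "AE x in M. max 0 (X x) = 0"
      unfolding q_def by (subst (asm) integral_nonneg_eq_0_iff_AE[OF q_int]) auto
    hence "AE x in M. \<not> 0 < X x" by eventually_elim auto
    thus False using pos by (subst (asm) AE_iff_measurable[OF _ refl]) (auto simp: measure_def)
  qed
  moreover have "0 \<le> q" unfolding q_def by (intro integral_nonneg_AE) auto
  ultimately have q: "0 < q" by simp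
  have low: "\<theta> * q \<le> (\<integral>x. exp (\<theta> * X x) \<partial>M)" if "0 \<le> \<theta>" for \<theta>
  proof -
    have "\<theta> * max 0 (X x) \<le> exp (\<theta> * X x)" for x
      using le_exp[of "\<theta> * X x"] that by (simp add: max_mult_distrib_left)
    hence "(\<integral>x. \<theta> * max 0 (X x) \<partial>M) \<le> (\<integral>x. exp (\<theta> * X x) \<partial>M)"
      by (intro integral_mono integrable_mult_right q_int int)
    thus ?thesis by (simp add: q_def)
  qed
  show ?thesis
  proof (intro exI[of _ "max 0 (K / q)"] allI impI)
    fix \<theta> assume \<theta>: "max 0 (K / q) < \<theta>"
    hence "K < \<theta> * q" using q by (simp add: pos_divide_less_eq)
    thus "K < (\<integral>x. exp (\<theta> * X x) \<partial>M)" using low[of \<theta>] \<theta> by simp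
  qed
qed

lemma mgf_coercive:
  assumes X [measurable]: "X \<in> borel_measurable M"
    and int: "\<And>\<theta>. integrable M (\<lambda>x. exp (\<theta> * X x :: real))"
    and pos: "measure M {x \<in> space M. 0 < X x} \<noteq> 0"
    and neg: "measure M {x \<in> space M. X x < 0} \<noteq> 0"
  shows "\<exists>b. \<forall>\<theta>. b < \<bar>\<theta>\<bar> \<longrightarrow> K < (\<integral>x. exp (\<theta> * X x) \<partial>M)"
proof -
  obtain b where b: "\<forall>\<theta>>b. K < (\<integral>x. exp (\<theta> * X x) \<partial>M)"
    using mgf_coercive_right[OF X int pos] by blast
  have "\<exists>b. \<forall>\<theta>>b. K < (\<integral>x. exp (\<theta> * - X x) \<partial>M)"
  proof (rule mgf_coercive_right)
    show "integrable M (\<lambda>x. exp (\<theta> * - X x))" for \<theta> using int[of "- \<theta>"] by simp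
  qed (use neg in simp_all)
  then obtain b' where b': "\<forall>\<theta>>b'. K < (\<integral>x. exp (\<theta> * - X x) \<partial>M)" by blast
  show ?thesis
  proof (intro exI[of _ "max b b'"] allI impI)
    fix \<theta> assume \<theta>: "max b b' < \<bar>\<theta>\<bar>"
    show "K < (\<integral>x. exp (\<theta> * X x) \<partial>M)"
    proof (cases "0 \<le> \<theta>")
      case True
      thus ?thesis using b \<theta> by auto
    next
      case False
      thus ?thesis using b'[rule_format, of "- \<theta>"] \<theta> by auto
    qed
  qed
qed

text \<open>
  Near \<open>\<theta>\<close> the difference quotients are dominated by exponentials with parameters
  \<open>\<theta> + 2\<close> and \<open>\<theta> - 2\<close>.
\<close>

lemma mgf_deriv:
  assumes X [measurable]: "X \<in> borel_measurable M"
    and int: "\<And>\<theta>. integrable M (\<lambda>x. exp (\<theta> * X x :: real))"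
  shows "integrable M (\<lambda>x. X x * exp (\<theta> * X x))"
    and "((\<lambda>\<theta>. \<integral>x. exp (\<theta> * X x) \<partial>M) has_real_derivative (\<integral>x. X x * exp (\<theta> * X x) \<partial>M)) (at \<theta>)"
proof -
  show X_int: "integrable M (\<lambda>x. X x * exp (\<theta> * X x))"
  proof (rule Bochner_Integration.integrable_bound)
    show "integrable M (\<lambda>x. exp ((\<theta> + 1) * X x) + exp ((\<theta> - 1) * X x))"
      by (intro Bochner_Integration.integrable_add int)
    show "AE x in M. norm (X x * exp (\<theta> * X x)) \<le> norm (exp ((\<theta> + 1) * X x) + exp ((\<theta> - 1) * X x))"
    proof (rule AE_I2)
      fix x
      have "\<bar>X x\<bar> * exp (\<theta> * X x) \<le> (exp (X x) + exp (- X x)) * exp (\<theta> * X x)"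
        by (intro mult_right_mono abs_le_exp_sum) simp
      also have "\<dots> = exp ((\<theta> + 1) * X x) + exp ((\<theta> - 1) * X x)"
        by (simp add: exp_add[symmetric] algebra_simps)
      finally show "norm (X x * exp (\<theta> * X x)) \<le> norm (exp ((\<theta> + 1) * X x) + exp ((\<theta> - 1) * X x))"
        by (simp add: abs_mult)
    qed
  qed simp
  have "((\<lambda>h. ((\<integral>x. exp ((\<theta> + h) * X x) \<partial>M) - (\<integral>x. exp (\<theta> * X x) \<partial>M)) / h) \<longlongrightarrow>
      (\<integral>x. X x * exp (\<theta> * X x) \<partial>M)) (at 0 within ball 0 1)"
    unfolding tendsto_at_iff_sequentially
  proof (intro allI impI)
    fix h :: "nat \<Rightarrow> real" assume "\<forall>i. h i \<in> ball 0 1 - {0}" and h0: "h \<longlonglongrightarrow> 0"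
    hence h: "\<bar>h i\<bar> < 1" "h i \<noteq> 0" for i by (auto simp: dist_real_def)
    let ?q = "\<lambda>i x. (exp (h i * X x) - 1) / h i * exp (\<theta> * X x)"
    have "(\<lambda>i. \<integral>x. ?q i x \<partial>M) \<longlonglongrightarrow> (\<integral>x. X x * exp (\<theta> * X x) \<partial>M)"
    proof (rule integral_dominated_convergence[where w = "\<lambda>x. exp ((\<theta> + 2) * X x) + exp ((\<theta> - 2) * X x)"])
      show "integrable M (\<lambda>x. exp ((\<theta> + 2) * X x) + exp ((\<theta> - 2) * X x))"
        by (intro Bochner_Integration.integrable_add int)
      show "AE x in M. (\<lambda>i. ?q i x) \<longlonglongrightarrow> X x * exp (\<theta> * X x)"
      proof (intro AE_I2 tendsto_mult tendsto_const)
        fix x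
        have "((\<lambda>u. exp (u * X x)) has_real_derivative X x) (at 0)"
          by (auto intro!: derivative_eq_intros)
        hence lim: "((\<lambda>u. (exp (u * X x) - 1) / u) \<longlongrightarrow> X x) (at 0)"
          by (simp add: DERIV_def)
        have "filterlim h (at 0) sequentially"
          using h0 h(2) by (simp add: filterlim_at)
        from filterlim_compose[OF lim this]
        show "(\<lambda>i. (exp (h i * X x) - 1) / h i) \<longlonglongrightarrow> X x" .
      qed
      fix i
      show "AE x in M. norm (?q i x) \<le> exp ((\<theta> + 2) * X x) + exp ((\<theta> - 2) * X x)"
      proof (rule AE_I2)
        fix x
        have "\<bar>exp (h i * X x) - 1\<bar> \<le> \<bar>h i * X x\<bar> * exp \<bar>h i * X x\<bar>"
          by (rule abs_exp_minus_1_le)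
        also have "\<dots> \<le> (\<bar>h i\<bar> * \<bar>X x\<bar>) * exp \<bar>X x\<bar>"
          using h(1)[of i] by (auto simp: abs_mult intro!: mult_left_mono mult_left_le_one_le)
        also have "\<dots> = \<bar>h i\<bar> * (\<bar>X x\<bar> * exp \<bar>X x\<bar>)" by simp
        also have "\<dots> \<le> \<bar>h i\<bar> * (exp \<bar>X x\<bar> * exp \<bar>X x\<bar>)"
        proof (intro mult_left_mono mult_right_mono)
          show "\<bar>X x\<bar> \<le> exp \<bar>X x\<bar>" using exp_ge_add_one_self[of "\<bar>X x\<bar>"] by linarith
        qed auto
        also have "exp \<bar>X x\<bar> * exp \<bar>X x\<bar> = exp \<bar>2 * X x\<bar>" by (simp add: exp_add[symmetric] abs_mult)
        also have "\<bar>h i\<bar> * \<dots> \<le> \<bar>h i\<bar> * (exp (2 * X x) + exp (- (2 * X x)))"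
          by (intro mult_left_mono exp_abs_le_exp_sum) simp
        finally have "\<bar>exp (h i * X x) - 1\<bar> / \<bar>h i\<bar> \<le> exp (2 * X x) + exp (- (2 * X x))"
          using h(2)[of i] by (simp add: divide_le_eq mult.commute)
        hence "\<bar>exp (h i * X x) - 1\<bar> / \<bar>h i\<bar> * exp (\<theta> * X x) \<le>
            (exp (2 * X x) + exp (- (2 * X x))) * exp (\<theta> * X x)"
          by (intro mult_right_mono) auto
        also have "\<dots> = exp ((\<theta> + 2) * X x) + exp ((\<theta> - 2) * X x)"
          by (simp add: exp_add[symmetric] algebra_simps)
        finally show "norm (?q i x) \<le> exp ((\<theta> + 2) * X x) + exp ((\<theta> - 2) * X x)"
          by (simp add: abs_mult)
      qed
    qed simp_all
    moreover have "(\<integral>x. ?q i x \<partial>M) =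
        ((\<integral>x. exp ((\<theta> + h i) * X x) \<partial>M) - (\<integral>x. exp (\<theta> * X x) \<partial>M)) / h i" for i
    proof -
      have "(\<integral>x. ?q i x \<partial>M) = (\<integral>x. (exp ((\<theta> + h i) * X x) - exp (\<theta> * X x)) / h i \<partial>M)"
        by (simp add: algebra_simps exp_add)
      also have "\<dots> = (\<integral>x. exp ((\<theta> + h i) * X x) - exp (\<theta> * X x) \<partial>M) / h i" by simp
      also have "\<dots> = ((\<integral>x. exp ((\<theta> + h i) * X x) \<partial>M) - (\<integral>x. exp (\<theta> * X x) \<partial>M)) / h i"
        by (simp add: Bochner_Integration.integral_diff[OF int int])
      finally show ?thesis .
    qed
    ultimately show "((\<lambda>h. ((\<integral>x. exp ((\<theta> + h) * X x) \<partial>M) - (\<integral>x. exp (\<theta> * X x) \<partial>M)) / h) \<circ> h)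
        \<longlonglongrightarrow> (\<integral>x. X x * exp (\<theta> * X x) \<partial>M)"
      by (simp only: comp_def)
  qed
  \<comment> \<open>the restriction to the unit ball provides the bound on \<open>h\<close> for all members of the sequence\<close>
  moreover have "at (0::real) within ball 0 1 = at 0" by (rule at_within_open) auto
  ultimately show "((\<lambda>\<theta>. \<integral>x. exp (\<theta> * X x) \<partial>M) has_real_derivative
      (\<integral>x. X x * exp (\<theta> * X x) \<partial>M)) (at \<theta>)"
    by (simp add: DERIV_def)
qed

lemma mgf_minimiser:
  assumes X [measurable]: "X \<in> borel_measurable M"
    and int: "\<And>\<theta>. integrable M (\<lambda>x. exp (\<theta> * X x :: real))"
    and pos: "measure M {x \<in> space M. 0 < X x} \<noteq> 0"
    and neg: "measure M {x \<in> space M. X x < 0} \<noteq> 0"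
  obtains \<theta> where "\<forall>\<theta>'. (\<integral>x. exp (\<theta> * X x) \<partial>M) \<le> (\<integral>x. exp (\<theta>' * X x) \<partial>M)"
    and "(\<integral>x. X x * exp (\<theta> * X x) \<partial>M) = 0"
proof -
  let ?f = "\<lambda>\<theta>. \<integral>x. exp (\<theta> * X x) \<partial>M"
  obtain b0 where b0: "\<forall>\<theta>. b0 < \<bar>\<theta>\<bar> \<longrightarrow> ?f 0 < ?f \<theta>"
    using mgf_coercive[OF assms] by blast
  define b where "b = max 0 b0"
  have "continuous_on {- b..b} ?f"
    by (intro continuous_at_imp_continuous_on ballI DERIV_isCont[OF mgf_deriv(2)[OF X int]])
  then obtain \<theta> where \<theta>: "\<theta> \<in> {- b..b}" "\<forall>y\<in>{- b..b}. ?f \<theta> \<le> ?f y"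
    using continuous_attains_inf[of "{- b..b}" ?f] by (auto simp: b_def)
  have min: "?f \<theta> \<le> ?f y" for y
  proof (cases "\<bar>y\<bar> \<le> b")
    case True
    thus ?thesis by (intro \<theta>(2)[rule_format]) auto
  next
    case False
    hence "?f 0 < ?f y" using b0 by (auto simp: b_def)
    moreover have "?f \<theta> \<le> ?f 0" by (intro \<theta>(2)[rule_format]) (simp add: b_def)
    ultimately show ?thesis by linarith
  qed
  have "(\<integral>x. X x * exp (\<theta> * X x) \<partial>M) = 0"
    by (rule DERIV_local_min[OF mgf_deriv(2)[OF X int] zero_less_one]) (use min in auto)
  with min show thesis by (intro that) auto
qed

end

section \<open>Extended expectations\<close>

lemma ext_expectation_mono_AE:
  assumes "AE x in M. f x \<le> g x"
  shows "ext_expectation M f \<le> ext_expectation M g"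
  unfolding ext_expectation_def
proof (intro ereal_minus_mono)
  show "enn2ereal (\<integral>\<^sup>+x. ennreal (f x) \<partial>M) \<le> enn2ereal (\<integral>\<^sup>+x. ennreal (g x) \<partial>M)"
    using assms by (intro iffD1[OF less_eq_ennreal.rep_eq] nn_integral_mono_AE)
       (elim eventually_mono, simp add: ennreal_leI)
  show "enn2ereal (\<integral>\<^sup>+x. ennreal (- g x) \<partial>M) \<le> enn2ereal (\<integral>\<^sup>+x. ennreal (- f x) \<partial>M)"
    using assms by (intro iffD1[OF less_eq_ennreal.rep_eq] nn_integral_mono_AE)
       (elim eventually_mono, simp add: ennreal_leI)
qed

lemma ext_expectation_eq_integral:
  assumes "integrable M f"
  shows "ext_expectation M f = ereal (integral\<^sup>L M f)"
proof -
  have "(\<integral>\<^sup>+x. ennreal (f x) \<partial>M) \<noteq> \<infinity>" "(\<integral>\<^sup>+x. ennreal (- f x) \<partial>M) \<noteq> \<infinity>"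
    using assms by (auto simp: real_integrable_def)
  then obtain a b where "0 \<le> a" "(\<integral>\<^sup>+x. ennreal (f x) \<partial>M) = ennreal a"
      "0 \<le> b" "(\<integral>\<^sup>+x. ennreal (- f x) \<partial>M) = ennreal b"
    by (metis ennreal_cases infinity_ennreal_def)
  thus ?thesis unfolding ext_expectation_def real_lebesgue_integral_def[OF assms] by simp
qed

text \<open>The convex conjugate of \<open>z ln z - z\<close> is the exponential.\<close>

lemma young_exp: "0 \<le> z \<Longrightarrow> z * u \<le> z * ln z - z + exp u" for z u :: real
proof (cases "z = 0")
  case False
  assume "0 \<le> z"
  with False have z: "0 < z" by simp
  have "z * (1 + (u - ln z)) \<le> z * exp (u - ln z)"
    using z by (intro mult_left_mono exp_ge_add_one_self) auto
  also have "\<dots> = exp u" using z by (simp add: exp_diff)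
  finally show ?thesis by (simp add: algebra_simps)
qed simp


section \<open>Consequences of stationary independent increments\<close>

context levy
begin

lemma nn_integral_L_diff:
  assumes st: "0 \<le> s" "s \<le> t" "t \<le> T" and A: "A \<in> sets (F s)"
    and [measurable]: "h \<in> borel_measurable borel"
  shows "(\<integral>\<^sup>+\<omega>. indicator A \<omega> * h (L t \<omega> - L s \<omega>) \<partial>P) = emeasure P A * (\<integral>\<^sup>+\<omega>. h (L (t - s) \<omega>) \<partial>P)"
proof -
  have [measurable]: "A \<in> sets P" using A sets_F_P[of s] st by auto
  have [measurable]: "L (t - s) \<in> borel_measurable P" using st by (intro L_measurable) auto
  have "(\<integral>\<^sup>+\<omega>. indicator A \<omega> * h (L t \<omega> - L s \<omega>) \<partial>P) =
     (\<integral>\<^sup>+\<omega>. indicator A \<omega> * (\<integral>\<^sup>+y. h y \<partial>distr P borel (L (t - s))) \<partial>P)"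
    using A by (intro nn_integral_increment[OF st, where V = "\<lambda>_. 0" and h = "\<lambda>_. h"]) auto
  also have "(\<integral>\<^sup>+y. h y \<partial>distr P borel (L (t - s))) = (\<integral>\<^sup>+\<omega>. h (L (t - s) \<omega>) \<partial>P)"
    by (rule nn_integral_distr) auto
  finally show ?thesis by (simp add: nn_integral_multc)
qed

lemma prob_L_diff:
  assumes st: "0 \<le> s" "s \<le> t" "t \<le> T" and [measurable]: "Measurable.pred borel p"
  shows "prob {\<omega> \<in> space P. p (L t \<omega> - L s \<omega>)} = prob {\<omega> \<in> space P. p (L (t - s) \<omega>)}"
proof -
  note [measurable] = L_measurable[of s] L_measurable[of t] L_measurable[of "t - s"]
  have "measure (distr P borel (\<lambda>\<omega>. L t \<omega> - L s \<omega>)) {x. p x} = measure (distr P borel (L (t - s))) {x. p x}"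
    by (simp add: distr_increment[OF st])
  thus ?thesis using st by (simp add: measure_distr vimage_def Collect_conj_eq Int_commute)
qed

text \<open>
  The jump at \<open>u\<close> is the limit of \<open>L u - L v\<close> as \<open>v\<close> increases to \<open>u\<close>, and these increments are
  distributed like \<open>L (u - v)\<close>, which tends to 0. The exceptional set is taken in \<open>F T\<close> so that the
  statement passes on to every absolutely continuous measure on that \<open>\<sigma>\<close>-algebra.
\<close>

lemma AE_continuous:
  assumes u: "0 \<le> u" "u \<le> T"
  shows "AE \<omega> in restr_to_subalg P (F T). \<forall>v. (\<forall>m. 0 \<le> v m \<and> v m \<le> T) \<longrightarrow> v \<longlonglongrightarrow> u \<longrightarrow>
      (\<lambda>m. L (v m) \<omega>) \<longlonglongrightarrow> L u \<omega>"
proof -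
  define v where "v m = u - u / 2 ^ m" for m :: nat
  have v: "0 \<le> v m" "v m \<le> u" "v m \<le> T" "u - v m = u / 2 ^ m" "0 \<le> u / 2 ^ m" "u / 2 ^ m \<le> T" for m
  proof -
    have "u / 2 ^ m \<le> u" using u divide_left_mono[of 1 "2 ^ m" u] by simp
    moreover have "0 \<le> u / 2 ^ m" using u by simp
    ultimately show "0 \<le> v m" "v m \<le> u" "v m \<le> T" "u - v m = u / 2 ^ m" "0 \<le> u / 2 ^ m" "u / 2 ^ m \<le> T"
      unfolding v_def using u by linarith+
  qed
  have F_meas: "L (v m) \<in> borel_measurable (F T)" "L u \<in> borel_measurable (F T)" for m
    using v u by (auto intro!: L_measurable_F)
  have v_lim: "v \<longlonglongrightarrow> u"
    using tendsto_diff[OF tendsto_const[of u] mesh_tendsto_0[of u]] by (simp add: v_def[abs_def])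
  have conv: "\<exists>l. (\<lambda>m. L (v m) \<omega>) \<longlonglongrightarrow> l" and
    cont: "(\<lambda>m. L (v m) \<omega>) \<longlonglongrightarrow> L u \<omega> \<Longrightarrow> \<forall>w. (\<forall>m. 0 \<le> w m \<and> w m \<le> T) \<longrightarrow> w \<longlonglongrightarrow> u \<longrightarrow>
      (\<lambda>m. L (w m) \<omega>) \<longlonglongrightarrow> L u \<omega>" if w: "\<omega> \<in> space P" for \<omega>
  proof -
    obtain l where l: "\<forall>e>0. \<exists>d>0. (\<forall>r. u \<le> r \<and> r < u + d \<and> r \<le> T \<longrightarrow> \<bar>L r \<omega> - L u \<omega>\<bar> < e) \<and>
                              (\<forall>r. u - d < r \<and> r < u \<and> 0 \<le> r \<longrightarrow> \<bar>L r \<omega> - l\<bar> < e)"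
      by (rule cadlag_on_local[OF cadlag[OF w] u])
    have lim: "(\<lambda>m. L (v m) \<omega>) \<longlonglongrightarrow> l" if "0 < u"
    proof (rule tendstoI)
      fix e :: real assume "0 < e"
      with l obtain d where d: "d > 0" "\<forall>r. u - d < r \<and> r < u \<and> 0 \<le> r \<longrightarrow> \<bar>L r \<omega> - l\<bar> < e" by blast
      have "\<forall>\<^sub>F m in sequentially. u - d < v m"
        using order_tendstoD(1)[OF v_lim, of "u - d"] d(1) by simp
      thus "\<forall>\<^sub>F m in sequentially. dist (L (v m) \<omega>) l < e"
      proof eventually_elim
        case (elim m)
        have "v m < u" using that by (simp add: v_def)
        thus ?case using d(2) elim v(1)[of m] by (simp add: dist_real_def)
      qed
    qed
    show "\<exists>l. (\<lambda>m. L (v m) \<omega>) \<longlonglongrightarrow> l"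
    proof (cases "0 < u")
      case False
      hence "v = (\<lambda>m. 0)" using u by (simp add: v_def[abs_def])
      thus ?thesis by (auto intro: tendsto_const)
    qed (use lim in blast)
    assume vl: "(\<lambda>m. L (v m) \<omega>) \<longlonglongrightarrow> L u \<omega>"
    have lu: "l = L u \<omega>" if "0 < u" using LIMSEQ_unique[OF lim[OF that] vl] .
    show "\<forall>w. (\<forall>m. 0 \<le> w m \<and> w m \<le> T) \<longrightarrow> w \<longlonglongrightarrow> u \<longrightarrow> (\<lambda>m. L (w m) \<omega>) \<longlonglongrightarrow> L u \<omega>"
    proof (intro allI impI tendstoI)
      fix w :: "nat \<Rightarrow> real" and e :: real
      assume w: "\<forall>m. 0 \<le> w m \<and> w m \<le> T" and wl: "w \<longlonglongrightarrow> u" and "0 < e"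
      with l obtain d where d: "d > 0" "\<forall>r. u \<le> r \<and> r < u + d \<and> r \<le> T \<longrightarrow> \<bar>L r \<omega> - L u \<omega>\<bar> < e"
        "\<forall>r. u - d < r \<and> r < u \<and> 0 \<le> r \<longrightarrow> \<bar>L r \<omega> - l\<bar> < e" by blast
      have "\<forall>\<^sub>F m in sequentially. dist (w m) u < d" using wl d(1) by (rule tendstoD)
      thus "\<forall>\<^sub>F m in sequentially. dist (L (w m) \<omega>) (L u \<omega>) < e"
      proof eventually_elim
        case (elim m)
        hence near: "u - d < w m" "w m < u + d" by (auto simp: dist_real_def abs_if split: if_splits)
        show ?case
        proof (cases "u \<le> w m")
          case True
          thus ?thesis using d(2) near w by (simp add: dist_real_def)
        next
          case False
          moreover from False have "0 < u" using w[rule_format, of m] by linarith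
          ultimately show ?thesis using d(3) near w lu by (simp add: dist_real_def)
        qed
      qed
    qed
  qed
  have lim_meas [measurable]: "Measurable.pred (F T) (\<lambda>\<omega>. (\<lambda>m. L (v m) \<omega>) \<longlonglongrightarrow> L u \<omega>)"
    using F_meas by measurable
  have "AE \<omega> in P. (\<lambda>m. L (v m) \<omega>) \<longlonglongrightarrow> L u \<omega>"
  proof -
    note [measurable] = L_measurable[OF v(1) v(3)] L_measurable[OF u] L_measurable[OF v(5) v(6)]
    \<comment> \<open>the jump at \<open>u\<close>\<close>
    define K where "K \<omega> = lim (\<lambda>m. L u \<omega> - L (v m) \<omega>)" for \<omega>
    have K: "(\<lambda>m. L u \<omega> - L (v m) \<omega>) \<longlonglongrightarrow> K \<omega>" if "\<omega> \<in> space P" for \<omega>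
      unfolding K_def convergent_LIMSEQ_iff[symmetric]
      using conv[OF that] by (intro convergent_diff convergent_const) (auto simp: convergent_def)
    have [measurable]: "K \<in> borel_measurable P"
      by (rule borel_measurable_LIMSEQ_real[OF K]) measurable
    let ?h = "\<lambda>x. ennreal (min 1 \<bar>x\<bar>)"
    have 1: "(\<lambda>m. \<integral>\<^sup>+\<omega>. ?h (L u \<omega> - L (v m) \<omega>) \<partial>P) \<longlonglongrightarrow> (\<integral>\<^sup>+\<omega>. ?h (K \<omega>) \<partial>P)"
    proof (rule nn_integral_dominated_convergence[where w = "\<lambda>_. 1"])
      show "AE \<omega> in P. (\<lambda>m. ?h (L u \<omega> - L (v m) \<omega>)) \<longlonglongrightarrow> ?h (K \<omega>)"
        by (intro AE_I2 tendsto_ennrealI tendsto_min tendsto_const tendsto_rabs K)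
    qed (auto simp: emeasure_space_1)
    have 2: "(\<lambda>m. \<integral>\<^sup>+\<omega>. ?h (L (u / 2 ^ m) \<omega>) \<partial>P) \<longlonglongrightarrow> (\<integral>\<^sup>+\<omega>. 0 \<partial>P)"
    proof (rule nn_integral_dominated_convergence[where w = "\<lambda>_. 1"])
      show "AE \<omega> in P. (\<lambda>m. ?h (L (u / 2 ^ m) \<omega>)) \<longlonglongrightarrow> 0"
      proof (rule AE_I2)
        fix \<omega> assume w: "\<omega> \<in> space P"
        have "(\<lambda>m. L (u / 2 ^ m) \<omega>) \<longlonglongrightarrow> L 0 \<omega>"
          using T_pos v by (intro cadlag_on_right_limit[OF cadlag[OF w]] mesh_tendsto_0) auto
        hence "(\<lambda>m. ?h (L (u / 2 ^ m) \<omega>)) \<longlonglongrightarrow> ?h 0"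
          unfolding L_0[OF w] by (intro tendsto_ennrealI tendsto_min tendsto_const tendsto_rabs)
        thus "(\<lambda>m. ?h (L (u / 2 ^ m) \<omega>)) \<longlonglongrightarrow> 0" by simp
      qed
    qed (auto simp: emeasure_space_1)
    have eq: "(\<integral>\<^sup>+\<omega>. ?h (L u \<omega> - L (v m) \<omega>) \<partial>P) = (\<integral>\<^sup>+\<omega>. ?h (L (u / 2 ^ m) \<omega>) \<partial>P)" for m
    proof -
      have "space P \<in> sets (F (v m))" using space_F[OF v(1) v(3)] sets.top[of "F (v m)"] by simp
      from nn_integral_L_diff[OF v(1) v(2) u(2) this, of ?h]
      show ?thesis by (simp add: v(4) emeasure_space_1 cong: nn_integral_cong_simp)
    qed
    have "(\<integral>\<^sup>+\<omega>. ?h (K \<omega>) \<partial>P) = 0"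
      using LIMSEQ_unique[OF 1[unfolded eq] 2] by simp
    hence "AE \<omega> in P. ?h (K \<omega>) = 0" by (subst (asm) nn_integral_0_iff_AE) auto
    hence "AE \<omega> in P. K \<omega> = 0"
      by eventually_elim (auto simp: min_def split: if_splits)
    thus ?thesis
      using AE_space
    proof eventually_elim
      case (elim \<omega>)
      have "(\<lambda>m. L u \<omega> - (L u \<omega> - L (v m) \<omega>)) \<longlonglongrightarrow> L u \<omega> - K \<omega>"
        by (intro tendsto_diff tendsto_const K elim)
      thus ?case using elim by simp
    qed
  qed
  hence "AE \<omega> in restr_to_subalg P (F T). (\<lambda>m. L (v m) \<omega>) \<longlonglongrightarrow> L u \<omega>"
    using T_pos by (intro AE_restr_to_subalg2 subalgebra_F lim_meas) auto
  thus ?thesis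
    using AE_space by eventually_elim (intro cont, simp_all add: space_restr_to_subalg)
qed

end

section \<open>Levy processes with mean zero are martingales\<close>

context levy
begin

text \<open>
  \<open>L T\<close> is the sum of the independent variables \<open>L (T - t)\<close> and \<open>L T - L (T - t)\<close>. By Fubini,
  \<open>x\<close> plus the second one is integrable for almost every value \<open>x\<close> of the first, and the second
  one is distributed like \<open>L t\<close>.
\<close>

lemma integrable_L:
  assumes int: "integrable P (L T)" and t: "0 \<le> t" "t \<le> T"
  shows "integrable P (L t)"
proof -
  let ?\<mu> = "distr P borel (L t)"
  interpret \<mu>: prob_space ?\<mu> using t by (rule prob_space_distr_L)
  have s: "0 \<le> T - t" "T - t \<le> T" using t by auto
  note [measurable] = L_measurable[OF t] L_measurable[OF s] L_measurable[OF less_imp_le[OF T_pos] order_refl]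
  have "(\<integral>\<^sup>+\<omega>. 1 * ennreal \<bar>L (T - t) \<omega> + (L T \<omega> - L (T - t) \<omega>)\<bar> \<partial>P) =
      (\<integral>\<^sup>+\<omega>. 1 * (\<integral>\<^sup>+y. ennreal \<bar>L (T - t) \<omega> + y\<bar> \<partial>distr P borel (L (T - (T - t)))) \<partial>P)"
    using s by (intro nn_integral_increment[where h = "\<lambda>x y. ennreal \<bar>x + y\<bar>"] L_measurable_F) auto
  hence "(\<integral>\<^sup>+\<omega>. (\<integral>\<^sup>+y. ennreal \<bar>L (T - t) \<omega> + y\<bar> \<partial>?\<mu>) \<partial>P) = (\<integral>\<^sup>+\<omega>. ennreal \<bar>L T \<omega>\<bar> \<partial>P)"
    by simp
  also have "\<dots> \<noteq> \<infinity>" using int by (simp add: integrable_iff_bounded)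
  finally have "AE \<omega> in P. (\<integral>\<^sup>+y. ennreal \<bar>L (T - t) \<omega> + y\<bar> \<partial>?\<mu>) \<noteq> \<infinity>"
    by (intro nn_integral_PInf_AE) auto
  hence "\<exists>x. (\<integral>\<^sup>+y. ennreal \<bar>x + y\<bar> \<partial>?\<mu>) \<noteq> \<infinity>"
    using AE_const[of False] by (rule_tac ccontr) auto
  then obtain x where x: "(\<integral>\<^sup>+y. ennreal \<bar>x + y\<bar> \<partial>?\<mu>) \<noteq> \<infinity>" ..
  have "(\<integral>\<^sup>+\<omega>. ennreal \<bar>L t \<omega>\<bar> \<partial>P) = (\<integral>\<^sup>+y. ennreal \<bar>y\<bar> \<partial>?\<mu>)"
    by (subst nn_integral_distr) auto
  also have "\<dots> \<le> (\<integral>\<^sup>+y. ennreal \<bar>x + y\<bar> + ennreal \<bar>x\<bar> \<partial>?\<mu>)"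
    by (intro nn_integral_mono) (simp add: ennreal_plus[symmetric] del: ennreal_plus)
  also have "\<dots> = (\<integral>\<^sup>+y. ennreal \<bar>x + y\<bar> \<partial>?\<mu>) + ennreal \<bar>x\<bar>"
    by (subst nn_integral_add) (auto simp: \<mu>.emeasure_space_1[simplified])
  also have "\<dots> < \<infinity>" using x by (simp add: less_top)
  finally show ?thesis by (simp add: integrable_iff_bounded)
qed

lemma integral_indicator_L_diff:
  assumes int: "integrable P (L T)" and st: "0 \<le> s" "s \<le> t" "t \<le> T" and A: "A \<in> sets (F s)"
  shows "(\<integral>\<omega>. indicator A \<omega> * (L t \<omega> - L s \<omega>) \<partial>P) = prob A * (\<integral>\<omega>. L (t - s) \<omega> \<partial>P)"
proof -
  have [measurable]: "A \<in> sets P" using A sets_F_P[of s] st by auto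
  have i: "integrable P (L t)" "integrable P (L s)" "integrable P (L (t - s))"
    using st by (auto intro!: integrable_L[OF int])
  have iA: "integrable P (\<lambda>\<omega>. indicator A \<omega> * (L t \<omega> - L s \<omega>))"
    using i by (intro integrable_mult_indicator[where 'b = real, simplified]) auto
  have e: "ennreal (indicator A \<omega> * x) = indicator A \<omega> * ennreal x" for \<omega> x
    by (simp add: indicator_def)
  have p: "(\<integral>\<^sup>+\<omega>. ennreal (indicator A \<omega> * (L t \<omega> - L s \<omega>)) \<partial>P) = emeasure P A * (\<integral>\<^sup>+\<omega>. ennreal (L (t - s) \<omega>) \<partial>P)"
    unfolding e by (rule nn_integral_L_diff[OF st A]) simp
  have n: "(\<integral>\<^sup>+\<omega>. ennreal (- (indicator A \<omega> * (L t \<omega> - L s \<omega>))) \<partial>P) = emeasure P A * (\<integral>\<^sup>+\<omega>. ennreal (- L (t - s) \<omega>) \<partial>P)"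
    unfolding mult_minus_right[symmetric] e
    by (rule nn_integral_L_diff[OF st A, where h = "\<lambda>x. ennreal (- x)"]) simp
  show ?thesis
    unfolding real_lebesgue_integral_def[OF iA] real_lebesgue_integral_def[OF i(3)] p n
    by (simp add: enn2real_mult emeasure_eq_measure right_diff_distrib)
qed

lemma mean_add:
  assumes "integrable P (L T)" "0 \<le> s" "0 \<le> t" "s + t \<le> T"
  shows "(\<integral>\<omega>. L (s + t) \<omega> \<partial>P) = (\<integral>\<omega>. L s \<omega> \<partial>P) + (\<integral>\<omega>. L t \<omega> \<partial>P)"
proof -
  have i: "integrable P (L (s + t))" "integrable P (L s)"
    using assms by (auto intro!: integrable_L)
  have "space P \<in> sets (F s)" using space_F[of s] sets.top[of "F s"] assms by simp
  from integral_indicator_L_diff[OF assms(1,2) _ assms(4) this]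
  have "(\<integral>\<omega>. indicator (space P) \<omega> * (L (s + t) \<omega> - L s \<omega>) \<partial>P) = (\<integral>\<omega>. L t \<omega> \<partial>P)"
    using assms by (simp add: prob_space)
  also have "(\<integral>\<omega>. indicator (space P) \<omega> * (L (s + t) \<omega> - L s \<omega>) \<partial>P) = (\<integral>\<omega>. L (s + t) \<omega> - L s \<omega> \<partial>P)"
    by (intro Bochner_Integration.integral_cong) auto
  finally show ?thesis using i by simp
qed

text \<open>
  The mean is additive in time and vanishes at \<open>T\<close>, hence on the grid. So the grid values form a
  martingale and the first absolute moments are bounded by that of \<open>L T\<close>; by Fatou this extends
  to all times. A bounded additive function that vanishes on the grid is 0.
\<close>

lemma mean_0:
  assumes int: "integrable P (L T)" and mean: "(\<integral>\<omega>. L T \<omega> \<partial>P) = 0" and t: "0 \<le> t" "t \<le> T"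
  shows "(\<integral>\<omega>. L t \<omega> \<partial>P) = 0"
proof -
  define m where "m t = (\<integral>\<omega>. L t \<omega> \<partial>P)" for t
  have add: "m (s + t) = m s + m t" if "0 \<le> s" "0 \<le> t" "s + t \<le> T" for s t
    unfolding m_def by (rule mean_add[OF int that])
  have m0: "m 0 = 0" using add[of 0 0] T_pos by simp
  have grid_mult: "m (tm k i) = real i * m (tm k 1)" if "i \<le> 2 ^ k" for k i
    using that
  proof (induction i)
    case (Suc i)
    have "m (tm k (i + 1)) = m (tm k i) + m (tm k 1)"
      unfolding grid_add using Suc.prems T_pos
      by (intro add) (simp_all add: grid_add[symmetric] grid_le_T)
    thus ?case using Suc by (simp add: algebra_simps)
  qed (simp add: m0)
  have grid_0: "m (tm k i) = 0" if "i \<le> 2 ^ k" for k i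
  proof -
    have "real (2 ^ k) * m (tm k 1) = 0"
      using grid_mult[of "2 ^ k" k] mean by (simp add: m_def)
    thus ?thesis using grid_mult[OF that] by simp
  qed
  define B where "B = (\<integral>\<omega>. \<bar>L T \<omega>\<bar> \<partial>P)"
  have T: "0 \<le> T" "T \<le> T" using T_pos by auto
  have Bn: "(\<integral>\<^sup>+\<omega>. ennreal \<bar>L T \<omega>\<bar> \<partial>P) = ennreal B"
    unfolding B_def using int by (intro nn_integral_eq_integral) auto
  have grid_bound: "(\<integral>\<^sup>+\<omega>. ennreal \<bar>L (tm k i) \<omega>\<bar> \<partial>P) \<le> ennreal B" if i: "i \<le> 2 ^ k" for k i
  proof -
    let ?t = "tm k i"
    have t: "0 \<le> ?t" "?t \<le> T" using tm_bounds[OF i] by auto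
    have Tt: "T - ?t = tm k (2 ^ k - i)" using grid_diff[OF i, of T k] by simp
    let ?\<mu> = "distr P borel (L (T - ?t))"
    note [measurable] = L_measurable[OF t] L_measurable[OF T]
    have Lm [measurable]: "L (T - ?t) \<in> borel_measurable P" using t by (intro L_measurable) auto
    interpret \<mu>: prob_space ?\<mu> using t by (intro prob_space_distr_L) auto
    have iy: "integrable ?\<mu> (\<lambda>y. y)" using t by (subst integrable_distr_eq) (auto intro!: integrable_L[OF int])
    have y0: "(\<integral>y. y \<partial>?\<mu>) = 0"
      using grid_0[of "2 ^ k - i" k] by (subst integral_distr) (auto simp: m_def Tt)
    have low: "ennreal \<bar>x\<bar> \<le> (\<integral>\<^sup>+y. ennreal \<bar>x + y\<bar> \<partial>?\<mu>)" for x
    proof -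
      have "x = (\<integral>y. x + y \<partial>?\<mu>)" using iy y0 by (simp add: \<mu>.prob_space[simplified])
      hence "\<bar>x\<bar> \<le> (\<integral>y. \<bar>x + y\<bar> \<partial>?\<mu>)" using integral_abs_bound[of ?\<mu> "\<lambda>y. x + y"] by simp
      hence "ennreal \<bar>x\<bar> \<le> ennreal (\<integral>y. \<bar>x + y\<bar> \<partial>?\<mu>)" by (rule ennreal_leI)
      also have "\<dots> = (\<integral>\<^sup>+y. ennreal \<bar>x + y\<bar> \<partial>?\<mu>)"
        using iy by (intro nn_integral_eq_integral[symmetric]) auto
      finally show ?thesis .
    qed
    have "(\<integral>\<^sup>+\<omega>. ennreal \<bar>L ?t \<omega>\<bar> \<partial>P) \<le> (\<integral>\<^sup>+\<omega>. 1 * (\<integral>\<^sup>+y. ennreal \<bar>L ?t \<omega> + y\<bar> \<partial>?\<mu>) \<partial>P)"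
      using low by (intro nn_integral_mono) simp
    also have "\<dots> = (\<integral>\<^sup>+\<omega>. 1 * ennreal \<bar>L ?t \<omega> + (L T \<omega> - L ?t \<omega>)\<bar> \<partial>P)"
      using t by (intro nn_integral_increment[where h = "\<lambda>x y. ennreal \<bar>x + y\<bar>", symmetric] L_measurable_F) auto
    finally show ?thesis by (simp add: Bn)
  qed
  have bound: "\<bar>m t\<bar> \<le> B" if t: "0 \<le> t" "t \<le> T" for t
  proof -
    let ?u = "\<lambda>k. tm k (grid_above T k t)"
    note up = grid_above_props[OF T_pos t]
    have [measurable]: "L (?u k) \<in> borel_measurable P" for k by (intro L_tm_measurable up)
    have "(\<integral>\<^sup>+\<omega>. ennreal \<bar>L t \<omega>\<bar> \<partial>P) = (\<integral>\<^sup>+\<omega>. liminf (\<lambda>k. ennreal \<bar>L (?u k) \<omega>\<bar>) \<partial>P)"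
    proof (rule nn_integral_cong)
      fix \<omega> assume w: "\<omega> \<in> space P"
      have "(\<lambda>k. L (?u k) \<omega>) \<longlonglongrightarrow> L t \<omega>"
        using up T_pos by (intro cadlag_on_right_limit[OF cadlag[OF w] t] grid_above_tendsto[OF T_pos t])
          (auto simp: grid_le_T)
      hence "(\<lambda>k. ennreal \<bar>L (?u k) \<omega>\<bar>) \<longlonglongrightarrow> ennreal \<bar>L t \<omega>\<bar>"
        by (intro tendsto_ennrealI tendsto_rabs)
      thus "ennreal \<bar>L t \<omega>\<bar> = liminf (\<lambda>k. ennreal \<bar>L (?u k) \<omega>\<bar>)"
        by (rule lim_imp_Liminf[OF sequentially_bot, symmetric])
    qed
    also have "\<dots> \<le> liminf (\<lambda>k. \<integral>\<^sup>+\<omega>. ennreal \<bar>L (?u k) \<omega>\<bar> \<partial>P)" by (rule nn_integral_liminf) measurable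
    also have "\<dots> \<le> liminf (\<lambda>k. ennreal B)"
      by (intro Liminf_mono always_eventually allI grid_bound up)
    also have "\<dots> = ennreal B" by (simp add: Liminf_const)
    also have "(\<integral>\<^sup>+\<omega>. ennreal \<bar>L t \<omega>\<bar> \<partial>P) = ennreal (\<integral>\<omega>. \<bar>L t \<omega>\<bar> \<partial>P)"
      using integrable_L[OF int t] by (intro nn_integral_eq_integral) auto
    finally have "(\<integral>\<omega>. \<bar>L t \<omega>\<bar> \<partial>P) \<le> B"
      by (subst (asm) ennreal_le_iff) (auto simp: B_def)
    thus ?thesis unfolding m_def by (rule order_trans[OF integral_abs_bound])
  qed
  have double: "m (2 ^ j * s) = 2 ^ j * m s" if "0 \<le> s" "2 ^ j * s \<le> T" for j s
    using that(2)
  proof (induction j)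
    case (Suc j)
    have "2 ^ j * s \<le> 2 ^ Suc j * s" using that(1) by (intro mult_right_mono) auto
    hence "m (2 ^ j * s) = 2 ^ j * m s" using Suc.prems by (intro Suc.IH) linarith
    moreover have "m (2 ^ j * s + 2 ^ j * s) = m (2 ^ j * s) + m (2 ^ j * s)"
      using Suc.prems that(1) by (intro add) (simp_all add: mult_ac)
    ultimately show ?case by (simp add: mult_ac)
  qed simp
  have "\<bar>m t\<bar> \<le> B / 2 ^ k" for k
  proof -
    define i where "i = nat \<lfloor>t * 2 ^ k / T\<rfloor>"
    have i: "real i \<le> t * 2 ^ k / T" "t * 2 ^ k / T < real i + 1"
      unfolding i_def using t T_pos by (auto simp: of_nat_nat)
    have s0: "tm k i \<le> t" using i(1) T_pos by (simp add: grid_def field_simps)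
    have "t * 2 ^ k < (real i + 1) * T" using i(2) T_pos by (simp add: pos_divide_less_eq)
    moreover have "2 ^ k * tm k i = T * real i" by (simp add: grid_def)
    ultimately have sk: "2 ^ k * (t - tm k i) \<le> T" by (simp add: right_diff_distrib algebra_simps)
    have "tm k i \<le> T" using s0 t by linarith
    hence ik: "i \<le> 2 ^ k" using T_pos by (simp add: grid_le_T)
    have "m t = m (tm k i) + m (t - tm k i)"
      using add[of "tm k i" "t - tm k i"] s0 t T_pos by simp
    hence "2 ^ k * m t = m (2 ^ k * (t - tm k i))"
      using double[of "t - tm k i" k] grid_0[OF ik] s0 sk by simp
    hence "2 ^ k * \<bar>m t\<bar> \<le> B"
      using bound[of "2 ^ k * (t - tm k i)"] s0 sk by (simp add: abs_mult[symmetric])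
    thus ?thesis by (simp add: field_simps)
  qed
  hence "\<bar>m t\<bar> \<le> 0"
    by (intro LIMSEQ_le_const[OF mesh_tendsto_0[of B]]) auto
  thus ?thesis by (simp add: m_def)
qed

lemma martingale_of_mean_0:
  assumes int: "integrable P (L T)" and mean: "(\<integral>\<omega>. L T \<omega> \<partial>P) = 0"
  shows "martingale_upto P F T L"
  unfolding martingale_upto_def
proof (intro conjI ballI filtered adapted)
  fix t assume "t \<in> {0..T}"
  thus "integrable P (L t)" using integrable_L[OF int] by simp
next
  fix s t assume "s \<in> {0..T}" "t \<in> {s..T}"
  hence st: "0 \<le> s" "s \<le> t" "t \<le> T" by auto
  hence s: "0 \<le> s" "s \<le> T" by auto
  interpret S: finite_measure_subalgebra P "F s"
    using subalgebra_F[OF s] by unfold_locales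
  have i: "integrable P (L t)" "integrable P (L s)" using st by (auto intro!: integrable_L[OF int])
  show "AE \<omega> in P. real_cond_exp P (F s) (L t) \<omega> = L s \<omega>"
  proof (rule S.real_cond_exp_charact[OF _ i L_measurable_F])
    fix A assume A: "A \<in> sets (F s)"
    hence [measurable]: "A \<in> sets P" using sets_F_P[OF s] by auto
    have iA: "integrable P (\<lambda>\<omega>. indicator A \<omega> * L t \<omega>)" "integrable P (\<lambda>\<omega>. indicator A \<omega> * L s \<omega>)"
      using i by (auto intro!: integrable_mult_indicator[where 'b = real, simplified])
    have "(\<integral>\<omega>. indicator A \<omega> * L t \<omega> \<partial>P) - (\<integral>\<omega>. indicator A \<omega> * L s \<omega> \<partial>P) =
        (\<integral>\<omega>. indicator A \<omega> * (L t \<omega> - L s \<omega>) \<partial>P)"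
      using iA by (simp add: right_diff_distrib)
    also have "\<dots> = 0"
      using integral_indicator_L_diff[OF int st A] mean_0[OF int mean, of "t - s"] st by simp
    finally show "(\<integral>\<omega>\<in>A. L t \<omega> \<partial>P) = (\<integral>\<omega>\<in>A. L s \<omega> \<partial>P)"
      by (simp add: set_lebesgue_integral_def)
  qed (use s in auto)
qed

section \<open>Levy processes that are not monotone\<close>

text \<open>
  If each increment over one step of a grid is negative with positive probability, then so are all
  of them at once, by independence, and then \<open>L T\<close> is negative.
\<close>

lemma AE_increments_nonneg:
  assumes "prob {\<omega> \<in> space P. L T \<omega> < 0} = 0"
  shows "AE \<omega> in P. \<forall>m. \<forall>k<2 ^ m. 0 \<le> incr m k \<omega>"
proof -
  have "AE \<omega> in P. \<forall>k\<in>{..<2 ^ m}. 0 \<le> incr m k \<omega>" for m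
  proof -
    let ?w = "\<lambda>x::real. indicator {..<0} x :: ennreal"
    have incm [measurable]: "incr m k \<in> borel_measurable P" if "k < 2 ^ m" for k
      unfolding incr_def using that by (intro borel_measurable_diff L_tm_measurable) auto
    define q where "q r = (\<integral>\<^sup>+\<omega>. (\<Prod>k<r. ?w (incr m k \<omega>)) \<partial>P)" for r
    have step: "q (Suc r) = q r * q 1" if "Suc r \<le> 2 ^ m" for r
    proof -
      have [measurable]: "(\<lambda>\<omega>. \<Prod>k<r. ?w (incr m k \<omega>)) \<in> borel_measurable (F (tm m r))"
        using that by (intro borel_measurable_prod_ennreal measurable_compose[OF incr_measurable_F]) auto
      have "q (Suc r) = (\<integral>\<^sup>+\<omega>. (\<Prod>k<r. ?w (incr m k \<omega>)) * 1 * (\<Prod>k\<in>{r..<r + 1}. ?w (incr m k \<omega>)) \<partial>P)"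
        by (simp add: q_def)
      also have "\<dots> = q r * q 1"
        unfolding q_def using that by (subst nn_integral_grid_steps[where h = "\<lambda>_. 1"]) simp_all
      finally show ?thesis .
    qed
    have pow: "q r = q 1 ^ r" if "r \<le> 2 ^ m" for r
      using that
    proof (induction r)
      case 0
      show ?case by (simp add: q_def emeasure_space_1)
    next
      case (Suc r)
      thus ?case using step[of r] by (simp add: mult.commute)
    qed
    have "q (2 ^ m) \<le> (\<integral>\<^sup>+\<omega>. indicator {\<omega> \<in> space P. L T \<omega> < 0} \<omega> \<partial>P)"
      unfolding q_def
    proof (rule nn_integral_mono)
      fix \<omega> assume w: "\<omega> \<in> space P"
      show "(\<Prod>k<2 ^ m. ?w (incr m k \<omega>)) \<le> indicator {\<omega> \<in> space P. L T \<omega> < 0} \<omega>"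
      proof (cases "\<forall>k<2 ^ m. incr m k \<omega> < 0")
        case True
        have "(\<Sum>k<2 ^ m. incr m k \<omega>) = L T \<omega> - L 0 \<omega>"
          unfolding incr_def by (subst sum_lessThan_telescope) simp
        moreover have "(\<Sum>k<2 ^ m. incr m k \<omega>) < (\<Sum>k<(2::nat) ^ m. 0)"
          using True by (intro sum_strict_mono) (auto simp: lessThan_empty_iff)
        ultimately have "L T \<omega> < 0" using L_0[OF w] by simp
        thus ?thesis using w True by (simp add: indicator_def)
      next
        case False
        hence "(\<Prod>k<2 ^ m. ?w (incr m k \<omega>)) = 0" by (auto simp: prod_zero_iff indicator_def)
        thus ?thesis by (simp only: zero_le)
      qed
    qed
    also have "\<dots> = 0"
      using assms L_measurable[of T] T_pos by (simp add: emeasure_eq_measure)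
    finally have q1: "q 1 = 0" using pow[of "2 ^ m"] by simp
    have "AE \<omega> in P. 0 \<le> incr m k \<omega>" if k: "k < 2 ^ m" for k
    proof -
      have "prob {\<omega> \<in> space P. incr m k \<omega> < 0} = prob {\<omega> \<in> space P. L (tm m (Suc k) - tm m k) \<omega> < 0}"
        unfolding incr_def using k T_pos by (intro prob_L_diff tm_bounds) auto
      also have "tm m (Suc k) - tm m k = tm m 1" by (subst grid_diff) simp_all
      also have "{\<omega> \<in> space P. L (tm m 1) \<omega> < 0} = {\<omega> \<in> space P. incr m 0 \<omega> < 0}"
        by (auto simp: incr_def L_0)
      also have "ennreal (prob \<dots>) = q 1"
      proof -
        have "q 1 = (\<integral>\<^sup>+\<omega>. indicator {\<omega> \<in> space P. incr m 0 \<omega> < 0} \<omega> \<partial>P)"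
          unfolding q_def by (intro nn_integral_cong) (auto simp: indicator_def)
        thus ?thesis using incm[of 0] by (simp add: emeasure_eq_measure)
      qed
      finally have "prob {\<omega> \<in> space P. incr m k \<omega> < 0} = 0" using q1 by simp
      thus ?thesis
        using incm[OF k] by (subst AE_iff_measurable[OF _ refl]) (auto simp: not_le emeasure_eq_measure)
    qed
    thus "AE \<omega> in P. \<forall>k\<in>{..<2 ^ m}. 0 \<le> incr m k \<omega>"
      by (subst AE_ball_countable) auto
  qed
  hence "AE \<omega> in P. \<forall>m. \<forall>k\<in>{..<2 ^ m}. 0 \<le> incr m k \<omega>" unfolding AE_all_countable by blast
  thus ?thesis by eventually_elim simp
qed

lemma subordinator_of_nonneg:
  assumes "prob {\<omega> \<in> space P. L T \<omega> < 0} = 0"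
  shows "subordinator P F T L"
  unfolding subordinator_def
proof (rule conjI[OF levy])
  show "AE \<omega> in P. mono_on {0..T} (\<lambda>t. L t \<omega>)"
    using AE_increments_nonneg[OF assms] AE_space
  proof eventually_elim
    case (elim \<omega>)
    hence w: "\<omega> \<in> space P" by simp
    have grid: "L (tm m i) \<omega> \<le> L (tm m j) \<omega>" if "i \<le> j" "j \<le> 2 ^ m" for m i j
      using that
    proof (induction j rule: dec_induct)
      case (step j)
      have "0 \<le> incr m j \<omega>" using elim step by auto
      thus ?case using step by (simp add: incr_def)
    qed simp
    show ?case
    proof (rule mono_onI)
      fix s t assume st: "s \<in> {0..T}" "t \<in> {0..T}" "s \<le> t"
      have lim: "(\<lambda>m. L (tm m (grid_above T m u)) \<omega>) \<longlonglongrightarrow> L u \<omega>" if "u \<in> {0..T}" for u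
      proof -
        have u: "0 \<le> u" "u \<le> T" using that by auto
        show ?thesis using grid_above_props[OF T_pos u] T_pos
          by (intro cadlag_on_right_limit[OF cadlag[OF w] u] grid_above_tendsto[OF T_pos u])
             (auto simp: grid_le_T)
      qed
      show "L s \<omega> \<le> L t \<omega>"
      proof (rule LIMSEQ_le[OF lim lim])
        show "\<exists>N. \<forall>m\<ge>N. L (tm m (grid_above T m s)) \<omega> \<le> L (tm m (grid_above T m t)) \<omega>"
          using st T_pos by (intro exI[of _ 0] allI impI grid grid_above_mono grid_above_props(3)) auto
      qed (use st in auto)
    qed
  qed
qed

end

lemma levy_process_uminus:
  assumes "0 < T" "levy_process P F T L"
  shows "levy_process P F T (\<lambda>t \<omega>. - L t \<omega>)"
proof -
  interpret levy P F T L using assms by unfold_locales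
  show ?thesis
    unfolding levy_process_def
  proof (intro conjI ballI filtered)
    show "adapted_process F T (\<lambda>t \<omega>. - L t \<omega>)"
      using adapted by (auto simp: adapted_process_def)
    fix \<omega> assume w: "\<omega> \<in> space P"
    show "- L 0 \<omega> = 0" using L_0[OF w] by simp
    have "\<exists>l'. ((\<lambda>t. - L t \<omega>) \<longlongrightarrow> l') G" if "\<exists>l. ((\<lambda>t. L t \<omega>) \<longlongrightarrow> l) G" for G
      using that tendsto_minus by blast
    thus "cadlag_on T (\<lambda>t. - L t \<omega>)"
      using cadlag[OF w] by (auto simp: cadlag_on_def intro: continuous_minus)
  next
    fix s t assume "s \<in> {0..T}" "t \<in> {s..T}"
    hence st: "0 \<le> s" "s \<le> t" "t \<le> T" by auto
    have [measurable]: "L s \<in> borel_measurable P" "L t \<in> borel_measurable P"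
      "L (t - s) \<in> borel_measurable P" "L 0 \<in> borel_measurable P"
      using st by (auto intro!: L_measurable)
    have neg: "distr (distr P borel X) borel uminus = distr P borel (\<lambda>\<omega>. - X \<omega>)"
      if [measurable]: "X \<in> borel_measurable P" for X :: "'a \<Rightarrow> real"
      by (subst distr_distr) (simp_all add: comp_def)
    have "distr P borel (\<lambda>\<omega>. - (L t \<omega> - L s \<omega>)) = distr (distr P borel (\<lambda>\<omega>. L t \<omega> - L s \<omega>)) borel uminus"
      by (rule neg[symmetric]) measurable
    also have "distr P borel (\<lambda>\<omega>. L t \<omega> - L s \<omega>) = distr P borel (\<lambda>\<omega>. L (t - s) \<omega> - L 0 \<omega>)"
      by (rule stationary[rule_format]) (use st in auto)
    also have "distr \<dots> borel uminus = distr P borel (\<lambda>\<omega>. - (L (t - s) \<omega> - L 0 \<omega>))"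
      by (rule neg) measurable
    finally show "distr P borel (\<lambda>\<omega>. - L t \<omega> - - L s \<omega>) = distr P borel (\<lambda>\<omega>. - L (t - s) \<omega> - - L 0 \<omega>)"
      by (simp only: minus_diff_minus)
    have ind: "indep_set (sets (F s)) {(\<lambda>\<omega>. L t \<omega> - L s \<omega>) -` B \<inter> space P | B. B \<in> sets borel}"
      by (rule independent[rule_format]) (use st in auto)
    have vim: "(\<lambda>\<omega>. - L t \<omega> - - L s \<omega>) -` B = (\<lambda>\<omega>. L t \<omega> - L s \<omega>) -` (uminus -` B)" for B :: "real set"
      by auto
    have uB: "uminus -` B \<in> sets borel" if "B \<in> sets borel" for B :: "real set"
      using measurable_sets[of uminus borel borel B] that by simp
    show "indep_set (sets (F s)) {(\<lambda>\<omega>. - L t \<omega> - - L s \<omega>) -` B \<inter> space P | B. B \<in> sets borel}"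
    proof (rule indep_setI)
      show "sets (F s) \<subseteq> events" using sets_F_P[of s] st by simp
      show "{(\<lambda>\<omega>. - L t \<omega> - - L s \<omega>) -` B \<inter> space P | B. B \<in> sets borel} \<subseteq> events"
        by (auto intro!: measurable_sets[of _ P borel])
      fix a b assume a: "a \<in> sets (F s)"
        and b: "b \<in> {(\<lambda>\<omega>. - L t \<omega> - - L s \<omega>) -` B \<inter> space P | B. B \<in> sets borel}"
      then obtain B :: "real set" where B: "B \<in> sets borel"
        and "b = (\<lambda>\<omega>. L t \<omega> - L s \<omega>) -` (uminus -` B) \<inter> space P"
        unfolding vim by blast
      hence "b \<in> {(\<lambda>\<omega>. L t \<omega> - L s \<omega>) -` B \<inter> space P | B. B \<in> sets borel}"
        using uB[OF B] by blast
      with ind a show "prob (a \<inter> b) = prob a * prob b" by (rule indep_setD)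
    qed
  qed
qed

lemma nonmonotone_both_signs:
  assumes "0 < T" "levy_process P F T L"
    and "\<not> subordinator P F T L" "\<not> subordinator P F T (\<lambda>t \<omega>. - L t \<omega>)"
  shows "measure P {\<omega> \<in> space P. 0 < L T \<omega>} \<noteq> 0" "measure P {\<omega> \<in> space P. L T \<omega> < 0} \<noteq> 0"
proof -
  interpret levy P F T L using assms by unfold_locales
  interpret neg: levy P F T "\<lambda>t \<omega>. - L t \<omega>"
    using assms levy_process_uminus by unfold_locales
  show "measure P {\<omega> \<in> space P. 0 < L T \<omega>} \<noteq> 0"
    using neg.subordinator_of_nonneg assms(4) by auto
  show "measure P {\<omega> \<in> space P. L T \<omega> < 0} \<noteq> 0"
    using subordinator_of_nonneg assms(3) by auto
qed

section \<open>Passing from grid times to all times\<close>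

context levy
begin

text \<open>
  Every time is a limit of grid times from above, and then the lengths of the grid intervals converge
  as well. So the identity for grid intervals passes to the limit for continuous
  integrands, because at a fixed time the paths are almost surely continuous. Open half-lines are
  approximated by continuous functions and generate the Borel sets.
\<close>

lemma levy_process_of_grid:
  assumes prQ: "prob_space Q" and sQ: "sets Q = sets (F T)"
    and ac: "absolutely_continuous (restr_to_subalg P (F T)) Q"
    and grid: "\<And>k i r A h. i + r \<le> 2 ^ k \<Longrightarrow> A \<in> sets (F (tm k i)) \<Longrightarrow> h \<in> borel_measurable borel \<Longrightarrow>
      (\<integral>\<^sup>+\<omega>. indicator A \<omega> * h (L (tm k (i + r)) \<omega> - L (tm k i) \<omega>) \<partial>Q) =
      emeasure Q A * (\<integral>\<^sup>+\<omega>. h (L (tm k r) \<omega>) \<partial>Q)"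
  shows "levy_process Q F T L"
proof -
  interpret Q: prob_space Q by (rule prQ)
  have T: "0 \<le> T" "T \<le> T" using T_pos by auto
  have spQ: "space Q = space P" using sets_eq_imp_space_eq[OF sQ] space_F[OF T] by simp
  have F_Q: "sets (F t) \<subseteq> sets Q" if "0 \<le> t" "t \<le> T" for t
    using sets_F_mono[OF that(1,2)] by (simp add: sQ)
  have LQ: "L t \<in> borel_measurable Q" if "0 \<le> t" "t \<le> T" for t
    using L_measurable_F[OF that T(2)] by (simp cong: measurable_cong_sets add: sQ)
  have cont: "AE \<omega> in Q. \<forall>v. (\<forall>m. 0 \<le> v m \<and> v m \<le> T) \<longrightarrow> v \<longlonglongrightarrow> u \<longrightarrow>
      (\<lambda>m. L (v m) \<omega>) \<longlonglongrightarrow> L u \<omega>" if "0 \<le> u" "u \<le> T" for u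
    by (rule absolutely_continuous_AE[OF _ ac AE_continuous[OF that]])
       (simp add: sQ sets_restr_to_subalg[OF subalgebra_F[OF T]])
  have key1: "(\<integral>\<^sup>+\<omega>. indicator A \<omega> * ennreal (h (L t \<omega> - L s \<omega>)) \<partial>Q) =
      emeasure Q A * (\<integral>\<^sup>+\<omega>. ennreal (h (L (t - s) \<omega>)) \<partial>Q)"
    if st: "0 \<le> s" "s \<le> t" "t \<le> T" and A: "A \<in> sets (F s)"
      and h: "\<And>x. isCont h x" "\<And>x. h x \<le> 1" for s t A and h :: "real \<Rightarrow> real"
  proof -
    have s: "0 \<le> s" "s \<le> T" and t: "0 \<le> t" "t \<le> T" and ts: "0 \<le> t - s" "t - s \<le> T"
      using st by auto
    have AQ [measurable]: "A \<in> sets Q" using A F_Q[OF s] by auto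
    have [measurable]: "h \<in> borel_measurable borel"
      using h(1) by (intro borel_measurable_continuous_onI continuous_at_imp_continuous_on) auto
    note [measurable] = LQ[OF s] LQ[OF t] LQ[OF ts]
    define i where "i m = grid_above T m s" for m
    define r where "r m = grid_above T m t - i m" for m
    note us = grid_above_props[OF T_pos s] and ut = grid_above_props[OF T_pos t]
    have ir: "i m + r m = grid_above T m t" for m
      unfolding i_def r_def using grid_above_mono[OF T_pos st(2), of m] by simp
    have le: "i m + r m \<le> 2 ^ m" for m unfolding ir by (rule ut(3))
    have Lm [measurable]: "L (tm m (i m)) \<in> borel_measurable Q" "L (tm m (i m + r m)) \<in> borel_measurable Q"
      "L (tm m (r m)) \<in> borel_measurable Q" for m
      using le[of m] by (auto intro!: LQ tm_bounds)
    have ls: "(\<lambda>m. tm m (i m)) \<longlonglongrightarrow> s" unfolding i_def by (rule grid_above_tendsto[OF T_pos s])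
    have lt: "(\<lambda>m. tm m (i m + r m)) \<longlonglongrightarrow> t" unfolding ir by (rule grid_above_tendsto[OF T_pos t])
    have lr: "(\<lambda>m. tm m (r m)) \<longlonglongrightarrow> t - s" using tendsto_diff[OF lt ls] by (simp add: grid_add)
    have b: "0 \<le> tm m (i m)" "tm m (i m) \<le> T" "0 \<le> tm m (i m + r m)" "tm m (i m + r m) \<le> T"
      "0 \<le> tm m (r m)" "tm m (r m) \<le> T" for m
      using le[of m] T_pos by (simp_all add: grid_le_T)
    have "(\<lambda>m. \<integral>\<^sup>+\<omega>. indicator A \<omega> * ennreal (h (L (tm m (i m + r m)) \<omega> - L (tm m (i m)) \<omega>)) \<partial>Q) \<longlonglongrightarrow>
        (\<integral>\<^sup>+\<omega>. indicator A \<omega> * ennreal (h (L t \<omega> - L s \<omega>)) \<partial>Q)"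
    proof (rule nn_integral_dominated_convergence[where w = "\<lambda>_. 1"])
      show "AE \<omega> in Q. (\<lambda>m. indicator A \<omega> * ennreal (h (L (tm m (i m + r m)) \<omega> - L (tm m (i m)) \<omega>))) \<longlonglongrightarrow>
        indicator A \<omega> * ennreal (h (L t \<omega> - L s \<omega>))"
        using cont[OF s] cont[OF t]
      proof eventually_elim
        case (elim \<omega>)
        have "(\<lambda>m. L (tm m (i m + r m)) \<omega>) \<longlonglongrightarrow> L t \<omega>"
          by (rule elim(2)[rule_format]) (use b lt in auto)
        moreover have "(\<lambda>m. L (tm m (i m)) \<omega>) \<longlonglongrightarrow> L s \<omega>"
          by (rule elim(1)[rule_format]) (use b ls in auto)
        ultimately show ?case
          by (intro ennreal_tendsto_cmult tendsto_ennrealI isCont_tendsto_compose[OF h(1)] tendsto_diff)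
             (simp add: indicator_def)
      qed
      show "AE \<omega> in Q. indicator A \<omega> * ennreal (h (L (tm m (i m + r m)) \<omega> - L (tm m (i m)) \<omega>)) \<le> 1" for m
        using h(2) by (intro AE_I2) (auto simp: indicator_def)
    qed (simp_all add: Q.emeasure_space_1)
    moreover have "(\<integral>\<^sup>+\<omega>. indicator A \<omega> * ennreal (h (L (tm m (i m + r m)) \<omega> - L (tm m (i m)) \<omega>)) \<partial>Q) =
        emeasure Q A * (\<integral>\<^sup>+\<omega>. ennreal (h (L (tm m (r m)) \<omega>)) \<partial>Q)" for m
    proof (rule grid[OF le])
      show "A \<in> sets (F (tm m (i m)))"
        using A sets_F_mono[of s "tm m (i m)"] us(1)[of m] b(2)[of m] s by (auto simp: i_def)
    qed measurable
    moreover have "(\<lambda>m. emeasure Q A * (\<integral>\<^sup>+\<omega>. ennreal (h (L (tm m (r m)) \<omega>)) \<partial>Q)) \<longlonglongrightarrow>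
        emeasure Q A * (\<integral>\<^sup>+\<omega>. ennreal (h (L (t - s) \<omega>)) \<partial>Q)"
    proof (rule ennreal_tendsto_cmult)
      show "(\<lambda>m. \<integral>\<^sup>+\<omega>. ennreal (h (L (tm m (r m)) \<omega>)) \<partial>Q) \<longlonglongrightarrow> (\<integral>\<^sup>+\<omega>. ennreal (h (L (t - s) \<omega>)) \<partial>Q)"
      proof (rule nn_integral_dominated_convergence[where w = "\<lambda>_. 1"])
        show "AE \<omega> in Q. (\<lambda>m. ennreal (h (L (tm m (r m)) \<omega>))) \<longlonglongrightarrow> ennreal (h (L (t - s) \<omega>))"
          using cont[OF ts]
        proof eventually_elim
          case (elim \<omega>)
          have "(\<lambda>m. L (tm m (r m)) \<omega>) \<longlonglongrightarrow> L (t - s) \<omega>" by (rule elim[rule_format]) (use b lr in auto)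
          thus ?case by (intro tendsto_ennrealI isCont_tendsto_compose[OF h(1)])
        qed
        show "AE \<omega> in Q. ennreal (h (L (tm m (r m)) \<omega>)) \<le> 1" for m
          using h(2) by (intro AE_I2) auto
      qed (simp_all add: Q.emeasure_space_1)
    qed (simp add: Q.emeasure_eq_measure)
    ultimately show ?thesis using LIMSEQ_unique by simp
  qed
  have key2: "(\<integral>\<^sup>+\<omega>. indicator A \<omega> * indicator {x<..} (L t \<omega> - L s \<omega>) \<partial>Q) =
      emeasure Q A * (\<integral>\<^sup>+\<omega>. indicator {x<..} (L (t - s) \<omega>) \<partial>Q)"
    if st: "0 \<le> s" "s \<le> t" "t \<le> T" and A: "A \<in> sets (F s)" for s t A and x :: real
  proof -
    have s: "0 \<le> s" "s \<le> T" and t: "0 \<le> t" "t \<le> T" and ts: "0 \<le> t - s" "t - s \<le> T"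
      using st by auto
    have AQ [measurable]: "A \<in> sets Q" using A F_Q[OF s] by auto
    note [measurable] = LQ[OF s] LQ[OF t] LQ[OF ts]
    define h where "h j y = min 1 (real j * max 0 (y - x))" for j :: nat and y
    have h1: "h j y \<le> 1" for j y by (simp add: h_def)
    have hc: "isCont (h j) y" for j y unfolding h_def by (intro continuous_intros)
    have [measurable]: "h j \<in> borel_measurable borel" for j unfolding h_def by measurable
    have hl: "(\<lambda>j. ennreal (h j y)) \<longlonglongrightarrow> indicator {x<..} y" for y
    proof (cases "x < y")
      case True
      obtain N :: nat where N: "1 < real N * (y - x)" using reals_Archimedean3[of "y - x"] True by auto
      have "\<forall>\<^sub>F j in sequentially. ennreal (h j y) = 1"
        unfolding eventually_sequentially
      proof (intro exI[of _ N] allI impI)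
        fix j assume "N \<le> j"
        hence "real N * (y - x) \<le> real j * (y - x)" using True by (intro mult_right_mono) auto
        hence "1 \<le> real j * (y - x)" using N by linarith
        thus "ennreal (h j y) = 1" using True by (simp add: h_def min_def)
      qed
      thus ?thesis using True by (simp add: tendsto_eventually)
    qed (simp add: h_def max_def)
    have "(\<lambda>j. \<integral>\<^sup>+\<omega>. indicator A \<omega> * ennreal (h j (L t \<omega> - L s \<omega>)) \<partial>Q) \<longlonglongrightarrow>
        (\<integral>\<^sup>+\<omega>. indicator A \<omega> * indicator {x<..} (L t \<omega> - L s \<omega>) \<partial>Q)"
    proof (rule nn_integral_dominated_convergence[where w = "\<lambda>_. 1"])
      show "AE \<omega> in Q. (\<lambda>j. indicator A \<omega> * ennreal (h j (L t \<omega> - L s \<omega>))) \<longlonglongrightarrow>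
          indicator A \<omega> * indicator {x<..} (L t \<omega> - L s \<omega>)"
        by (intro AE_I2 ennreal_tendsto_cmult hl) (simp add: indicator_def)
      show "AE \<omega> in Q. indicator A \<omega> * ennreal (h j (L t \<omega> - L s \<omega>)) \<le> 1" for j
        using h1 by (intro AE_I2) (auto simp: indicator_def)
    qed (simp_all add: Q.emeasure_space_1)
    moreover have "(\<lambda>j. emeasure Q A * (\<integral>\<^sup>+\<omega>. ennreal (h j (L (t - s) \<omega>)) \<partial>Q)) \<longlonglongrightarrow>
        emeasure Q A * (\<integral>\<^sup>+\<omega>. indicator {x<..} (L (t - s) \<omega>) \<partial>Q)"
    proof (rule ennreal_tendsto_cmult)
      show "(\<lambda>j. \<integral>\<^sup>+\<omega>. ennreal (h j (L (t - s) \<omega>)) \<partial>Q) \<longlonglongrightarrow> (\<integral>\<^sup>+\<omega>. indicator {x<..} (L (t - s) \<omega>) \<partial>Q)"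
      proof (rule nn_integral_dominated_convergence[where w = "\<lambda>_. 1"])
        show "AE \<omega> in Q. (\<lambda>j. ennreal (h j (L (t - s) \<omega>))) \<longlonglongrightarrow> indicator {x<..} (L (t - s) \<omega>)"
          by (intro AE_I2 hl)
        show "AE \<omega> in Q. ennreal (h j (L (t - s) \<omega>)) \<le> 1" for j
          using h1 by (intro AE_I2) auto
      qed (simp_all add: Q.emeasure_space_1)
    qed (simp add: Q.emeasure_eq_measure)
    ultimately show ?thesis
      unfolding key1[OF st A hc h1] by (rule LIMSEQ_unique)
  qed
  have key3: "(\<integral>\<^sup>+\<omega>. indicator A \<omega> * indicator B (L t \<omega> - L s \<omega>) \<partial>Q) =
      emeasure Q A * (\<integral>\<^sup>+\<omega>. indicator B (L (t - s) \<omega>) \<partial>Q)"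
    if st: "0 \<le> s" "s \<le> t" "t \<le> T" and A: "A \<in> sets (F s)" and B: "B \<in> sets borel" for s t A B
  proof -
    have s: "0 \<le> s" "s \<le> T" and t: "0 \<le> t" "t \<le> T" and ts: "0 \<le> t - s" "t - s \<le> T"
      using st by auto
    have AQ [measurable]: "A \<in> sets Q" using A F_Q[OF s] by auto
    note [measurable] = LQ[OF s] LQ[OF t] LQ[OF ts]
    let ?M = "distr (density Q (indicator A)) borel (\<lambda>\<omega>. L t \<omega> - L s \<omega>)"
    let ?N = "scale_measure (emeasure Q A) (distr Q borel (L (t - s)))"
    have M: "emeasure ?M C = (\<integral>\<^sup>+\<omega>. indicator A \<omega> * indicator C (L t \<omega> - L s \<omega>) \<partial>Q)"
      if [measurable]: "C \<in> sets borel" for C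
    proof -
      have "emeasure ?M C = (\<integral>\<^sup>+y. indicator C y \<partial>?M)" by simp
      also have "\<dots> = (\<integral>\<^sup>+\<omega>. indicator C (L t \<omega> - L s \<omega>) \<partial>density Q (indicator A))"
        by (rule nn_integral_distr) measurable
      also have "\<dots> = (\<integral>\<^sup>+\<omega>. indicator A \<omega> * indicator C (L t \<omega> - L s \<omega>) \<partial>Q)"
        by (rule nn_integral_density) measurable
      finally show ?thesis .
    qed
    have N: "emeasure ?N C = emeasure Q A * (\<integral>\<^sup>+\<omega>. indicator C (L (t - s) \<omega>) \<partial>Q)"
      if [measurable]: "C \<in> sets borel" for C
    proof -
      have "emeasure (distr Q borel (L (t - s))) C = (\<integral>\<^sup>+y. indicator C y \<partial>distr Q borel (L (t - s)))" by simp
      also have "\<dots> = (\<integral>\<^sup>+\<omega>. indicator C (L (t - s) \<omega>) \<partial>Q)" by (rule nn_integral_distr) measurable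
      finally show ?thesis by simp
    qed
    have "?M = ?N"
    proof (rule measure_eqI_lessThan)
      fix x :: real
      show "emeasure ?M {x<..} = emeasure ?N {x<..}"
        by (subst M, simp, subst N, simp, rule key2[OF st A])
      have "emeasure ?M {x<..} = (\<integral>\<^sup>+\<omega>. indicator A \<omega> * indicator {x<..} (L t \<omega> - L s \<omega>) \<partial>Q)"
        by (rule M) simp
      also have "\<dots> \<le> (\<integral>\<^sup>+\<omega>. 1 \<partial>Q)"
        by (intro nn_integral_mono) (simp split: split_indicator)
      also have "\<dots> < \<infinity>" by (simp add: Q.emeasure_space_1)
      finally show "emeasure ?M {x<..} < \<infinity>" .
    qed simp_all
    thus ?thesis using M[OF B] N[OF B] by simp
  qed
  have law: "emeasure Q (A \<inter> ((\<lambda>\<omega>. L t \<omega> - L s \<omega>) -` B \<inter> space P)) =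
      emeasure Q A * emeasure Q (L (t - s) -` B \<inter> space P)"
    if st: "0 \<le> s" "s \<le> t" "t \<le> T" and A: "A \<in> sets (F s)" and B: "B \<in> sets borel" for s t A B
  proof -
    have s: "0 \<le> s" "s \<le> T" and t: "0 \<le> t" "t \<le> T" and ts: "0 \<le> t - s" "t - s \<le> T"
      using st by auto
    have AQ: "A \<in> sets Q" using A F_Q[OF s] by auto
    note [measurable] = LQ[OF s] LQ[OF t] LQ[OF ts]
    have D: "(\<lambda>\<omega>. L t \<omega> - L s \<omega>) -` B \<inter> space P \<in> sets Q"
      unfolding spQ[symmetric] by (rule measurable_sets[OF _ B]) measurable
    have E: "L (t - s) -` B \<inter> space P \<in> sets Q"
      unfolding spQ[symmetric] by (rule measurable_sets[OF LQ[OF ts] B])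
    have "emeasure Q (A \<inter> ((\<lambda>\<omega>. L t \<omega> - L s \<omega>) -` B \<inter> space P)) =
        (\<integral>\<^sup>+\<omega>. indicator (A \<inter> ((\<lambda>\<omega>. L t \<omega> - L s \<omega>) -` B \<inter> space P)) \<omega> \<partial>Q)"
      using AQ D by simp
    also have "\<dots> = (\<integral>\<^sup>+\<omega>. indicator A \<omega> * indicator B (L t \<omega> - L s \<omega>) \<partial>Q)"
      by (intro nn_integral_cong) (auto simp: indicator_def spQ)
    also have "\<dots> = emeasure Q A * (\<integral>\<^sup>+\<omega>. indicator B (L (t - s) \<omega>) \<partial>Q)" by (rule key3[OF st A B])
    also have "(\<integral>\<^sup>+\<omega>. indicator B (L (t - s) \<omega>) \<partial>Q) = (\<integral>\<^sup>+\<omega>. indicator (L (t - s) -` B \<inter> space P) \<omega> \<partial>Q)"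
      by (intro nn_integral_cong) (auto simp: indicator_def spQ)
    also have "\<dots> = emeasure Q (L (t - s) -` B \<inter> space P)" using E by simp
    finally show ?thesis .
  qed
  have law_full: "emeasure Q ((\<lambda>\<omega>. L t \<omega> - L s \<omega>) -` B \<inter> space P) = emeasure Q (L (t - s) -` B \<inter> space P)"
    if st: "0 \<le> s" "s \<le> t" "t \<le> T" and B: "B \<in> sets borel" for s t B
  proof -
    have "space P \<in> sets (F s)" using space_F[of s] sets.top[of "F s"] st by simp
    moreover have "space P \<inter> (X \<inter> space P) = X \<inter> space P" for X by auto
    ultimately show ?thesis using law[OF st _ B, of "space P"] Q.emeasure_space_1 by (simp add: spQ)
  qed
  show ?thesis
    unfolding levy_process_def
  proof (intro conjI ballI)
    show "filtered_prob_space Q F T"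
      unfolding filtered_prob_space_def subalgebra_def
      using prQ F_Q space_F spQ sets_F_mono by auto
    show "adapted_process F T L" by (rule adapted)
    fix \<omega> assume "\<omega> \<in> space Q"
    thus "L 0 \<omega> = 0" "cadlag_on T (\<lambda>t. L t \<omega>)" using L_0 cadlag by (auto simp: spQ)
  next
    fix s t assume "s \<in> {0..T}" "t \<in> {s..T}"
    hence st: "0 \<le> s" "s \<le> t" "t \<le> T" by auto
    hence s: "0 \<le> s" "s \<le> T" and t: "0 \<le> t" "t \<le> T" and ts: "0 \<le> t - s" "t - s \<le> T" by auto
    note [measurable] = LQ[OF s] LQ[OF t] LQ[OF ts]
    have "distr Q borel (\<lambda>\<omega>. L t \<omega> - L s \<omega>) = distr Q borel (L (t - s))"
    proof (rule measure_eqI)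
      fix B assume "B \<in> sets (distr Q borel (\<lambda>\<omega>. L t \<omega> - L s \<omega>))"
      hence B: "B \<in> sets borel" by simp
      thus "emeasure (distr Q borel (\<lambda>\<omega>. L t \<omega> - L s \<omega>)) B = emeasure (distr Q borel (L (t - s))) B"
        using law_full[OF st B] by (simp add: emeasure_distr spQ)
    qed simp
    also have "\<dots> = distr Q borel (\<lambda>\<omega>. L (t - s) \<omega> - L 0 \<omega>)"
      by (intro distr_cong) (simp_all add: L_0 spQ)
    finally show "distr Q borel (\<lambda>\<omega>. L t \<omega> - L s \<omega>) = distr Q borel (\<lambda>\<omega>. L (t - s) \<omega> - L 0 \<omega>)" .
    show "Q.indep_set (sets (F s)) {(\<lambda>\<omega>. L t \<omega> - L s \<omega>) -` B \<inter> space Q | B. B \<in> sets borel}"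
    proof (rule Q.indep_setI)
      show "sets (F s) \<subseteq> sets Q" by (rule F_Q[OF s])
      show "{(\<lambda>\<omega>. L t \<omega> - L s \<omega>) -` B \<inter> space Q | B. B \<in> sets borel} \<subseteq> sets Q"
        by (auto intro!: measurable_sets[of _ Q borel])
      fix a b assume a: "a \<in> sets (F s)"
        and "b \<in> {(\<lambda>\<omega>. L t \<omega> - L s \<omega>) -` B \<inter> space Q | B. B \<in> sets borel}"
      then obtain B where B: "B \<in> sets borel" and b: "b = (\<lambda>\<omega>. L t \<omega> - L s \<omega>) -` B \<inter> space P"
        unfolding spQ by blast
      have "emeasure Q (a \<inter> b) = emeasure Q a * emeasure Q b"
        unfolding b using law[OF st a B] law_full[OF st B] by simp
      thus "Q.prob (a \<inter> b) = Q.prob a * Q.prob b"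
        by (simp add: Q.emeasure_eq_measure ennreal_mult[symmetric])
    qed
  qed
qed

section \<open>Exponential tilting of the damped process\<close>

text \<open>
  The Esscher transform with parameter \<open>\<theta>\<close> of the process with damped large jumps.
\<close>

abbreviation tilt :: "nat \<Rightarrow> real \<Rightarrow> 'a \<Rightarrow> real" where
  "tilt n \<theta> \<omega> \<equiv> exp (\<theta> * L T \<omega>) * damp n 0 T \<omega>"

definition tilt_mass :: "nat \<Rightarrow> real \<Rightarrow> real" where
  "tilt_mass n \<theta> = (\<integral>\<omega>. tilt n \<theta> \<omega> \<partial>P)"

definition tilted :: "nat \<Rightarrow> real \<Rightarrow> 'a measure" where
  "tilted n \<theta> = density (restr_to_subalg P (F T))
     (\<lambda>\<omega>. ennreal (tilt n \<theta> \<omega> / tilt_mass n \<theta>))"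

lemma horizon: "0 \<le> T" "T \<le> T"
  using T_pos by auto

lemma damp_T_measurable_F [measurable]: "damp n 0 T \<in> borel_measurable (F T)"
  using damp_measurable_F[of 0 1 0 n] by (simp add: grid_def)

lemma damp_T_measurable [measurable]: "damp n 0 T \<in> borel_measurable P"
  by (rule measurable_F_P[OF damp_T_measurable_F horizon])

lemma L_T_measurable_F [measurable]: "L T \<in> borel_measurable (F T)"
  using T_pos by (intro L_measurable_F) auto

lemma L_T_measurable [measurable]: "L T \<in> borel_measurable P"
  using T_pos by (intro L_measurable) auto

lemma integrable_exp_damp: "integrable P (\<lambda>\<omega>. tilt n \<theta> \<omega>)"
proof (rule integrableI_bounded)
  have "norm (tilt n \<theta> \<omega>) \<le> exp (\<bar>\<theta>\<bar> * \<bar>L T \<omega>\<bar>) * damp n 0 T \<omega>" for \<omega>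
  proof -
    have "\<theta> * L T \<omega> \<le> \<bar>\<theta>\<bar> * \<bar>L T \<omega>\<bar>" using abs_ge_self[of "\<theta> * L T \<omega>"] by (simp add: abs_mult)
    thus ?thesis using damp_pos[of n 0 T \<omega>] by (simp add: abs_mult)
  qed
  hence "(\<integral>\<^sup>+\<omega>. ennreal (norm (tilt n \<theta> \<omega>)) \<partial>P) \<le>
      (\<integral>\<^sup>+\<omega>. ennreal (exp (\<bar>\<theta>\<bar> * \<bar>L T \<omega>\<bar>)) * ennreal (damp n 0 T \<omega>) \<partial>P)"
    using damp_pos[of n 0 T]
    by (intro nn_integral_mono) (auto simp: ennreal_mult[symmetric] less_imp_le intro!: ennreal_leI)
  also have "\<dots> < \<infinity>" by (rule damped_exp_moment_finite)
  finally show "(\<integral>\<^sup>+\<omega>. ennreal (norm (tilt n \<theta> \<omega>)) \<partial>P) < \<infinity>" .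
qed simp

lemma tilt_mass_pos: "0 < tilt_mass n \<theta>"
proof -
  have "0 \<le> tilt_mass n \<theta>"
    unfolding tilt_mass_def using damp_pos[of n 0 T] by (intro integral_nonneg_AE AE_I2) (simp add: less_imp_le)
  moreover have "tilt_mass n \<theta> \<noteq> 0"
  proof
    assume "tilt_mass n \<theta> = 0"
    hence "AE \<omega> in P. tilt n \<theta> \<omega> = 0"
      unfolding tilt_mass_def using damp_pos[of n 0 T]
      by (subst (asm) integral_nonneg_eq_0_iff_AE[OF integrable_exp_damp]) (auto simp: less_imp_le)
    hence "AE \<omega> in P. False"
      by eventually_elim (use damp_pos[of n 0 T] in \<open>auto simp: less_le\<close>)
    thus False by simp
  qed
  ultimately show ?thesis by simp
qed

lemma nn_integral_tilted:
  assumes [measurable]: "f \<in> borel_measurable (F T)"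
  shows "(\<integral>\<^sup>+\<omega>. f \<omega> \<partial>tilted n \<theta>) =
    (\<integral>\<^sup>+\<omega>. f \<omega> * ennreal (tilt n \<theta> \<omega>) \<partial>P) * ennreal (1 / tilt_mass n \<theta>)"
proof -
  have sub: "subalgebra P (F T)" by (rule subalgebra_F[OF horizon])
  have fP [measurable]: "f \<in> borel_measurable P" by (rule measurable_F_P[OF assms horizon])
  let ?Z = "\<lambda>\<omega>. ennreal (tilt n \<theta> \<omega> / tilt_mass n \<theta>)"
  have "(\<integral>\<^sup>+\<omega>. f \<omega> \<partial>tilted n \<theta>) = (\<integral>\<^sup>+\<omega>. ?Z \<omega> * f \<omega> \<partial>restr_to_subalg P (F T))"
    unfolding tilted_def by (rule nn_integral_density) (auto intro!: measurable_in_subalg[OF sub])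
  also have "\<dots> = (\<integral>\<^sup>+\<omega>. ?Z \<omega> * f \<omega> \<partial>P)"
    by (rule nn_integral_subalgebra2[OF sub]) measurable
  also have "\<dots> = (\<integral>\<^sup>+\<omega>. f \<omega> * ennreal (tilt n \<theta> \<omega>) * ennreal (1 / tilt_mass n \<theta>) \<partial>P)"
    using tilt_mass_pos[of n \<theta>] damp_pos[of n 0 T]
    by (intro nn_integral_cong) (simp add: mult_ac ennreal_mult[symmetric] less_imp_le divide_inverse)
  also have "\<dots> = (\<integral>\<^sup>+\<omega>. f \<omega> * ennreal (tilt n \<theta> \<omega>) \<partial>P) * ennreal (1 / tilt_mass n \<theta>)"
    by (rule nn_integral_multc) measurable
  finally show ?thesis .
qed

lemma sets_tilted: "sets (tilted n \<theta>) = sets (F T)"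
  by (simp add: tilted_def sets_restr_to_subalg[OF subalgebra_F[OF horizon]])

lemma prob_space_tilted: "prob_space (tilted n \<theta>)"
proof
  have "emeasure (tilted n \<theta>) (space (tilted n \<theta>)) = (\<integral>\<^sup>+\<omega>. 1 \<partial>tilted n \<theta>)" by simp
  also have "\<dots> = ennreal (tilt_mass n \<theta>) * ennreal (1 / tilt_mass n \<theta>)"
    unfolding nn_integral_tilted[OF borel_measurable_const] tilt_mass_def
    using damp_pos[of n 0 T]
    by (subst nn_integral_eq_integral[symmetric, OF integrable_exp_damp]) (auto simp: less_imp_le)
  also have "\<dots> = 1" using tilt_mass_pos[of n \<theta>] by (simp add: ennreal_mult[symmetric])
  finally show "emeasure (tilted n \<theta>) (space (tilted n \<theta>)) = 1" .
qed

lemma tilted_equivalent: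
  "absolutely_continuous (restr_to_subalg P (F T)) (tilted n \<theta>)"
  "absolutely_continuous (tilted n \<theta>) (restr_to_subalg P (F T))"
proof -
  have sub: "subalgebra P (F T)" by (rule subalgebra_F[OF horizon])
  have [measurable]: "(\<lambda>\<omega>. ennreal (tilt n \<theta> \<omega> / tilt_mass n \<theta>)) \<in>
      borel_measurable (restr_to_subalg P (F T))"
    by (rule measurable_in_subalg[OF sub]) measurable
  show "absolutely_continuous (restr_to_subalg P (F T)) (tilted n \<theta>)"
    unfolding tilted_def by (rule absolutely_continuousI_density) measurable
  have pos: "0 < tilt n \<theta> \<omega> / tilt_mass n \<theta>" for \<omega>
    using tilt_mass_pos damp_pos by simp
  show "absolutely_continuous (tilted n \<theta>) (restr_to_subalg P (F T))"
    unfolding absolutely_continuous_def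
  proof
    fix N assume "N \<in> null_sets (tilted n \<theta>)"
    hence N: "N \<in> sets (restr_to_subalg P (F T))"
      and "AE \<omega> in restr_to_subalg P (F T). \<omega> \<in> N \<longrightarrow> ennreal (tilt n \<theta> \<omega> / tilt_mass n \<theta>) = 0"
      unfolding tilted_def by (subst (asm) null_sets_density_iff; auto)+
    from this(2) have "AE \<omega> in restr_to_subalg P (F T). \<omega> \<notin> N"
    proof eventually_elim
      case (elim \<omega>)
      thus ?case using pos[of \<omega>] by (auto simp: ennreal_eq_0_iff)
    qed
    thus "N \<in> null_sets (restr_to_subalg P (F T))" using N by (simp add: AE_iff_null_sets)
  qed
qed

text \<open>
  The density factorises over adjacent time intervals into factors that are independent and
  stationary under \<open>P\<close>; the normalising constants of the factors multiply up to that of the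
  density.
\<close>

lemma tilted_grid:
  assumes ir: "i + r \<le> 2 ^ k" and A: "A \<in> sets (F (tm k i))" and h [measurable]: "h \<in> borel_measurable borel"
  shows "(\<integral>\<^sup>+\<omega>. indicator A \<omega> * h (L (tm k (i + r)) \<omega> - L (tm k i) \<omega>) \<partial>tilted n \<theta>) =
      emeasure (tilted n \<theta>) A * (\<integral>\<^sup>+\<omega>. h (L (tm k r) \<omega>) \<partial>tilted n \<theta>)"
proof -
  define D where "D j \<omega> = ennreal (exp (\<theta> * L (tm k j) \<omega>) * damp n 0 (tm k j) \<omega>)" for j \<omega>
  define e where "e j = (\<integral>\<^sup>+\<omega>. D j \<omega> \<partial>P)" for j
  let ?N = "2 ^ k :: nat" and ?c = "ennreal (1 / tilt_mass n \<theta>)"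
  have DT: "D ?N \<omega> = ennreal (tilt n \<theta> \<omega>)" for \<omega> by (simp add: D_def)
  have DF: "D j \<in> borel_measurable (F (tm k j))" if "j \<le> ?N" for j
  proof -
    have [measurable]: "damp n 0 (tm k j) \<in> borel_measurable (F (tm k j))"
      using damp_measurable_F[of 0 j k n] that by simp
    have [measurable]: "L (tm k j) \<in> borel_measurable (F (tm k j))"
      using that by (intro L_tm_measurable_F) auto
    show ?thesis unfolding D_def by measurable
  qed
  have mult: "(\<integral>\<^sup>+\<omega>. U \<omega> * g (L (tm k (j + l)) \<omega> - L (tm k j) \<omega>) * D (j + l) \<omega> \<partial>P) =
      (\<integral>\<^sup>+\<omega>. U \<omega> * D j \<omega> \<partial>P) * (\<integral>\<^sup>+\<omega>. g (L (tm k l) \<omega>) * D l \<omega> \<partial>P)"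
    if jl: "j + l \<le> ?N" and U: "U \<in> borel_measurable (F (tm k j))" and g [measurable]: "g \<in> borel_measurable borel"
    for j l U and g :: "real \<Rightarrow> ennreal"
  proof -
    have "(\<integral>\<^sup>+\<omega>. U \<omega> * g (L (tm k (j + l)) \<omega> - L (tm k j) \<omega>) * D (j + l) \<omega> \<partial>P) =
      (\<integral>\<^sup>+\<omega>. (U \<omega> * D j \<omega>) * (\<lambda>x. g x * ennreal (exp (\<theta> * x))) (L (tm k (j + l)) \<omega> - L (tm k j) \<omega>) *
          ennreal (damp n (tm k j) (tm k (j + l)) \<omega>) \<partial>P)"
    proof (rule nn_integral_cong)
      fix \<omega> assume w: "\<omega> \<in> space P"
      have "damp n 0 (tm k (j + l)) \<omega> = damp n 0 (tm k j) \<omega> * damp n (tm k j) (tm k (j + l)) \<omega>"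
        using damp_mult[OF w, of 0 "tm k j" "tm k (j + l)" n] jl T_pos by (simp add: grid_le_T)
      moreover have "exp (\<theta> * L (tm k (j + l)) \<omega>) =
          exp (\<theta> * L (tm k j) \<omega>) * exp (\<theta> * (L (tm k (j + l)) \<omega> - L (tm k j) \<omega>))"
        by (simp add: exp_add[symmetric] algebra_simps)
      ultimately have "D (j + l) \<omega> = D j \<omega> * ennreal (exp (\<theta> * (L (tm k (j + l)) \<omega> - L (tm k j) \<omega>))) *
          ennreal (damp n (tm k j) (tm k (j + l)) \<omega>)"
        using damp_pos[of n] by (simp add: D_def ennreal_mult[symmetric] less_imp_le mult_ac)
      thus "U \<omega> * g (L (tm k (j + l)) \<omega> - L (tm k j) \<omega>) * D (j + l) \<omega> =
        (U \<omega> * D j \<omega>) * (\<lambda>x. g x * ennreal (exp (\<theta> * x))) (L (tm k (j + l)) \<omega> - L (tm k j) \<omega>) *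
          ennreal (damp n (tm k j) (tm k (j + l)) \<omega>)"
        by (simp add: mult_ac)
    qed
    also have "\<dots> = (\<integral>\<^sup>+\<omega>. U \<omega> * D j \<omega> \<partial>P) *
        (\<integral>\<^sup>+\<omega>. (\<lambda>x. g x * ennreal (exp (\<theta> * x))) (L (tm k l) \<omega>) * ennreal (damp n 0 (tm k l) \<omega>) \<partial>P)"
      using jl U DF[of j] by (intro nn_integral_damp_steps) auto
    also have "(\<integral>\<^sup>+\<omega>. (\<lambda>x. g x * ennreal (exp (\<theta> * x))) (L (tm k l) \<omega>) * ennreal (damp n 0 (tm k l) \<omega>) \<partial>P) =
        (\<integral>\<^sup>+\<omega>. g (L (tm k l) \<omega>) * D l \<omega> \<partial>P)"
      using damp_pos[of n]
      by (intro nn_integral_cong) (simp add: D_def ennreal_mult less_imp_le mult_ac)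
    finally show ?thesis .
  qed
  have e_mult: "e (j + l) = e j * e l" if "j + l \<le> ?N" for j l
    using mult[OF that, of "\<lambda>_. 1" "\<lambda>_. 1"] by (simp add: e_def)
  have eN: "e ?N * ?c = 1"
    using nn_integral_tilted[of "\<lambda>_. 1" n \<theta>] prob_space.emeasure_space_1[OF prob_space_tilted[of n \<theta>]]
    by (simp add: e_def DT)
  have drop: "(\<integral>\<^sup>+\<omega>. U \<omega> \<partial>tilted n \<theta>) = (\<integral>\<^sup>+\<omega>. U \<omega> * D j \<omega> \<partial>P) * e (?N - j) * ?c"
    if j: "j \<le> ?N" and U: "U \<in> borel_measurable (F (tm k j))" for j U
  proof -
    have "U \<in> borel_measurable (F T)" by (rule measurable_F_mono[OF U]) (use tm_bounds[OF j] in auto)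
    from nn_integral_tilted[OF this, of n \<theta>]
    have "(\<integral>\<^sup>+\<omega>. U \<omega> \<partial>tilted n \<theta>) = (\<integral>\<^sup>+\<omega>. U \<omega> * D ?N \<omega> \<partial>P) * ?c" by (simp add: DT)
    also have "(\<integral>\<^sup>+\<omega>. U \<omega> * D ?N \<omega> \<partial>P) = (\<integral>\<^sup>+\<omega>. U \<omega> * D j \<omega> \<partial>P) * e (?N - j)"
      using mult[OF _ U, of "?N - j" "\<lambda>_. 1"] j by (simp add: e_def)
    finally show ?thesis .
  qed
  let ?a = "\<integral>\<^sup>+\<omega>. indicator A \<omega> * D i \<omega> \<partial>P" and ?H = "\<integral>\<^sup>+\<omega>. h (L (tm k r) \<omega>) * D r \<omega> \<partial>P"
  have Lr: "(\<lambda>\<omega>. h (L (tm k r) \<omega>)) \<in> borel_measurable (F (tm k r))"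
    using ir by (intro measurable_compose[OF L_tm_measurable_F h]) auto
  have A': "A \<in> sets (F (tm k (i + r)))"
    using A sets_F_mono[of "tm k i" "tm k (i + r)"] ir T_pos by (auto simp: grid_le_T)
  have AT: "A \<in> sets (tilted n \<theta>)"
    using A sets_F_mono[of "tm k i" T] ir T_pos by (auto simp: sets_tilted grid_le_T)
  have hD: "(\<lambda>\<omega>. h (L (tm k (i + r)) \<omega> - L (tm k i) \<omega>)) \<in> borel_measurable (F (tm k (i + r)))"
    using ir by (intro measurable_compose[OF borel_measurable_diff h] L_tm_measurable_F) auto
  have "(\<integral>\<^sup>+\<omega>. indicator A \<omega> * h (L (tm k (i + r)) \<omega> - L (tm k i) \<omega>) \<partial>tilted n \<theta>) =
      (\<integral>\<^sup>+\<omega>. indicator A \<omega> * h (L (tm k (i + r)) \<omega> - L (tm k i) \<omega>) * D (i + r) \<omega> \<partial>P) * e (?N - (i + r)) * ?c"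
    using A' hD by (intro drop[OF ir]) auto
  also have "(\<integral>\<^sup>+\<omega>. indicator A \<omega> * h (L (tm k (i + r)) \<omega> - L (tm k i) \<omega>) * D (i + r) \<omega> \<partial>P) = ?a * ?H"
    using A by (intro mult[OF ir]) auto
  finally have 1: "(\<integral>\<^sup>+\<omega>. indicator A \<omega> * h (L (tm k (i + r)) \<omega> - L (tm k i) \<omega>) \<partial>tilted n \<theta>) =
      ?a * ?H * e (?N - (i + r)) * ?c" .
  have "emeasure (tilted n \<theta>) A = (\<integral>\<^sup>+\<omega>. indicator A \<omega> \<partial>tilted n \<theta>)" using AT by simp
  also have "\<dots> = ?a * e (?N - i) * ?c" using A ir by (intro drop) auto
  also have "e (?N - i) = e r * e (?N - (i + r))"
    using e_mult[of r "?N - (i + r)"] ir by simp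
  finally have 2: "emeasure (tilted n \<theta>) A = ?a * (e r * e (?N - (i + r))) * ?c" .
  have 3: "(\<integral>\<^sup>+\<omega>. h (L (tm k r) \<omega>) \<partial>tilted n \<theta>) = ?H * e (?N - r) * ?c"
    using ir by (intro drop Lr) auto
  have "e r * e (?N - r) * ?c = 1" using e_mult[of r "?N - r"] ir eN by simp
  moreover have "emeasure (tilted n \<theta>) A * (\<integral>\<^sup>+\<omega>. h (L (tm k r) \<omega>) \<partial>tilted n \<theta>) =
      ?a * ?H * e (?N - (i + r)) * ?c * (e r * e (?N - r) * ?c)"
    unfolding 2 3 by (simp only: mult_ac)
  ultimately show ?thesis unfolding 1 by simp
qed

lemma levy_tilted: "levy_process (tilted n \<theta>) F T L"
  by (rule levy_process_of_grid[OF prob_space_tilted sets_tilted tilted_equivalent(1) tilted_grid])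

lemma tilted_mean_0:
  assumes int: "integrable P (\<lambda>\<omega>. L T \<omega> * tilt n \<theta> \<omega>)"
    and mean: "(\<integral>\<omega>. L T \<omega> * tilt n \<theta> \<omega> \<partial>P) = 0"
  shows "integrable (tilted n \<theta>) (L T)" "(\<integral>\<omega>. L T \<omega> \<partial>tilted n \<theta>) = 0"
proof -
  let ?Z = "\<lambda>\<omega>. tilt n \<theta> \<omega> / tilt_mass n \<theta>"
  have sub: "subalgebra P (F T)" by (rule subalgebra_F[OF horizon])
  have Z [measurable]: "?Z \<in> borel_measurable (restr_to_subalg P (F T))"
    by (rule measurable_in_subalg[OF sub]) measurable
  have LT [measurable]: "L T \<in> borel_measurable (restr_to_subalg P (F T))"
    by (rule measurable_in_subalg[OF sub]) measurable
  have pos: "AE \<omega> in restr_to_subalg P (F T). 0 \<le> ?Z \<omega>"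
    using damp_pos[of n 0 T] tilt_mass_pos[of n \<theta>] by (intro AE_I2) (simp add: less_imp_le)
  have eq: "?Z \<omega> * L T \<omega> = (1 / tilt_mass n \<theta>) * (L T \<omega> * tilt n \<theta> \<omega>)" for \<omega>
    by simp
  have iP: "integrable P (\<lambda>\<omega>. ?Z \<omega> * L T \<omega>)"
    unfolding eq by (rule integrable_mult_right[OF int])
  have m: "(\<lambda>\<omega>. ?Z \<omega> * L T \<omega>) \<in> borel_measurable (F T)" by measurable
  have "integrable (restr_to_subalg P (F T)) (\<lambda>\<omega>. ?Z \<omega> * L T \<omega>)"
    by (rule integrable_in_subalg[OF sub m iP])
  thus "integrable (tilted n \<theta>) (L T)"
    unfolding tilted_def using integrable_density[OF LT Z pos] by simp
  have "(\<integral>\<omega>. L T \<omega> \<partial>tilted n \<theta>) = (\<integral>\<omega>. ?Z \<omega> * L T \<omega> \<partial>restr_to_subalg P (F T))"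
    unfolding tilted_def using integral_density[OF LT Z pos] by simp
  also have "\<dots> = (\<integral>\<omega>. ?Z \<omega> * L T \<omega> \<partial>P)" by (rule integral_subalgebra2[OF sub m])
  also have "\<dots> = 0" unfolding eq by (simp add: mean)
  finally show "(\<integral>\<omega>. L T \<omega> \<partial>tilted n \<theta>) = 0" .
qed

end

lemma restr_to_subalg_same:
  assumes "sets Q = sets G" shows "restr_to_subalg Q G = Q"
proof (rule measure_eqI)
  have sub: "subalgebra Q G" using assms sets_eq_imp_space_eq[OF assms] by (simp add: subalgebra_def)
  show "sets (restr_to_subalg Q G) = sets Q" by (simp add: sets_restr_to_subalg[OF sub] assms)
  fix A assume "A \<in> sets (restr_to_subalg Q G)"
  thus "emeasure (restr_to_subalg Q G) A = emeasure Q A"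
    by (simp add: emeasure_restr_to_subalg[OF sub] sets_restr_to_subalg[OF sub])
qed

context levy
begin

text \<open>
  Since the penalty is nonnegative, the logarithm of the density is at most
  \<open>\<theta> * L T - ln (tilt_mass n \<theta>)\<close>, and \<open>L T\<close> has mean 0 under the tilted measure.
\<close>

lemma rel_entropy_tilted_le:
  assumes int: "integrable P (\<lambda>\<omega>. L T \<omega> * tilt n \<theta> \<omega>)"
    and mean: "(\<integral>\<omega>. L T \<omega> * tilt n \<theta> \<omega> \<partial>P) = 0"
  shows "rel_entropy (F T) (tilted n \<theta>) P \<le> ereal (- ln (tilt_mass n \<theta>))"
proof -
  let ?P = "restr_to_subalg P (F T)" and ?Q = "tilted n \<theta>"
  let ?Z = "\<lambda>\<omega>. tilt n \<theta> \<omega> / tilt_mass n \<theta>"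
  let ?g = "\<lambda>\<omega>. ?Z \<omega> * (\<theta> * L T \<omega> - ln (tilt_mass n \<theta>))"
  have sub: "subalgebra P (F T)" by (rule subalgebra_F[OF horizon])
  interpret P': prob_space ?P by (rule prob_space_restr_to_subalg[OF sub prob_space_axioms])
  have pp: "0 < tilt_mass n \<theta>" by (rule tilt_mass_pos)
  have Zpos: "0 < ?Z \<omega>" for \<omega> using pp damp_pos by simp
  have Z [measurable]: "?Z \<in> borel_measurable ?P"
    by (rule measurable_in_subalg[OF sub]) measurable
  have RN: "AE \<omega> in ?P. ennreal (?Z \<omega>) = RN_deriv ?P ?Q \<omega>"
    by (rule P'.RN_deriv_unique) (simp_all add: tilted_def)
  have "ext_expectation ?P (\<lambda>\<omega>. enn2real (RN_deriv ?P ?Q \<omega>) * ln (enn2real (RN_deriv ?P ?Q \<omega>))) \<le> ext_expectation ?P ?g"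
  proof (rule ext_expectation_mono_AE)
    show "AE \<omega> in ?P. enn2real (RN_deriv ?P ?Q \<omega>) * ln (enn2real (RN_deriv ?P ?Q \<omega>)) \<le> ?g \<omega>"
      using RN AE_space
    proof eventually_elim
      case (elim \<omega>)
      hence w: "\<omega> \<in> space P" by (simp add: space_restr_to_subalg)
      have R: "enn2real (RN_deriv ?P ?Q \<omega>) = ?Z \<omega>"
        unfolding elim(1)[symmetric] using Zpos[of \<omega>] by (intro enn2real_ennreal) (rule less_imp_le)
      have "ln (?Z \<omega>) = \<theta> * L T \<omega> + ln (damp n 0 T \<omega>) - ln (tilt_mass n \<theta>)"
        using pp damp_pos[of n 0 T \<omega>] by (simp add: ln_div ln_mult)
      moreover have "ln (damp n 0 T \<omega>) \<le> 0"
        using damp_le_1[OF w, of 0 T n] T_pos damp_pos[of n 0 T \<omega>] by (subst ln_le_zero_iff) auto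
      ultimately have "ln (?Z \<omega>) \<le> \<theta> * L T \<omega> - ln (tilt_mass n \<theta>)" by linarith
      thus ?case unfolding R using Zpos[of \<omega>] by (intro mult_left_mono) (auto intro: less_imp_le)
    qed
  qed
  also have "ext_expectation ?P ?g = ereal (- ln (tilt_mass n \<theta>))"
  proof -
    have eq: "?g \<omega> = \<theta> / tilt_mass n \<theta> * (L T \<omega> * tilt n \<theta> \<omega>) -
        ln (tilt_mass n \<theta>) / tilt_mass n \<theta> * tilt n \<theta> \<omega>" for \<omega>
      using pp by (simp add: field_simps)
    have iP: "integrable P ?g"
      unfolding eq by (intro Bochner_Integration.integrable_diff integrable_mult_right int integrable_exp_damp)
    have m: "?g \<in> borel_measurable (F T)" by measurable
    have "(\<integral>\<omega>. ?g \<omega> \<partial>?P) = (\<integral>\<omega>. ?g \<omega> \<partial>P)" by (rule integral_subalgebra2[OF sub m])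
    also have "\<dots> = - ln (tilt_mass n \<theta>)"
      unfolding eq using pp
      by (subst Bochner_Integration.integral_diff)
         (auto intro!: integrable_mult_right int integrable_exp_damp simp: mean tilt_mass_def[symmetric])
    finally show ?thesis
      by (subst ext_expectation_eq_integral[OF integrable_in_subalg[OF sub m iP]]) simp
  qed
  finally show ?thesis
    unfolding rel_entropy_def restr_to_subalg_same[OF sets_tilted]
    using tilted_equivalent(1)[of n \<theta>] by (simp add: Let_def)
qed

lemma tilted_in_M_efl:
  assumes int: "integrable P (\<lambda>\<omega>. L T \<omega> * tilt n \<theta> \<omega>)"
    and mean: "(\<integral>\<omega>. L T \<omega> * tilt n \<theta> \<omega> \<partial>P) = 0"
  shows "tilted n \<theta> \<in> M_efl P F T L"
proof -
  interpret tilt: levy "tilted n \<theta>" F T L using T_pos levy_tilted by unfold_locales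
  have "rel_entropy (F T) (tilted n \<theta>) P < \<infinity>"
    by (rule order_le_less_trans[OF rel_entropy_tilted_le[OF assms]]) simp
  thus ?thesis
    unfolding M_efl_def prob_ac_def
    using prob_space_tilted sets_tilted tilted_equivalent levy_tilted
      tilt.martingale_of_mean_0[OF tilted_mean_0[OF assms]] by simp
qed

end

section \<open>The lower bound\<close>

lemma grid_above_le_iff:
  assumes "0 < T" "0 \<le> x" shows "grid_above T m x \<le> i \<longleftrightarrow> x \<le> grid T m i"
proof -
  have "grid_above T m x \<le> i \<longleftrightarrow> x * 2 ^ m / T \<le> real i"
    unfolding grid_above_def by (simp add: nat_le_iff ceiling_le_iff)
  also have "\<dots> \<longleftrightarrow> x \<le> grid T m i"
    using assms(1) by (simp add: grid_def field_simps)
  finally show ?thesis .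
qed

context levy
begin

text \<open>
  The exponential moments are multiplicative over grid steps, so the one at time \<open>T\<close> determines
  all others. In particular they are finite.
\<close>

lemma exp_moment_grid:
  assumes \<kappa>: "(\<integral>\<^sup>+\<omega>. ennreal (exp (\<theta> * L T \<omega>)) \<partial>P) = ennreal (exp (\<kappa> * T))" and i: "i \<le> 2 ^ m"
  shows "(\<integral>\<^sup>+\<omega>. ennreal (exp (\<theta> * L (tm m i) \<omega>)) \<partial>P) = ennreal (exp (\<kappa> * tm m i))"
proof -
  define E where "E r = (\<integral>\<^sup>+\<omega>. ennreal (exp (\<theta> * L (tm m r) \<omega>)) \<partial>P)" for r
  have step: "E (Suc r) = E r * E 1" if "Suc r \<le> 2 ^ m" for r
  proof -
    have [measurable]: "L (tm m r) \<in> borel_measurable (F (tm m r))"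
      using that by (intro L_tm_measurable_F) auto
    have "E (Suc r) = (\<integral>\<^sup>+\<omega>. ennreal (exp (\<theta> * L (tm m r) \<omega>)) *
        ennreal (exp (\<theta> * (L (tm m (r + 1)) \<omega> - L (tm m r) \<omega>))) * (\<Prod>k\<in>{r..<r + 1}. 1) \<partial>P)"
      unfolding E_def
      by (intro nn_integral_cong) (simp add: ennreal_mult[symmetric] exp_add[symmetric] algebra_simps)
    also have "\<dots> = E r * (\<integral>\<^sup>+\<omega>. ennreal (exp (\<theta> * L (tm m 1) \<omega>)) * (\<Prod>k<1::nat. 1) \<partial>P)"
      unfolding E_def using that
      by (intro nn_integral_grid_steps[where w = "\<lambda>_. 1" and h = "\<lambda>x. ennreal (exp (\<theta> * x))"]) auto
    finally show ?thesis by (simp add: E_def)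
  qed
  have pow: "E r = E 1 ^ r" if "r \<le> 2 ^ m" for r
    using that
  proof (induction r)
    case 0
    have "E 0 = (\<integral>\<^sup>+\<omega>. 1 \<partial>P)" unfolding E_def by (intro nn_integral_cong) (simp add: L_0)
    thus ?case by (simp add: emeasure_space_1)
  next
    case (Suc r)
    thus ?case using step[of r] by (simp add: mult.commute)
  qed
  have top: "E 1 ^ (2 ^ m) = ennreal (exp (\<kappa> * T))"
    using pow[of "2 ^ m"] \<kappa> by (simp add: E_def)
  hence "E 1 \<noteq> top" by (auto simp: top_power_ennreal)
  then obtain x where x: "0 \<le> x" "E 1 = ennreal x" by (cases "E 1") auto
  have "x ^ (2 ^ m) = exp (\<kappa> * T)" using top x by (simp add: ennreal_power)
  also have "\<dots> = exp (\<kappa> * T / 2 ^ m) ^ (2 ^ m)"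
    by (subst exp_of_nat_mult[symmetric]) simp
  finally have "x = exp (\<kappa> * T / 2 ^ m)" by (rule power_eq_imp_eq_base) (use x(1) in simp_all)
  hence "E i = ennreal (exp (\<kappa> * T / 2 ^ m) ^ i)" using pow[OF i] x by (simp add: ennreal_power)
  also have "exp (\<kappa> * T / 2 ^ m) ^ i = exp (\<kappa> * tm m i)"
    by (simp add: exp_of_nat_mult[symmetric] grid_def mult_ac)
  finally show ?thesis by (simp add: E_def)
qed

text \<open>
  Rounding a stopping time up to the grid gives a stopping time. Values beyond \<open>T\<close> are cut back to
  \<open>T\<close>, so that at the last grid time nothing has to be observed.
\<close>

lemma stopping_time_grid_sets:
  assumes \<tau>: "stopping_time_upto F T \<tau>" and i: "i \<le> 2 ^ m"
  shows "{\<omega> \<in> space P. grid_above T m (min (\<tau> \<omega>) T) = i} \<in> sets (F (tm m i))"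
proof -
  have \<tau>0: "0 \<le> min (\<tau> \<omega>) T" if "\<omega> \<in> space P" for \<omega>
    using \<tau> that T_pos space_F[OF horizon] by (auto simp: stopping_time_upto_def)
  have le: "{\<omega> \<in> space P. grid_above T m (min (\<tau> \<omega>) T) \<le> j} \<in> sets (F (tm m j))" if j: "j \<le> 2 ^ m" for j
  proof (cases "j = 2 ^ m")
    case True
    have "{\<omega> \<in> space P. grid_above T m (min (\<tau> \<omega>) T) \<le> j} = space (F (tm m j))"
      using True \<tau>0 space_F[OF horizon] by (auto simp: grid_above_le_iff[OF T_pos])
    thus ?thesis by simp
  next
    case False
    hence "tm m j < tm m (2 ^ m)" using j T_pos by (intro iffD2[OF grid_less_iff]) auto
    hence "{\<omega> \<in> space P. grid_above T m (min (\<tau> \<omega>) T) \<le> j} = {\<omega> \<in> space (F (tm m j)). \<tau> \<omega> \<le> tm m j}"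
      using \<tau>0 space_F[OF tm_bounds[OF j]] by (auto simp: grid_above_le_iff[OF T_pos])
    also have "\<dots> \<in> sets (F (tm m j))"
      using \<tau> tm_bounds[OF j] by (auto simp: stopping_time_upto_def intro!: predE)
    finally show ?thesis .
  qed
  show ?thesis
  proof (cases i)
    case 0
    thus ?thesis using le[of 0] by simp
  next
    case (Suc j)
    have "{\<omega> \<in> space P. grid_above T m (min (\<tau> \<omega>) T) \<le> j} \<in> sets (F (tm m i))"
      using le[of j] sets_F_mono[of "tm m j" "tm m i"] i Suc T_pos by (auto simp: grid_le_T)
    with le[OF i] have "{\<omega> \<in> space P. grid_above T m (min (\<tau> \<omega>) T) \<le> i} -
        {\<omega> \<in> space P. grid_above T m (min (\<tau> \<omega>) T) \<le> j} \<in> sets (F (tm m i))" by (rule sets.Diff)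
    also have "{\<omega> \<in> space P. grid_above T m (min (\<tau> \<omega>) T) \<le> i} -
        {\<omega> \<in> space P. grid_above T m (min (\<tau> \<omega>) T) \<le> j} = {\<omega> \<in> space P. grid_above T m (min (\<tau> \<omega>) T) = i}"
      using Suc by auto
    finally show ?thesis .
  qed
qed

text \<open>
  Optional stopping for the exponential martingale. Approximating the stopping time from above by
  grid-valued ones gives expectation exactly 1; right-continuity and Fatou's lemma give the
  inequality in the limit.
\<close>

lemma exp_martingale_stopped_le_1:
  assumes \<kappa>: "(\<integral>\<^sup>+\<omega>. ennreal (exp (\<theta> * L T \<omega>)) \<partial>P) = ennreal (exp (\<kappa> * T))"
    and \<tau>: "stopping_time_upto F T \<tau>"
  shows "(\<integral>\<^sup>+\<omega>. ennreal (exp (\<theta> * L (min (\<tau> \<omega>) T) \<omega> - \<kappa> * min (\<tau> \<omega>) T)) \<partial>P) \<le> 1"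
proof -
  define g where "g m \<omega> = grid_above T m (min (\<tau> \<omega>) T)" for m \<omega>
  have \<tau>0: "0 \<le> min (\<tau> \<omega>) T" if "\<omega> \<in> space P" for \<omega>
    using \<tau> that T_pos space_F[OF horizon] by (auto simp: stopping_time_upto_def)
  define u where "u m \<omega> = (\<Sum>i\<le>2 ^ m. indicator {\<omega> \<in> space P. g m \<omega> = i} \<omega> *
      ennreal (exp (\<theta> * L (tm m i) \<omega> - \<kappa> * tm m i)))" for m \<omega>
  have A_F: "{\<omega> \<in> space P. g m \<omega> = i} \<in> sets (F (tm m i))" if "i \<le> 2 ^ m" for i m
    unfolding g_def by (rule stopping_time_grid_sets[OF \<tau> that])
  have A_P: "{\<omega> \<in> space P. g m \<omega> = i} \<in> sets P" if "i \<le> 2 ^ m" for i m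
    using A_F[OF that] sets_F_P[OF tm_bounds[OF that]] by auto
  have meas [measurable]: "(\<lambda>\<omega>. indicator {\<omega> \<in> space P. g m \<omega> = i} \<omega> *
      ennreal (exp (\<theta> * L (tm m i) \<omega> - \<kappa> * tm m i))) \<in> borel_measurable P" if "i \<le> 2 ^ m" for i m
  proof -
    note [measurable] = A_P[OF that] L_tm_measurable[OF that]
    show ?thesis by measurable
  qed
  have um [measurable]: "u m \<in> borel_measurable P" for m
    unfolding u_def by (intro borel_measurable_sum meas) simp
  have one: "(\<integral>\<^sup>+\<omega>. u m \<omega> \<partial>P) = 1" for m
  proof -
    have step: "(\<integral>\<^sup>+\<omega>. indicator {\<omega> \<in> space P. g m \<omega> = i} \<omega> * ennreal (exp (\<theta> * L (tm m i) \<omega> - \<kappa> * tm m i)) \<partial>P) =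
      (\<integral>\<^sup>+\<omega>. indicator {\<omega> \<in> space P. g m \<omega> = i} \<omega> * ennreal (exp (\<theta> * L T \<omega> - \<kappa> * T)) \<partial>P)"
      if i: "i \<le> 2 ^ m" for i
    proof -
      let ?Y = "\<lambda>\<omega>. indicator {\<omega> \<in> space P. g m \<omega> = i} \<omega> * ennreal (exp (\<theta> * L (tm m i) \<omega> - \<kappa> * tm m i))"
      let ?h = "\<lambda>y. ennreal (exp (\<theta> * y - \<kappa> * (T - tm m i)))"
      have t: "0 \<le> tm m i" "tm m i \<le> T" using tm_bounds[OF i] by auto
      have Tt: "T - tm m i = tm m (2 ^ m - i)" using grid_diff[OF i, of T m] by simp
      have [measurable]: "L (T - tm m i) \<in> borel_measurable P" using t by (intro L_measurable) auto
      have [measurable]: "L (tm m i) \<in> borel_measurable (F (tm m i))" using i by (intro L_tm_measurable_F) auto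
      have Y: "?Y \<in> borel_measurable (F (tm m i))" using A_F[OF i] by measurable
      have "(\<integral>\<^sup>+\<omega>. indicator {\<omega> \<in> space P. g m \<omega> = i} \<omega> * ennreal (exp (\<theta> * L T \<omega> - \<kappa> * T)) \<partial>P) =
        (\<integral>\<^sup>+\<omega>. ?Y \<omega> * ?h (L T \<omega> - L (tm m i) \<omega>) \<partial>P)"
        by (intro nn_integral_cong)
           (simp add: mult.assoc ennreal_mult[symmetric] exp_add[symmetric] algebra_simps)
      also have "\<dots> = (\<integral>\<^sup>+\<omega>. ?Y \<omega> * (\<integral>\<^sup>+y. ?h y \<partial>distr P borel (L (T - tm m i))) \<partial>P)"
        using t Y by (intro nn_integral_increment[where V = "\<lambda>_. 0" and h = "\<lambda>_. ?h"]) auto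
      also have "(\<integral>\<^sup>+y. ?h y \<partial>distr P borel (L (T - tm m i))) = 1"
      proof -
        have "(\<integral>\<^sup>+y. ?h y \<partial>distr P borel (L (T - tm m i))) = (\<integral>\<^sup>+\<omega>. ?h (L (T - tm m i) \<omega>) \<partial>P)"
          by (rule nn_integral_distr) measurable
        also have "\<dots> = (\<integral>\<^sup>+\<omega>. ennreal (exp (\<theta> * L (T - tm m i) \<omega>)) * ennreal (exp (- \<kappa> * (T - tm m i))) \<partial>P)"
          by (intro nn_integral_cong) (simp add: ennreal_mult[symmetric] exp_add[symmetric])
        also have "\<dots> = (\<integral>\<^sup>+\<omega>. ennreal (exp (\<theta> * L (T - tm m i) \<omega>)) \<partial>P) * ennreal (exp (- \<kappa> * (T - tm m i)))"
          by (rule nn_integral_multc) measurable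
        also have "\<dots> = 1"
          unfolding Tt by (subst exp_moment_grid[OF \<kappa>])
            (simp_all add: ennreal_mult[symmetric] exp_add[symmetric])
        finally show ?thesis .
      qed
      finally show ?thesis by simp
    qed
    have "(\<integral>\<^sup>+\<omega>. u m \<omega> \<partial>P) = (\<Sum>i\<le>2 ^ m. \<integral>\<^sup>+\<omega>. indicator {\<omega> \<in> space P. g m \<omega> = i} \<omega> *
        ennreal (exp (\<theta> * L T \<omega> - \<kappa> * T)) \<partial>P)"
      unfolding u_def by (subst nn_integral_sum) (auto intro!: meas sum.cong step)
    also have "\<dots> = (\<integral>\<^sup>+\<omega>. (\<Sum>i\<le>2 ^ m. indicator {\<omega> \<in> space P. g m \<omega> = i} \<omega> *
        ennreal (exp (\<theta> * L T \<omega> - \<kappa> * T))) \<partial>P)"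
    proof (rule nn_integral_sum[symmetric])
      fix i assume "i \<in> {..(2::nat) ^ m}"
      hence [measurable]: "{\<omega> \<in> space P. g m \<omega> = i} \<in> sets P" by (intro A_P) simp
      show "(\<lambda>\<omega>. indicator {\<omega> \<in> space P. g m \<omega> = i} \<omega> * ennreal (exp (\<theta> * L T \<omega> - \<kappa> * T))) \<in> borel_measurable P"
        by measurable
    qed
    also have "\<dots> = (\<integral>\<^sup>+\<omega>. ennreal (exp (\<theta> * L T \<omega>)) * ennreal (exp (- \<kappa> * T)) \<partial>P)"
    proof (rule nn_integral_cong)
      fix \<omega> assume w: "\<omega> \<in> space P"
      have "g m \<omega> \<le> 2 ^ m" unfolding g_def by (rule grid_above_props(3)[OF T_pos \<tau>0[OF w]]) simp
      hence "(\<Sum>i\<le>2 ^ m. indicator {\<omega> \<in> space P. g m \<omega> = i} \<omega> :: ennreal) = 1"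
        using w by (simp add: indicator_def of_bool_def sum.delta)
      hence "(\<Sum>i\<le>2 ^ m. indicator {\<omega> \<in> space P. g m \<omega> = i} \<omega> * ennreal (exp (\<theta> * L T \<omega> - \<kappa> * T))) =
          1 * ennreal (exp (\<theta> * L T \<omega> - \<kappa> * T))" by (simp only: sum_distrib_right[symmetric])
      thus "(\<Sum>i\<le>2 ^ m. indicator {\<omega> \<in> space P. g m \<omega> = i} \<omega> * ennreal (exp (\<theta> * L T \<omega> - \<kappa> * T))) =
          ennreal (exp (\<theta> * L T \<omega>)) * ennreal (exp (- \<kappa> * T))"
        by (simp add: ennreal_mult[symmetric] exp_add[symmetric])
    qed
    also have "\<dots> = ennreal (exp (\<kappa> * T)) * ennreal (exp (- \<kappa> * T))"
      by (subst nn_integral_multc) (simp_all add: \<kappa>)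
    also have "\<dots> = 1" by (simp add: ennreal_mult[symmetric] exp_add[symmetric])
    finally show ?thesis .
  qed
  have "(\<integral>\<^sup>+\<omega>. ennreal (exp (\<theta> * L (min (\<tau> \<omega>) T) \<omega> - \<kappa> * min (\<tau> \<omega>) T)) \<partial>P) = (\<integral>\<^sup>+\<omega>. liminf (\<lambda>m. u m \<omega>) \<partial>P)"
  proof (rule nn_integral_cong)
    fix \<omega> assume w: "\<omega> \<in> space P"
    let ?x = "min (\<tau> \<omega>) T"
    have x: "0 \<le> ?x" "?x \<le> T" using \<tau>0[OF w] by auto
    note gp = grid_above_props[OF T_pos x] and gl = grid_above_tendsto[OF T_pos x]
    have "u m \<omega> = ennreal (exp (\<theta> * L (tm m (g m \<omega>)) \<omega> - \<kappa> * tm m (g m \<omega>)))" for m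
    proof -
      have "u m \<omega> = (\<Sum>i\<le>2 ^ m. if i = g m \<omega> then ennreal (exp (\<theta> * L (tm m i) \<omega> - \<kappa> * tm m i)) else 0)"
        unfolding u_def using w by (intro sum.cong) (auto simp: indicator_def)
      thus ?thesis using gp(3)[of m] by (simp add: sum.delta g_def)
    qed
    moreover have "(\<lambda>m. ennreal (exp (\<theta> * L (tm m (g m \<omega>)) \<omega> - \<kappa> * tm m (g m \<omega>)))) \<longlonglongrightarrow>
        ennreal (exp (\<theta> * L ?x \<omega> - \<kappa> * ?x))"
    proof (intro tendsto_intros tendsto_ennrealI)
      show "(\<lambda>m. tm m (g m \<omega>)) \<longlonglongrightarrow> ?x" unfolding g_def by (rule gl)
      show "(\<lambda>m. L (tm m (g m \<omega>)) \<omega>) \<longlonglongrightarrow> L ?x \<omega>"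
        unfolding g_def using gp T_pos
        by (intro cadlag_on_right_limit[OF cadlag[OF w] x gl]) (auto simp: grid_le_T)
    qed
    ultimately have "(\<lambda>m. u m \<omega>) \<longlonglongrightarrow> ennreal (exp (\<theta> * L ?x \<omega> - \<kappa> * ?x))" by simp
    thus "ennreal (exp (\<theta> * L ?x \<omega> - \<kappa> * ?x)) = liminf (\<lambda>m. u m \<omega>)"
      by (rule lim_imp_Liminf[OF sequentially_bot, symmetric])
  qed
  also have "\<dots> \<le> liminf (\<lambda>m. \<integral>\<^sup>+\<omega>. u m \<omega> \<partial>P)" by (rule nn_integral_liminf) measurable
  also have "\<dots> = 1" by (simp add: one Liminf_const)
  finally show ?thesis .
qed

lemma stopping_time_measurable:
  assumes \<tau>: "stopping_time_upto F T \<tau>"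
  shows "(\<lambda>\<omega>. min (\<tau> \<omega>) T) \<in> borel_measurable (F T)"
proof (rule borel_measurableI_le)
  fix y
  consider "y < 0" | "0 \<le> y" "y < T" | "T \<le> y" by linarith
  thus "{\<omega> \<in> space (F T). min (\<tau> \<omega>) T \<le> y} \<in> sets (F T)"
  proof cases
    case 1
    hence "{\<omega> \<in> space (F T). min (\<tau> \<omega>) T \<le> y} = {}"
      using \<tau> T_pos by (force simp: stopping_time_upto_def)
    thus ?thesis by (simp only: sets.empty_sets)
  next
    case 2
    hence "{\<omega> \<in> space (F T). min (\<tau> \<omega>) T \<le> y} = {\<omega> \<in> space (F y). \<tau> \<omega> \<le> y}"
      using space_F[OF horizon] space_F[of y] by auto
    also have "\<dots> \<in> sets (F y)" using \<tau> 2 by (auto simp: stopping_time_upto_def intro!: predE)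
    finally show ?thesis using sets_F_mono[of y T] 2 by auto
  next
    case 3
    hence "{\<omega> \<in> space (F T). min (\<tau> \<omega>) T \<le> y} = space (F T)" by auto
    thus ?thesis by simp
  qed
qed

text \<open>
  Young's inequality \<open>z * u \<le> z * ln z - z + exp u\<close>, with the density of \<open>Q\<close> for \<open>z\<close>, is
  integrated with respect to \<open>P\<close>. This is the Gibbs variational inequality; it also covers infinite
  entropy, because the lower bound for \<open>z * ln z\<close> is integrable.
\<close>

lemma rel_entropy_ge_integral:
  assumes Q: "Q \<in> prob_ac P F T"
    and U: "integrable Q U" and exp_U: "(\<integral>\<^sup>+\<omega>. ennreal (exp (U \<omega>)) \<partial>P) \<le> 1"
  shows "ereal (\<integral>\<omega>. U \<omega> \<partial>Q) \<le> rel_entropy (F T) Q P"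
proof -
  let ?P = "restr_to_subalg P (F T)"
  have sub: "subalgebra P (F T)" by (rule subalgebra_F[OF horizon])
  interpret P': prob_space ?P by (rule prob_space_restr_to_subalg[OF sub prob_space_axioms])
  have prQ: "prob_space Q" and sQ: "sets Q = sets (F T)" and ac: "absolutely_continuous ?P Q"
    using Q by (auto simp: prob_ac_def)
  interpret Q: prob_space Q by (rule prQ)
  have sQP: "sets Q = sets ?P" by (simp add: sQ sets_restr_to_subalg[OF sub])
  obtain D where D [measurable]: "D \<in> borel_measurable ?P"
    and RN: "AE \<omega> in ?P. RN_deriv ?P Q \<omega> = ennreal (D \<omega>)" and D0: "\<And>\<omega>. 0 \<le> D \<omega>"
    using P'.real_RN_deriv[OF Q.finite_measure_axioms ac sQP] by metis
  have Qd: "Q = density ?P (\<lambda>\<omega>. ennreal (D \<omega>))"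
  proof -
    have "Q = density ?P (RN_deriv ?P Q)" by (rule P'.density_RN_deriv[OF ac sQP, symmetric])
    also have "\<dots> = density ?P (\<lambda>\<omega>. ennreal (D \<omega>))" using RN by (intro density_cong) auto
    finally show ?thesis .
  qed
  have UF: "U \<in> borel_measurable (F T)"
    using U by (simp cong: measurable_cong_sets add: sQ[symmetric] borel_measurable_integrable)
  have Um [measurable]: "U \<in> borel_measurable ?P" by (rule measurable_in_subalg[OF sub UF])
  have DU: "integrable ?P (\<lambda>\<omega>. D \<omega> * U \<omega>)" and DUi: "(\<integral>\<omega>. D \<omega> * U \<omega> \<partial>?P) = (\<integral>\<omega>. U \<omega> \<partial>Q)"
  proof -
    have "integrable (density ?P (\<lambda>\<omega>. ennreal (D \<omega>))) U" using U Qd by simp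
    thus "integrable ?P (\<lambda>\<omega>. D \<omega> * U \<omega>)"
      using D0 by (subst (asm) integrable_density) auto
    have "(\<integral>\<omega>. U \<omega> \<partial>Q) = (\<integral>\<omega>. U \<omega> \<partial>density ?P (\<lambda>\<omega>. ennreal (D \<omega>)))" using Qd by simp
    thus "(\<integral>\<omega>. D \<omega> * U \<omega> \<partial>?P) = (\<integral>\<omega>. U \<omega> \<partial>Q)"
      using D0 by (subst (asm) integral_density) auto
  qed
  have D1: "(\<integral>\<^sup>+\<omega>. ennreal (D \<omega>) \<partial>?P) = 1"
  proof -
    have "1 = emeasure (density ?P (\<lambda>\<omega>. ennreal (D \<omega>))) (space ?P)"
      using Q.emeasure_space_1 sets_eq_imp_space_eq[OF sQP] Qd by simp
    also have "\<dots> = (\<integral>\<^sup>+\<omega>. ennreal (D \<omega>) * indicator (space ?P) \<omega> \<partial>?P)"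
      by (rule emeasure_density) auto
    also have "\<dots> = (\<integral>\<^sup>+\<omega>. ennreal (D \<omega>) \<partial>?P)" by (intro nn_integral_cong) simp
    finally show ?thesis ..
  qed
  have Di: "integrable ?P D" using D1 D0 by (intro integrableI_nonneg) auto
  have D1': "(\<integral>\<omega>. D \<omega> \<partial>?P) = 1" using D1 D0 by (subst integral_eq_nn_integral) auto
  have eU: "(\<integral>\<^sup>+\<omega>. ennreal (exp (U \<omega>)) \<partial>?P) \<le> 1"
    using exp_U UF by (subst nn_integral_subalgebra2[OF sub]) auto
  have eUi: "integrable ?P (\<lambda>\<omega>. exp (U \<omega>))"
    using eU by (intro integrableI_nonneg) (auto simp: order_le_less_trans)
  have eU1: "(\<integral>\<omega>. exp (U \<omega>) \<partial>?P) \<le> 1"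
  proof -
    have "ennreal (\<integral>\<omega>. exp (U \<omega>) \<partial>?P) \<le> ennreal 1"
      using eU by (subst nn_integral_eq_integral[symmetric, OF eUi]) auto
    thus ?thesis by (subst (asm) ennreal_le_iff) auto
  qed
  let ?f = "\<lambda>\<omega>. D \<omega> * U \<omega> + D \<omega> - exp (U \<omega>)"
  have fi: "integrable ?P ?f"
    by (intro Bochner_Integration.integrable_add Bochner_Integration.integrable_diff DU Di eUi)
  have "(\<integral>\<omega>. U \<omega> \<partial>Q) \<le> (\<integral>\<omega>. ?f \<omega> \<partial>?P)"
    using DU Di eUi eU1 by (simp add: DUi D1')
  hence "ereal (\<integral>\<omega>. U \<omega> \<partial>Q) \<le> ext_expectation ?P ?f"
    by (simp add: ext_expectation_eq_integral[OF fi])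
  also have "\<dots> \<le> ext_expectation ?P (\<lambda>\<omega>. enn2real (RN_deriv ?P Q \<omega>) * ln (enn2real (RN_deriv ?P Q \<omega>)))"
  proof (rule ext_expectation_mono_AE)
    show "AE \<omega> in ?P. ?f \<omega> \<le> enn2real (RN_deriv ?P Q \<omega>) * ln (enn2real (RN_deriv ?P Q \<omega>))"
      using RN
    proof eventually_elim
      case (elim \<omega>)
      thus ?case using young_exp[OF D0[of \<omega>], of "U \<omega>"] D0[of \<omega>] by simp
    qed
  qed
  also have "\<dots> = rel_entropy (F T) Q P"
    unfolding rel_entropy_def restr_to_subalg_same[OF sQ] using ac by (simp add: Let_def)
  finally show ?thesis .
qed

text \<open>
  The variational inequality is applied to \<open>U = \<theta> * L \<tau> - \<kappa> * \<tau>\<close> for the stopping times cut back to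
  \<open>T\<close>; since the stopped process has mean 0, only the term with \<open>\<kappa>\<close> survives, and it converges to
  \<open>\<kappa> * T\<close>.
\<close>

lemma rel_entropy_ge:
  assumes \<kappa>: "(\<integral>\<^sup>+\<omega>. ennreal (exp (\<theta> * L T \<omega>)) \<partial>P) = ennreal (exp (\<kappa> * T))"
    and Q: "Q \<in> prob_ac P F T" and \<tau>: "\<And>k::nat. stopping_time_upto F T (\<tau> k)"
    and int: "\<And>k. integrable Q (\<lambda>\<omega>. L (min (\<tau> k \<omega>) T) \<omega>)"
    and mean: "\<And>k. (\<integral>\<omega>. L (min (\<tau> k \<omega>) T) \<omega> \<partial>Q) = 0"
    and ev: "AE \<omega> in Q. \<forall>\<^sub>F k in sequentially. T \<le> \<tau> k \<omega>"
  shows "ereal (- (\<kappa> * T)) \<le> rel_entropy (F T) Q P"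
proof -
  have prQ: "prob_space Q" and sQ: "sets Q = sets (F T)"
    using Q by (auto simp: prob_ac_def)
  interpret Q: prob_space Q by (rule prQ)
  have spQ: "space Q = space (F T)" by (rule sets_eq_imp_space_eq[OF sQ])
  have mt [measurable]: "(\<lambda>\<omega>. min (\<tau> k \<omega>) T) \<in> borel_measurable Q" for k
    using stopping_time_measurable[OF \<tau>[of k]] by (simp cong: measurable_cong_sets add: sQ)
  have bt: "norm (min (\<tau> k \<omega>) T) \<le> T" if "\<omega> \<in> space Q" for k \<omega>
    using \<tau>[of k] that T_pos by (auto simp: stopping_time_upto_def spQ abs_if)
  have it: "integrable Q (\<lambda>\<omega>. min (\<tau> k \<omega>) T)" for k
    using bt by (intro Q.integrable_const_bound[where B = T] AE_I2) auto
  have lim: "(\<lambda>k. \<integral>\<omega>. min (\<tau> k \<omega>) T \<partial>Q) \<longlonglongrightarrow> (\<integral>\<omega>. T \<partial>Q)"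
  proof (rule integral_dominated_convergence[where w = "\<lambda>_. T"])
    show "AE \<omega> in Q. (\<lambda>k. min (\<tau> k \<omega>) T) \<longlonglongrightarrow> T"
      using ev
    proof eventually_elim
      case (elim \<omega>)
      show ?case by (rule tendsto_eventually) (use elim in \<open>eventually_elim, simp\<close>)
    qed
  qed (use bt in auto)
  have "ereal (- (\<kappa> * (\<integral>\<omega>. min (\<tau> k \<omega>) T \<partial>Q))) \<le> rel_entropy (F T) Q P" for k
  proof -
    let ?U = "\<lambda>\<omega>. \<theta> * L (min (\<tau> k \<omega>) T) \<omega> - \<kappa> * min (\<tau> k \<omega>) T"
    have "(\<integral>\<omega>. ?U \<omega> \<partial>Q) = - (\<kappa> * (\<integral>\<omega>. min (\<tau> k \<omega>) T \<partial>Q))"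
      using int[of k] it[of k] by (simp add: mean)
    moreover have "ereal (\<integral>\<omega>. ?U \<omega> \<partial>Q) \<le> rel_entropy (F T) Q P"
      by (intro rel_entropy_ge_integral[OF Q] exp_martingale_stopped_le_1[OF \<kappa> \<tau>]
            Bochner_Integration.integrable_diff integrable_mult_right int it)
    ultimately show ?thesis by simp
  qed
  moreover have "(\<lambda>k. ereal (- (\<kappa> * (\<integral>\<omega>. min (\<tau> k \<omega>) T \<partial>Q)))) \<longlonglongrightarrow> ereal (- (\<kappa> * T))"
    using lim by (auto intro!: tendsto_intros simp: Q.prob_space)
  ultimately show ?thesis by (intro LIMSEQ_le_const2[of _ "ereal (- (\<kappa> * T))"]) blast+
qed

end

lemma martingale_mean_const:
  assumes M: "martingale_upto Q F T X" and T: "0 \<le> T"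
  shows "(\<integral>\<omega>. X T \<omega> \<partial>Q) = (\<integral>\<omega>. X 0 \<omega> \<partial>Q)"
proof -
  have fps: "filtered_prob_space Q F T" and int: "\<And>t. t \<in> {0..T} \<Longrightarrow> integrable Q (X t)"
    and ce: "AE \<omega> in Q. real_cond_exp Q (F 0) (X T) \<omega> = X 0 \<omega>"
    using M T by (auto simp: martingale_upto_def)
  interpret Q: prob_space Q using fps by (simp add: filtered_prob_space_def)
  have sub: "subalgebra Q (F 0)" using fps T by (simp add: filtered_prob_space_def)
  interpret S: finite_measure_subalgebra Q "F 0" using sub by unfold_locales
  have "(\<integral>\<omega>. X T \<omega> \<partial>Q) = (\<integral>\<omega>. real_cond_exp Q (F 0) (X T) \<omega> \<partial>Q)"
    using S.real_cond_exp_int(2)[OF int[of T]] T by simp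
  also have "\<dots> = (\<integral>\<omega>. X 0 \<omega> \<partial>Q)"
    using ce int[of 0] T by (intro integral_cong_AE) (auto intro: borel_measurable_integrable)
  finally show ?thesis .
qed

section \<open>The four classes\<close>

lemma M_efl_subset_M_a: "M_efl P F T L \<subseteq> M_a P F T L"
  by (auto simp: M_efl_def M_a_def)

lemma stopping_time_horizon: "0 < T \<Longrightarrow> stopping_time_upto F T (\<lambda>_. T)"
  by (auto simp: stopping_time_upto_def)

text \<open>
  The constant time \<open>T\<close> serves as localising sequence, here and for the larger class below.
\<close>

lemma M_a_subset_M_a_loc:
  assumes T: "0 < T" shows "M_a P F T L \<subseteq> M_a_loc P F T L"
proof
  fix Q assume Q: "Q \<in> M_a P F T L"
  hence M: "martingale_upto Q F T L" by (simp add: M_a_def)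
  have "martingale_upto Q F T (\<lambda>t \<omega>. L (min t T) \<omega>)"
    using M by (auto simp: martingale_upto_def adapted_process_def min_absorb1)
  hence "local_martingale_upto Q F T L"
    unfolding local_martingale_upto_def using stopping_time_horizon[OF T]
    by (intro exI[of _ "\<lambda>_ _. T"]) (auto simp: incseq_def)
  thus "Q \<in> M_a_loc P F T L" using Q by (simp add: M_a_loc_def M_a_def)
qed

context levy
begin

lemma martingale_mean_0:
  assumes Q: "Q \<in> prob_ac P F T" and M: "martingale_upto Q F T (\<lambda>t \<omega>. L (min t (\<tau> \<omega>)) \<omega>)"
    and \<tau>: "\<And>\<omega>. \<omega> \<in> space P \<Longrightarrow> 0 \<le> \<tau> \<omega>"
  shows "(\<integral>\<omega>. L (min T (\<tau> \<omega>)) \<omega> \<partial>Q) = 0"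
proof -
  have "space Q = space P"
    using Q sets_eq_imp_space_eq[of Q "F T"] space_F[OF horizon] by (auto simp: prob_ac_def)
  hence "(\<integral>\<omega>. L (min 0 (\<tau> \<omega>)) \<omega> \<partial>Q) = (\<integral>\<omega>. 0 \<partial>Q)"
    using \<tau> L_0 by (intro Bochner_Integration.integral_cong refl) (simp add: min_absorb1)
  thus ?thesis using martingale_mean_const[OF M horizon(1)] by simp
qed

lemma M_a_subset_M_a_loc_tilde: "M_a P F T L \<subseteq> M_a_loc_tilde P F T L"
proof
  fix Q assume Q: "Q \<in> M_a P F T L"
  hence M: "martingale_upto Q F T L" and ac: "Q \<in> prob_ac P F T" by (auto simp: M_a_def)
  have "martingale_upto Q F T (\<lambda>t \<omega>. L (min t T) \<omega>)"
    using M by (auto simp: martingale_upto_def adapted_process_def min_absorb1)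
  from martingale_mean_0[OF ac this] T_pos have mean: "(\<integral>\<omega>. L T \<omega> \<partial>Q) = 0" by simp
  have int: "integrable Q (L T)" using M T_pos by (simp add: martingale_upto_def)
  show "Q \<in> M_a_loc_tilde P F T L"
    unfolding M_a_loc_tilde_def using ac mean int stopping_time_horizon[OF T_pos]
    by (auto simp: incseq_def intro!: exI[of _ "\<lambda>_ _. T"])
qed

lemma rel_entropy_ge_M_a_loc:
  assumes \<kappa>: "(\<integral>\<^sup>+\<omega>. ennreal (exp (\<theta> * L T \<omega>)) \<partial>P) = ennreal (exp (\<kappa> * T))"
    and Q: "Q \<in> M_a_loc P F T L"
  shows "ereal (- (\<kappa> * T)) \<le> rel_entropy (F T) Q P"
proof -
  from Q have ac: "Q \<in> prob_ac P F T" by (simp add: M_a_loc_def)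
  from Q obtain \<tau> :: "nat \<Rightarrow> 'a \<Rightarrow> real" where \<tau>: "\<And>k. stopping_time_upto F T (\<tau> k)"
    and inc: "AE \<omega> in Q. incseq (\<lambda>k. \<tau> k \<omega>)" and ex: "AE \<omega> in Q. \<exists>k. T \<le> \<tau> k \<omega>"
    and M: "\<And>k. martingale_upto Q F T (\<lambda>t \<omega>. L (min t (\<tau> k \<omega>)) \<omega>)"
    unfolding M_a_loc_def local_martingale_upto_def by blast
  show ?thesis
  proof (rule rel_entropy_ge[OF \<kappa> ac \<tau>])
    fix k
    show "integrable Q (\<lambda>\<omega>. L (min (\<tau> k \<omega>) T) \<omega>)"
      using M[of k] T_pos by (simp add: martingale_upto_def min.commute)
    have "(\<integral>\<omega>. L (min T (\<tau> k \<omega>)) \<omega> \<partial>Q) = 0"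
      using \<tau>[of k] by (intro martingale_mean_0[OF ac M]) (auto simp: stopping_time_upto_def space_F[OF horizon])
    thus "(\<integral>\<omega>. L (min (\<tau> k \<omega>) T) \<omega> \<partial>Q) = 0" by (simp add: min.commute)
  next
    show "AE \<omega> in Q. \<forall>\<^sub>F k in sequentially. T \<le> \<tau> k \<omega>"
      using inc ex
    proof eventually_elim
      case (elim \<omega>)
      then obtain k where "T \<le> \<tau> k \<omega>" by blast
      thus ?case using elim(1)
        unfolding eventually_sequentially incseq_def by (meson order_trans)
    qed
  qed
qed

lemma rel_entropy_ge_M_a_loc_tilde:
  assumes \<kappa>: "(\<integral>\<^sup>+\<omega>. ennreal (exp (\<theta> * L T \<omega>)) \<partial>P) = ennreal (exp (\<kappa> * T))"
    and Q: "Q \<in> M_a_loc_tilde P F T L"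
  shows "ereal (- (\<kappa> * T)) \<le> rel_entropy (F T) Q P"
proof -
  from Q have ac: "Q \<in> prob_ac P F T" by (simp add: M_a_loc_tilde_def)
  obtain \<tau> :: "nat \<Rightarrow> 'a \<Rightarrow> real" where
    props: "(\<forall>k. stopping_time_upto F T (\<tau> k)) \<and>
          incseq (\<lambda>k. {\<omega> \<in> space Q. \<tau> k \<omega> = T}) \<and>
          (\<Union>k. {\<omega> \<in> space Q. \<tau> k \<omega> = T}) = space Q \<and>
          (\<forall>k. integrable Q (\<lambda>\<omega>. L (min (\<tau> k \<omega>) T) \<omega>) \<and>
               (\<integral>\<omega>. L (min (\<tau> k \<omega>) T) \<omega> \<partial>Q) = 0)"
    using Q[unfolded M_a_loc_tilde_def mem_Collect_eq, THEN conjunct2] ..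
  note inc = props[THEN conjunct2, THEN conjunct1]
  note un = props[THEN conjunct2, THEN conjunct2, THEN conjunct1]
  have \<tau>: "stopping_time_upto F T (\<tau> k)"
    and int: "integrable Q (\<lambda>\<omega>. L (min (\<tau> k \<omega>) T) \<omega>)"
    and mean: "(\<integral>\<omega>. L (min (\<tau> k \<omega>) T) \<omega> \<partial>Q) = 0" for k
    using props by simp_all
  show ?thesis
  proof (rule rel_entropy_ge[OF \<kappa> ac \<tau> int mean])
    show "AE \<omega> in Q. \<forall>\<^sub>F k in sequentially. T \<le> \<tau> k \<omega>"
    proof (rule AE_I2)
      fix \<omega> assume w: "\<omega> \<in> space Q"
      then obtain k where k: "\<omega> \<in> {\<omega> \<in> space Q. \<tau> k \<omega> = T}" using un by blast
      have "\<omega> \<in> {\<omega> \<in> space Q. \<tau> j \<omega> = T}" if "k \<le> j" for j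
        using incseqD[OF inc that] k by blast
      thus "\<forall>\<^sub>F k in sequentially. T \<le> \<tau> k \<omega>"
        unfolding eventually_sequentially by (intro exI[of _ k]) auto
    qed
  qed
qed

section \<open>Optimal tilting\<close>

lemma tilt_mass_mono: "n \<le> n' \<Longrightarrow> tilt_mass n \<theta> \<le> tilt_mass n' \<theta>"
  unfolding tilt_mass_def
  by (intro integral_mono integrable_exp_damp mult_left_mono damp_mono) auto

lemma tilt_mass_0_le_1: "tilt_mass n 0 \<le> 1"
proof -
  have "tilt_mass n 0 \<le> (\<integral>\<omega>. 1 \<partial>P)"
    unfolding tilt_mass_def using T_pos damp_le_1 integrable_exp_damp[of 0 n]
    by (intro integral_mono) auto
  thus ?thesis by (simp add: prob_space)
qed

text \<open>
  With the damping factor absorbed into the measure, \<open>tilt_mass n\<close> is a moment generating function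
  that is finite everywhere.
\<close>

definition damped :: "nat \<Rightarrow> 'a measure" where
  "damped n = density P (\<lambda>\<omega>. ennreal (damp n 0 T \<omega>))"

lemma integral_damped:
  fixes f :: "'a \<Rightarrow> real"
  assumes [measurable]: "f \<in> borel_measurable P"
  shows "(\<integral>\<omega>. f \<omega> \<partial>damped n) = (\<integral>\<omega>. f \<omega> * damp n 0 T \<omega> \<partial>P)"
    and "integrable (damped n) f \<longleftrightarrow> integrable P (\<lambda>\<omega>. f \<omega> * damp n 0 T \<omega>)"
  unfolding damped_def using damp_pos[of n 0 T]
  by (subst integral_density integrable_density; auto simp: less_imp_le mult.commute)+

lemma finite_measure_damped: "finite_measure (damped n)"
proof
  have "emeasure (damped n) (space (damped n)) \<le> (\<integral>\<^sup>+\<omega>. 1 \<partial>P)"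
  proof -
    have "emeasure (damped n) (space (damped n)) =
        (\<integral>\<^sup>+\<omega>. ennreal (damp n 0 T \<omega>) * indicator (space P) \<omega> \<partial>P)"
      unfolding damped_def by (subst emeasure_density) auto
    also have "\<dots> \<le> (\<integral>\<^sup>+\<omega>. 1 \<partial>P)"
      using damp_le_1 T_pos by (intro nn_integral_mono) (simp add: ennreal_le_1)
    finally show ?thesis .
  qed
  thus "emeasure (damped n) (space (damped n)) \<noteq> \<infinity>"
    by (auto simp: emeasure_space_1 top_unique)
qed

lemma measure_damped_nonzero:
  assumes "measure P {\<omega> \<in> space P. p \<omega>} \<noteq> 0" and [measurable]: "Measurable.pred P p"
  shows "measure (damped n) {\<omega> \<in> space (damped n). p \<omega>} \<noteq> 0"
proof
  interpret D: finite_measure "damped n" by (rule finite_measure_damped)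
  assume "measure (damped n) {\<omega> \<in> space (damped n). p \<omega>} = 0"
  moreover have "{\<omega> \<in> space (damped n). p \<omega>} = {\<omega> \<in> space P. p \<omega>}" by (simp add: damped_def)
  ultimately have "emeasure (damped n) {\<omega> \<in> space P. p \<omega>} = 0" by (simp add: D.emeasure_eq_measure)
  hence "{\<omega> \<in> space P. p \<omega>} \<in> null_sets (damped n)" by (auto simp: damped_def)
  hence "AE \<omega> in P. \<omega> \<in> {\<omega> \<in> space P. p \<omega>} \<longrightarrow> ennreal (damp n 0 T \<omega>) = 0"
    unfolding damped_def by (subst (asm) null_sets_density_iff) auto
  hence "AE \<omega> in P. \<omega> \<notin> {\<omega> \<in> space P. p \<omega>}"
  proof eventually_elim
    case (elim \<omega>)
    thus ?case using damp_pos[of n 0 T \<omega>] by (auto simp: ennreal_eq_0_iff)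
  qed
  hence "{\<omega> \<in> space P. p \<omega>} \<in> null_sets P" by (subst (asm) AE_iff_null_sets[symmetric]) auto
  thus False using assms(1) by (simp add: null_sets_def measure_def)
qed

lemma tilt_mass_eq_damped: "tilt_mass n \<theta> = (\<integral>\<omega>. exp (\<theta> * L T \<omega>) \<partial>damped n)"
  unfolding tilt_mass_def by (subst integral_damped) simp_all

lemma integrable_exp_damped: "integrable (damped n) (\<lambda>\<omega>. exp (\<theta> * L T \<omega>))"
  using integrable_exp_damp by (subst integral_damped(2)) simp_all

lemma L_T_measurable_damped [measurable]: "L T \<in> borel_measurable (damped n)"
  unfolding damped_def by simp

text \<open>
  At a minimiser the derivative vanishes, which says that \<open>L T\<close> has mean 0 under the tilted measure.
\<close>

lemma tilt_mass_minimiser: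
  assumes "prob {\<omega> \<in> space P. 0 < L T \<omega>} \<noteq> 0" "prob {\<omega> \<in> space P. L T \<omega> < 0} \<noteq> 0"
  obtains \<theta> where "\<forall>\<theta>'. tilt_mass n \<theta> \<le> tilt_mass n \<theta>'"
    and "integrable P (\<lambda>\<omega>. L T \<omega> * tilt n \<theta> \<omega>)"
    and "(\<integral>\<omega>. L T \<omega> * tilt n \<theta> \<omega> \<partial>P) = 0"
proof -
  interpret D: finite_measure "damped n" by (rule finite_measure_damped)
  obtain \<theta> where min: "\<forall>\<theta>'. (\<integral>\<omega>. exp (\<theta> * L T \<omega>) \<partial>damped n) \<le> (\<integral>\<omega>. exp (\<theta>' * L T \<omega>) \<partial>damped n)"
    and mean: "(\<integral>\<omega>. L T \<omega> * exp (\<theta> * L T \<omega>) \<partial>damped n) = 0"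
    using D.mgf_minimiser[OF L_T_measurable_damped integrable_exp_damped
        measure_damped_nonzero[OF assms(1)] measure_damped_nonzero[OF assms(2)]] by auto
  have "integrable (damped n) (\<lambda>\<omega>. L T \<omega> * exp (\<theta> * L T \<omega>))"
    by (rule D.mgf_deriv(1)[OF L_T_measurable_damped integrable_exp_damped])
  hence "integrable P (\<lambda>\<omega>. L T \<omega> * tilt n \<theta> \<omega>)"
    by (subst (asm) integral_damped(2)) (simp_all add: mult.assoc)
  moreover have "(\<integral>\<omega>. L T \<omega> * tilt n \<theta> \<omega> \<partial>P) = 0"
    using mean by (subst (asm) integral_damped(1)) (simp_all add: mult.assoc)
  ultimately show thesis using min by (intro that) (simp_all add: tilt_mass_eq_damped)
qed

text \<open>
  The minimisers for the damped processes stay in a compact set because already the most strongly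
  damped mass is coercive and damping less only increases the mass. A limit point \<open>\<theta>\<close> of
  them satisfies, by Fatou, that its undamped exponential moment is at most the limit of the
  minimal masses.
\<close>

lemma INF_M_efl_le:
  assumes "prob {\<omega> \<in> space P. 0 < L T \<omega>} \<noteq> 0" "prob {\<omega> \<in> space P. L T \<omega> < 0} \<noteq> 0"
  obtains \<theta> \<kappa> where "(\<integral>\<^sup>+\<omega>. ennreal (exp (\<theta> * L T \<omega>)) \<partial>P) = ennreal (exp (\<kappa> * T))"
    and "(INF Q\<in>M_efl P F T L. rel_entropy (F T) Q P) \<le> ereal (- (\<kappa> * T))"
proof -
  let ?v = "INF Q\<in>M_efl P F T L. rel_entropy (F T) Q P"
  define opt where "opt n \<theta> \<longleftrightarrow> (\<forall>\<theta>'. tilt_mass n \<theta> \<le> tilt_mass n \<theta>') \<and>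
     integrable P (\<lambda>\<omega>. L T \<omega> * tilt n \<theta> \<omega>) \<and>
     (\<integral>\<omega>. L T \<omega> * tilt n \<theta> \<omega> \<partial>P) = 0" for n \<theta>
  have "\<exists>\<theta>. opt n \<theta>" for n
    by (rule tilt_mass_minimiser[OF assms, of n]) (simp add: opt_def exI)
  then obtain th where th: "\<And>n. opt n (th n)" by metis
  have min: "tilt_mass n (th n) \<le> tilt_mass n \<theta>"
    and int: "integrable P (\<lambda>\<omega>. L T \<omega> * (tilt n (th n) \<omega>))"
    and mean: "(\<integral>\<omega>. L T \<omega> * (tilt n (th n) \<omega>) \<partial>P) = 0" for n \<theta>
    using th[of n] by (simp_all add: opt_def)
  have v_le: "?v \<le> ereal (- ln (tilt_mass n (th n)))" for n
    by (rule INF_lower2[of "tilted n (th n)"])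
       (rule tilted_in_M_efl[OF int mean], rule rel_entropy_tilted_le[OF int mean])
  have mass_le_1: "tilt_mass n (th n) \<le> 1" for n
    using min[of n 0] tilt_mass_0_le_1[of n] by linarith
  interpret D: finite_measure "damped 0" by (rule finite_measure_damped)
  obtain b where b: "\<forall>\<theta>. b < \<bar>\<theta>\<bar> \<longrightarrow> 1 < tilt_mass 0 \<theta>"
    using D.mgf_coercive[OF L_T_measurable_damped integrable_exp_damped
        measure_damped_nonzero[OF assms(1)] measure_damped_nonzero[OF assms(2)], of 1]
    by (auto simp: tilt_mass_eq_damped)
  have "\<bar>th n\<bar> \<le> b" for n
  proof -
    have "tilt_mass 0 (th n) \<le> 1" using tilt_mass_mono[of 0 n "th n"] mass_le_1[of n] by simp
    thus ?thesis using b[rule_format, of "th n"] by linarith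
  qed
  hence "th n \<in> {- b..b}" for n by (simp add: abs_le_iff minus_le_iff)
  then obtain \<theta> r where r: "strict_mono r" and lim: "(th \<circ> r) \<longlonglongrightarrow> \<theta>"
    using compact_Icc[of "- b" b] unfolding compact_eq_seq_compact_metric seq_compact_def by metis
  let ?Phi = "\<integral>\<^sup>+\<omega>. ennreal (exp (\<theta> * L T \<omega>)) \<partial>P"
  let ?u = "\<lambda>n \<omega>. ennreal (tilt (r n) (th (r n)) \<omega>)"
  have mass: "(\<integral>\<^sup>+\<omega>. ?u n \<omega> \<partial>P) = ennreal (tilt_mass (r n) (th (r n)))" for n
    unfolding tilt_mass_def using damp_pos
    by (intro nn_integral_eq_integral integrable_exp_damp) (auto simp: less_imp_le)
  have "?Phi = (\<integral>\<^sup>+\<omega>. liminf (\<lambda>n. ?u n \<omega>) \<partial>P)"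
  proof (rule nn_integral_cong)
    fix \<omega> assume w: "\<omega> \<in> space P"
    have "(\<lambda>n. damp (r n) 0 T \<omega>) \<longlonglongrightarrow> 1"
      using LIMSEQ_subseq_LIMSEQ[OF damp_tendsto_1[OF w] r] by (simp add: comp_def)
    hence lim_u: "(\<lambda>n. ?u n \<omega>) \<longlonglongrightarrow> ennreal (exp (\<theta> * L T \<omega>) * 1)"
      using lim by (intro tendsto_ennrealI tendsto_mult tendsto_exp tendsto_const) (simp_all add: comp_def)
    show "ennreal (exp (\<theta> * L T \<omega>)) = liminf (\<lambda>n. ?u n \<omega>)"
      using lim_imp_Liminf[OF sequentially_bot lim_u] by simp
  qed
  also have "\<dots> \<le> liminf (\<lambda>n. \<integral>\<^sup>+\<omega>. ?u n \<omega> \<partial>P)"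
    by (rule nn_integral_liminf) measurable
  finally have Phi_le: "?Phi \<le> liminf (\<lambda>n. ennreal (tilt_mass (r n) (th (r n))))"
    by (simp only: mass)
  have Phi_bound: "?Phi \<le> ennreal B" if "\<And>n. tilt_mass n (th n) \<le> B" for B
  proof -
    have "liminf (\<lambda>n. ennreal (tilt_mass (r n) (th (r n)))) \<le> liminf (\<lambda>n. ennreal B)"
      using that by (intro Liminf_mono always_eventually allI ennreal_leI)
    also have "\<dots> = ennreal B" by (simp add: Liminf_const)
    finally show ?thesis using Phi_le by (rule order_trans[rotated])
  qed
  have "?Phi < top" using Phi_bound[OF mass_le_1] by (rule order_le_less_trans) simp
  then obtain x where x: "0 \<le> x" "?Phi = ennreal x" by (cases ?Phi) auto
  have "x \<noteq> 0"
  proof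
    assume "x = 0"
    hence "?Phi = 0" using x by simp
    hence "AE \<omega> in P. ennreal (exp (\<theta> * L T \<omega>)) = 0" by (subst (asm) nn_integral_0_iff_AE) auto
    hence "AE \<omega> in P. False" by eventually_elim (simp add: ennreal_eq_0_iff not_le)
    thus False by simp
  qed
  with x have x0: "0 < x" by simp
  define \<kappa> where "\<kappa> = ln x / T"
  have kT: "\<kappa> * T = ln x" using T_pos by (simp add: \<kappa>_def)
  have Phi: "?Phi = ennreal (exp (\<kappa> * T))" using x x0 by (simp add: kT)
  have "?v \<le> ereal (- (\<kappa> * T))"
  proof (rule ccontr)
    assume "\<not> ?v \<le> ereal (- (\<kappa> * T))"
    hence gt: "ereal (- (\<kappa> * T)) < ?v" by simp
    then obtain y where y: "?v = ereal y" using v_le[of 0] by (cases ?v) auto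
    have "tilt_mass n (th n) \<le> exp (- y)" for n
    proof -
      have "ln (tilt_mass n (th n)) \<le> - y" using v_le[of n] y by simp
      thus ?thesis using tilt_mass_pos by (metis exp_le_cancel_iff exp_ln)
    qed
    hence "?Phi \<le> ennreal (exp (- y))" by (rule Phi_bound)
    hence "exp (\<kappa> * T) \<le> exp (- y)" by (simp add: Phi)
    thus False using gt y by simp
  qed
  with Phi show thesis by (rule that)
qed

end

theorem corollary4p2:
  fixes P :: "'a measure"
    and F :: "real \<Rightarrow> 'a measure"
    and T :: real
    and L :: "real \<Rightarrow> 'a \<Rightarrow> real"
  assumes "0 < T"
    and "levy_process P F T L"
    and "\<not> subordinator P F T L"
    and "\<not> subordinator P F T (\<lambda>t \<omega>. - L t \<omega>)"
  shows "(INF Q\<in>M_efl P F T L. rel_entropy (F T) Q P) = (INF Q\<in>M_a P F T L. rel_entropy (F T) Q P)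
       \<and> (INF Q\<in>M_a P F T L. rel_entropy (F T) Q P) = (INF Q\<in>M_a_loc P F T L. rel_entropy (F T) Q P)
       \<and> (INF Q\<in>M_a_loc P F T L. rel_entropy (F T) Q P)
           = (INF Q\<in>M_a_loc_tilde P F T L. rel_entropy (F T) Q P)"
proof -
  interpret levy P F T L using assms(1,2) by unfold_locales
  let ?H = "\<lambda>C. INF Q\<in>C. rel_entropy (F T) Q P"
  obtain \<theta> \<kappa> where \<kappa>: "(\<integral>\<^sup>+\<omega>. ennreal (exp (\<theta> * L T \<omega>)) \<partial>P) = ennreal (exp (\<kappa> * T))"
    and le: "?H (M_efl P F T L) \<le> ereal (- (\<kappa> * T))"
    using INF_M_efl_le[OF nonmonotone_both_signs[OF assms]] by blast
  have "?H (M_a P F T L) \<le> ?H (M_efl P F T L)"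
    by (intro INF_superset_mono M_efl_subset_M_a order_refl)
  moreover have "?H (M_a_loc P F T L) \<le> ?H (M_a P F T L)"
    by (intro INF_superset_mono M_a_subset_M_a_loc assms(1) order_refl)
  moreover have "?H (M_a_loc_tilde P F T L) \<le> ?H (M_a P F T L)"
    by (intro INF_superset_mono M_a_subset_M_a_loc_tilde order_refl)
  moreover have "?H (M_efl P F T L) \<le> ?H (M_a_loc P F T L)"
    by (intro INF_greatest order_trans[OF le] rel_entropy_ge_M_a_loc[OF \<kappa>])
  moreover have "?H (M_efl P F T L) \<le> ?H (M_a_loc_tilde P F T L)"
    by (intro INF_greatest order_trans[OF le] rel_entropy_ge_M_a_loc_tilde[OF \<kappa>])
  ultimately show ?thesis by (auto intro: antisym)
qed

end
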